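(* Let $X\subseteq A$ be a subset of the annulus such that its displacement energy $e(X)$ is strictly positive. Fix a positive integer $n$. Let $\alpha,\beta\in\mathcal{B}$ be two billiard tables with corresponding billiard ball maps $\psi_\alpha,\psi_\beta$. If \[ d_B(\alpha,\beta)<\frac{e(X)}{4n}, \] then there is a point $x\in X$ with $\psi_\beta^n(x)\in\psi_\alpha^n(X)$.
   Context: Billiard tables. $S^1=\mathbb{R}/\mathbb{Z}$. A billiard table (marked) is a smooth convex body $K\subset\mathbb{R}^2$ whose boundary has length $1$ and positive curvature, together with a point $S\in\partial K$; it is identified with the counterclockwise arc-length parametrization $\gamma\colon S^1\to\mathbb{R}^2$ of $\partial K$ with $\gamma(0)=S$. $\mathcal{B}$ is the set of all such tables. Geometric distance. For $\alpha,\beta\in\mathcal{B}$, $d_B(\alpha,\beta)$ is the infimum of $\int_0^1\max_{q\in S^1}\left\|\frac{\partial\gamma_s}{\partial s}(q)\right\|ds$ over all smooth homotopies $\gamma_s$, $s\in[0,1]$, from $\alpha$ to $\beta$ with $\gamma_s\in\mathcal{B}$ for every $s$. Annulus. $A=S^1\times(-1,1)$ with coordinates $(q,p)$ and symplectic form $\omega=dp\wedge dq$; $\bar A=S^1\times[-1,1]$. Billiard ball map. For $\gamma\in\mathcal{B}$, $\psi_\gamma\colon A\to A$, $\psi_\gamma(q,p)=(Q,P)$, is the unique map (with $Q\ne q$) such that $p=\left\langle\frac{\gamma(Q)-\gamma(q)}{\|\gamma(Q)-\gamma(q)\|},\gamma'(q)\right\rangle$ and $P=\left\langle\frac{\gamma(Q)-\gamma(q)}{\|\gamma(Q)-\gamma(q)\|},\gamma'(Q)\right\rangle$.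 It is a smooth symplectomorphism of $A$ extending continuously to $\bar A$ by the identity on $\partial A$. Hamiltonian paths. A smooth path $\psi_s$, $s\in[0,1]$, of symplectomorphisms of $A$ that extends continuously to a map $\bar A\times[0,1]\to\bar A$ by $\psi_s|_{\partial A}=\mathrm{id}_{\partial A}$ is Hamiltonian if there is a smooth family $H_s\colon A\to\mathbb{R}$ with $i_{X_s}\omega=-dH_s$ for every $s$, where $\frac{d\psi_s}{ds}=X_s\circ\psi_s$, such that $H_s$ extends continuously from $A\times[0,1]$ to $\bar A\times[0,1]$ by $H_s|_{\partial A}=0$. $\mathrm{Ham}(A,\partial A)$ is the set of time-one maps $\psi_1$ of Hamiltonian paths with $\psi_0=\mathrm{id}_A$. Hofer distance. The Hofer length of a Hamiltonian path is $l_H(\psi_s)=\int_0^1(\sup_AH_s-\inf_AH_s)\,ds$, and $d_H(\varphi,\psi)$ is the infimum of Hofer lengths of Hamiltonian paths joining $\varphi$ and $\psi$. Displacement energy. For $X\subseteq A$, $e(X)=\inf\{d_H(\mathrm{id}_A,\psi):\psi\in\mathrm{Ham}(A,\partial A),\ \psi(X)\cap X=\varnothing\}$, with the convention $\inf\varnothing=+\infty$. *)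

theory Defs
  imports "HOL-Analysis.Analysis"
begin

section \<open>Smooth maps on subsets of Euclidean spaces\<close>

text \<open>For open \<open>U\<close> this is the class $C^k$: in finite dimension, being $C^{k+1}$ is
  the same as being differentiable with all directional derivatives of class $C^k$.\<close>

primrec C_k_on ::
  "nat \<Rightarrow> 'a::euclidean_space set \<Rightarrow> ('a \<Rightarrow> 'b::real_normed_vector) \<Rightarrow> bool" where
  "C_k_on 0 U f \<longleftrightarrow> continuous_on U f"
| "C_k_on (Suc k) U f \<longleftrightarrow>
     (\<forall>x\<in>U. f differentiable (at x)) \<and>
     (\<forall>v. C_k_on k U (\<lambda>x. frechet_derivative f (at x) v))"

text \<open>On an arbitrary set, smoothness means local extendability to a smooth map on an open
  set. This is used for sets such as \<open>{0..1} \<times> UNIV\<close>, where smoothness is required up to the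
  boundary.\<close>

definition smooth_on ::
  "'a::euclidean_space set \<Rightarrow> ('a \<Rightarrow> 'b::real_normed_vector) \<Rightarrow> bool" where
  "smooth_on S f \<longleftrightarrow>
     (\<forall>x\<in>S. \<exists>U g. open U \<and> x \<in> U \<and> (\<forall>k. C_k_on k U g) \<and> (\<forall>y\<in>S \<inter> U. f y = g y))"

section \<open>The circle $\mathbb{R}/\mathbb{Z}$\<close>

quotient_type circle = real / "\<lambda>x y::real. \<exists>k::int. y = x + of_int k"
  morphisms rep_circle circ
proof (rule equivpI)
  show "reflp (\<lambda>x y::real. \<exists>k::int. y = x + of_int k)"
    by (rule reflpI) (rule exI[of _ 0], simp)
  show "symp (\<lambda>x y::real. \<exists>k::int. y = x + of_int k)"
  proof (rule sympI)
    fix x y :: real assume "\<exists>k::int. y = x + of_int k"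
    then obtain k :: int where "y = x + of_int k" ..
    then have "x = y + of_int (- k)" by simp
    then show "\<exists>k::int. x = y + of_int k" ..
  qed
  show "transp (\<lambda>x y::real. \<exists>k::int. y = x + of_int k)"
  proof (rule transpI)
    fix x y z :: real
    assume "\<exists>k::int. y = x + of_int k" "\<exists>k::int. z = y + of_int k"
    then obtain k l :: int where "y = x + of_int k" "z = y + of_int l" by blast
    then have "z = x + of_int (k + l)" by simp
    then show "\<exists>k::int. z = x + of_int k" ..
  qed
qed

text \<open>The quotient topology.\<close>

instantiation circle :: topological_space
begin

definition open_circle :: "circle set \<Rightarrow> bool" where
  "open_circle U \<longleftrightarrow> open (circ -` U)"

instance
  by standard (auto simp: open_circle_def vimage_Union)

end

text \<open>The derivative does not depend on the representative of \<open>q\<close>.\<close>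

definition circle_deriv :: "(circle \<Rightarrow> 'a::real_normed_vector) \<Rightarrow> circle \<Rightarrow> 'a" where
  "circle_deriv f q = vector_derivative (\<lambda>t. f (circ t)) (at (rep_circle q))"

section \<open>Billiard tables and the geometric distance\<close>

definition det2 :: "real^2 \<Rightarrow> real^2 \<Rightarrow> real" where
  "det2 u v = u $ 1 * v $ 2 - u $ 2 * v $ 1"

text \<open>A marked table is identified with its counterclockwise arc-length parametrization
  \<open>\<gamma>\<close>, the marked point being \<open>\<gamma> (circ 0)\<close>. As \<open>\<gamma>\<close> is an injective unit speed
  parametrization over a circle of length 1, the boundary has length 1.
  Counterclockwise means that the interior of the body lies to the left of the
  oriented tangent lines; for a unit speed curve \<open>det2 \<gamma>' \<gamma>''\<close> is the signed curvature.\<close>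

definition billiard_tables :: "(circle \<Rightarrow> real^2) set" where
  "billiard_tables =
     {\<gamma>. smooth_on UNIV (\<lambda>t. \<gamma> (circ t)) \<and> inj \<gamma> \<and>
         (\<forall>q. norm (circle_deriv \<gamma> q) = 1) \<and>
         (\<exists>K. compact K \<and> convex K \<and> interior K \<noteq> {} \<and> frontier K = range \<gamma> \<and>
              (\<forall>q. \<forall>x\<in>interior K. det2 (circle_deriv \<gamma> q) (x - \<gamma> q) > 0)) \<and>
         (\<forall>q. det2 (circle_deriv \<gamma> q) (circle_deriv (circle_deriv \<gamma>) q) > 0)}"

definition table_homotopy ::
  "(circle \<Rightarrow> real^2) \<Rightarrow> (circle \<Rightarrow> real^2) \<Rightarrow> (real \<Rightarrow> circle \<Rightarrow> real^2) \<Rightarrow> bool" where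
  "table_homotopy \<alpha> \<beta> \<Gamma> \<longleftrightarrow>
     smooth_on ({0..1} \<times> UNIV) (\<lambda>(s, t). \<Gamma> s (circ t)) \<and>
     (\<forall>s\<in>{0..1}. \<Gamma> s \<in> billiard_tables) \<and> \<Gamma> 0 = \<alpha> \<and> \<Gamma> 1 = \<beta>"

definition homotopy_length :: "(real \<Rightarrow> circle \<Rightarrow> real^2) \<Rightarrow> real" where
  "homotopy_length \<Gamma> =
     integral {0..1}
       (\<lambda>s. SUP q. norm (vector_derivative (\<lambda>r. \<Gamma> r q) (at s within {0..1})))"

definition d_B :: "(circle \<Rightarrow> real^2) \<Rightarrow> (circle \<Rightarrow> real^2) \<Rightarrow> ereal" where
  "d_B \<alpha> \<beta> = (INF \<Gamma>\<in>{\<Gamma>. table_homotopy \<alpha> \<beta> \<Gamma>}. ereal (homotopy_length \<Gamma>))"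

section \<open>The annulus and its symplectomorphisms\<close>

type_synonym phase = "circle \<times> real"

definition annulus :: "phase set" where
  "annulus = UNIV \<times> {-1<..<1}"

definition closed_annulus :: "phase set" where
  "closed_annulus = UNIV \<times> {-1..1}"

definition strip :: "(real \<times> real) set" where
  "strip = UNIV \<times> {-1<..<1}"

definition annulus_cover :: "real \<times> real \<Rightarrow> phase" where
  "annulus_cover = (\<lambda>(t, p). (circ t, p))"

text \<open>The form $dp \wedge dq$ on tangent vectors given by their \<open>(q, p)\<close> components.\<close>

definition omega :: "real \<times> real \<Rightarrow> real \<times> real \<Rightarrow> real" where
  "omega u v = snd u * fst v - snd v * fst u"

text \<open>The covering \<open>annulus_cover\<close> of the annulus by the strip is a local diffeomorphism
  with simply connected total space, so a self-map of the annulus is smooth iff it has a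
  smooth lift. Lifts differ by integer translations, so that their derivatives
  are the derivative of the map in the coordinates \<open>(q, p)\<close>.\<close>

definition smooth_lift :: "(phase \<Rightarrow> phase) \<Rightarrow> (real \<times> real \<Rightarrow> real \<times> real) \<Rightarrow> bool" where
  "smooth_lift \<phi> \<Phi> \<longleftrightarrow>
     smooth_on strip \<Phi> \<and> (\<forall>y\<in>strip. annulus_cover (\<Phi> y) = \<phi> (annulus_cover y))"

definition symplectomorphism :: "(phase \<Rightarrow> phase) \<Rightarrow> bool" where
  "symplectomorphism \<phi> \<longleftrightarrow>
     bij_betw \<phi> annulus annulus \<and>
     (\<exists>\<Phi>. smooth_lift \<phi> \<Phi> \<and>
        (\<forall>y\<in>strip. \<forall>u v.
           omega (frechet_derivative \<Phi> (at y) u) (frechet_derivative \<Phi> (at y) v) = omega u v)) \<and>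
     (\<exists>\<Phi>. smooth_lift (inv_into annulus \<phi>) \<Phi>)"

section \<open>Hamiltonian paths and the Hofer distance\<close>

text \<open>Maps are only considered on the annulus, and paths only for times in \<open>{0..1}\<close>; all
  other values are irrelevant.\<close>

definition symplectic_path ::
  "(real \<Rightarrow> phase \<Rightarrow> phase) \<Rightarrow> (real \<Rightarrow> real \<times> real \<Rightarrow> real \<times> real) \<Rightarrow> bool" where
  "symplectic_path \<psi> \<Psi> \<longleftrightarrow>
     (\<forall>s\<in>{0..1}. symplectomorphism (\<psi> s) \<and> smooth_lift (\<psi> s) (\<Psi> s)) \<and>
     smooth_on ({0..1} \<times> strip) (\<lambda>(s, y). \<Psi> s y) \<and>
     continuous_on ({0..1} \<times> closed_annulus)
       (\<lambda>(s, x). if x \<in> annulus then \<psi> s x else x)"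

text \<open>\<open>generates H \<psi>\<close>: the path \<open>\<psi>\<close>, with a jointly smooth lift \<open>\<Psi>\<close>, is the flow of the
  vector field \<open>X\<close> given by $i_{X_s}\omega = -dH_s$.\<close>

definition generates ::
  "(real \<Rightarrow> phase \<Rightarrow> real) \<Rightarrow> (real \<Rightarrow> phase \<Rightarrow> phase) \<Rightarrow> bool" where
  "generates H \<psi> \<longleftrightarrow>
     smooth_on ({0..1} \<times> strip) (\<lambda>(s, y). H s (annulus_cover y)) \<and>
     continuous_on ({0..1} \<times> closed_annulus)
       (\<lambda>(s, x). if x \<in> annulus then H s x else 0) \<and>
     (\<exists>\<Psi> X. symplectic_path \<psi> \<Psi> \<and>
        (\<forall>s\<in>{0..1}. \<forall>y\<in>strip.
           ((\<lambda>r. \<Psi> r y) has_vector_derivative X s (\<psi> s (annulus_cover y)))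
             (at s within {0..1})) \<and>
        (\<forall>s\<in>{0..1}. \<forall>y\<in>strip. \<forall>v.
           omega (X s (annulus_cover y)) v =
             - frechet_derivative (\<lambda>z. H s (annulus_cover z)) (at y) v))"

definition hamiltonian_path :: "(real \<Rightarrow> phase \<Rightarrow> phase) \<Rightarrow> bool" where
  "hamiltonian_path \<psi> \<longleftrightarrow> (\<exists>H. generates H \<psi>)"

definition joins ::
  "(real \<Rightarrow> phase \<Rightarrow> phase) \<Rightarrow> (phase \<Rightarrow> phase) \<Rightarrow> (phase \<Rightarrow> phase) \<Rightarrow> bool" where
  "joins \<psi> \<phi>\<^sub>0 \<phi>\<^sub>1 \<longleftrightarrow> (\<forall>x\<in>annulus. \<psi> 0 x = \<phi>\<^sub>0 x \<and> \<psi> 1 x = \<phi>\<^sub>1 x)"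

definition Ham :: "(phase \<Rightarrow> phase) set" where
  "Ham = {\<phi>. \<exists>\<psi>. hamiltonian_path \<psi> \<and> joins \<psi> id \<phi>}"

text \<open>The Hofer length of a path is a function of its Hamiltonian, which the path determines
  on the annulus because of the boundary condition. The suprema and
  infima are finite, as \<open>H\<close> extends continuously to the compact closed annulus.\<close>

definition hofer_length :: "(real \<Rightarrow> phase \<Rightarrow> real) \<Rightarrow> real" where
  "hofer_length H = integral {0..1} (\<lambda>s. (SUP x\<in>annulus. H s x) - (INF x\<in>annulus. H s x))"

definition d_H :: "(phase \<Rightarrow> phase) \<Rightarrow> (phase \<Rightarrow> phase) \<Rightarrow> ereal" where
  "d_H \<phi>\<^sub>0 \<phi>\<^sub>1 =
     (INF (H, \<psi>)\<in>{(H, \<psi>). generates H \<psi> \<and> joins \<psi> \<phi>\<^sub>0 \<phi>\<^sub>1}. ereal (hofer_length H))"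

definition displacement_energy :: "phase set \<Rightarrow> ereal" where
  "displacement_energy X = (INF \<phi>\<in>{\<phi>\<in>Ham. \<phi> ` X \<inter> X = {}}. d_H id \<phi>)"

section \<open>The billiard ball map\<close>

definition chord_dir :: "(circle \<Rightarrow> real^2) \<Rightarrow> circle \<Rightarrow> circle \<Rightarrow> real^2" where
  "chord_dir \<gamma> q Q = (\<gamma> Q - \<gamma> q) /\<^sub>R norm (\<gamma> Q - \<gamma> q)"

text \<open>Only meaningful for \<open>\<gamma> \<in> billiard_tables\<close> and points of the annulus.\<close>

definition billiard_map :: "(circle \<Rightarrow> real^2) \<Rightarrow> phase \<Rightarrow> phase" where
  "billiard_map \<gamma> = (\<lambda>(q, p). THE (Q, P).
     Q \<noteq> q \<and>
     p = chord_dir \<gamma> q Q \<bullet> circle_deriv \<gamma> q \<and>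
     P = chord_dir \<gamma> q Q \<bullet> circle_deriv \<gamma> Q)"

end

theory Submission
  imports Defs
begin

text \<open>The chord length \<open>L(s, t, T)\<close> between the boundary points with parameters \<open>t\<close> and \<open>T\<close>
  of the table at time \<open>s\<close> of a homotopy is a generating function of the billiard ball map:
  $dL = K\,ds - p\,dt + P\,dT$, where $K = \partial_s L$. Taking the exterior derivative
  shows that the billiard ball maps of a homotopy form a Hamiltonian path whose Hamiltonian,
  pulled back along the path, is \<open>-K\<close>. As \<open>K\<close> is the component along the chord of the
  difference of the velocities of the homotopy at its endpoints, it is at most twice the maximal
  speed, so that the oscillation of the Hamiltonian is at most four times the speed. Pulled back Hamiltonians
  add up under composition, so the path from the identity to
  $\psi_\alpha^{-n} \circ \psi_\beta^n$ obtained from the \<open>n\<close>-th iterates has Hofer length at most \<open>4 n\<close> times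
  the length of the homotopy. If this is smaller than \<open>e(X)\<close>, then \<open>X\<close> is not displaced.

  The billiard ball map is invertible because trajectories can be run backwards. It is well
  defined and smooth because the angle of a chord with the boundary at its starting point is
  strictly monotone in the endpoint, by strict convexity.\<close>

section \<open>Smooth functions\<close>

text \<open>Derivatives are taken in the full space and on open sets, whereas a homotopy is given
  for times in [0,1] only. The geometry is therefore developed for families over all real times, on
  the open product of the time axis with the strip that covers the annulus. Passing down to the
  annulus then only requires invariance under integer shifts.

  Exterior calculus appears in coordinates: a two-form identity is an equation for every pair of
  space-time vectors, and closedness of the differential of \<open>L\<close> is the symmetry of
  second derivatives. Composing paths amounts to pulling such an identity back, so the vector field
  of a composite never has to be computed.

  The delicate place is the boundary of the annulus, where chords shrink to points and smoothness is
  lost. Continuity there comes from comparing both ends of one chord: the change of momentum and the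
  function \<open>K\<close> are inner products of a unit vector with the difference of a periodic
  continuous function at the two ends, and this difference tends to zero.\<close>

lemma frechet_derivative_cong_open:
  assumes "open U" "x \<in> U" "\<And>y. y \<in> U \<Longrightarrow> f y = g y"
  shows "frechet_derivative f (at x) = frechet_derivative g (at x)"
proof -
  have "(f has_derivative D) (at x) \<longleftrightarrow> (g has_derivative D) (at x)" for D
    using assms has_derivative_transform_within_open[of f D x UNIV U g]
      has_derivative_transform_within_open[of g D x UNIV U f] by auto
  then show ?thesis unfolding frechet_derivative_def by simp
qed

lemma differentiable_cong_open:
  assumes "open U" "x \<in> U" "\<And>y. y \<in> U \<Longrightarrow> f y = g y" "f differentiable (at x)"
  shows "g differentiable (at x)"
  using assms unfolding differentiable_def
  by (meson has_derivative_transform_within_open)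

lemma C_k_on_cong:
  assumes "open U" "\<And>y. y \<in> U \<Longrightarrow> f y = g y" "C_k_on k U f"
  shows "C_k_on k U g"
  using assms(2,3)
proof (induction k arbitrary: f g)
  case 0
  then show ?case by (simp cong: continuous_on_cong)
next
  case (Suc k)
  have "g differentiable (at x)" if "x \<in> U" for x
    using differentiable_cong_open[OF assms(1) that, of f g] Suc.prems that by auto
  moreover have "C_k_on k U (\<lambda>x. frechet_derivative g (at x) v)" for v
  proof (rule Suc.IH[of "\<lambda>x. frechet_derivative f (at x) v"])
    show "frechet_derivative f (at x) v = frechet_derivative g (at x) v" if "x \<in> U" for x
      using frechet_derivative_cong_open[OF assms(1) that, of f g] Suc.prems(1) by simp
  qed (use Suc.prems in auto)
  ultimately show ?case by simp
qed

lemma C_k_on_imp_continuous_on: "C_k_on k U f \<Longrightarrow> continuous_on U f"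
  by (cases k) (auto intro!: continuous_at_imp_continuous_on differentiable_imp_continuous_within)

lemma C_k_on_Suc_D: "C_k_on (Suc k) U f \<Longrightarrow> C_k_on k U f"
proof (induction k arbitrary: f)
  case 0
  then show ?case using C_k_on_imp_continuous_on[of "Suc 0" U f] by simp
next
  case (Suc k)
  then show ?case by (metis C_k_on.simps(2))
qed

lemma C_k_on_subset: "C_k_on k U f \<Longrightarrow> V \<subseteq> U \<Longrightarrow> C_k_on k V f"
  by (induction k arbitrary: f) (auto intro: continuous_on_subset)

text \<open>The recursion in \<open>C_k_on\<close> speaks of \<open>frechet_derivative\<close>; this
  rule accepts any explicit formula for the derivative, which is what the inductions on the order
  supply.\<close>

lemma C_k_on_SucI:
  assumes "open U" "\<And>x. x \<in> U \<Longrightarrow> (f has_derivative D x) (at x)"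
    "\<And>v. C_k_on k U (\<lambda>x. D x v)"
  shows "C_k_on (Suc k) U f"
proof -
  have "C_k_on k U (\<lambda>x. frechet_derivative f (at x) v)" for v
  proof (rule C_k_on_cong[OF assms(1) _ assms(3)])
    show "D x v = frechet_derivative f (at x) v" if "x \<in> U" for x
      using frechet_derivative_at[OF assms(2)[OF that]] by simp
  qed
  then show ?thesis using assms(2) by (auto simp: differentiable_def)
qed

lemma C_k_on_const: "C_k_on k U (\<lambda>_. c)"
  by (induction k arbitrary: c) auto

lemma C_k_on_linear:
  assumes "open U" "bounded_linear f"
  shows "C_k_on k U f"
proof (cases k)
  case 0
  then show ?thesis using assms by (simp add: linear_continuous_on)
next
  case (Suc m)
  have "C_k_on (Suc m) U f"
    by (rule C_k_on_SucI[OF assms(1) bounded_linear_imp_has_derivative[OF assms(2)] C_k_on_const])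
  then show ?thesis using Suc by simp
qed

lemma C_k_on_has_derivative:
  "C_k_on (Suc k) U f \<Longrightarrow> x \<in> U \<Longrightarrow> (f has_derivative frechet_derivative f (at x)) (at x)"
  by (simp add: frechet_derivative_works)

lemma C_k_on_linear_comp:
  assumes "open U" "bounded_linear l" "C_k_on k U f"
  shows "C_k_on k U (\<lambda>x. l (f x))"
  using assms(3)
proof (induction k arbitrary: f)
  case 0
  then show ?case
    using continuous_on_compose2[OF linear_continuous_on[OF assms(2), of UNIV]] by auto
next
  case (Suc k)
  show ?case
  proof (rule C_k_on_SucI[OF assms(1)])
    show "((\<lambda>x. l (f x)) has_derivative (\<lambda>v. l (frechet_derivative f (at x) v))) (at x)"
      if "x \<in> U" for x
      using bounded_linear.has_derivative[OF assms(2) C_k_on_has_derivative[OF Suc.prems that]] .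
    show "C_k_on k U (\<lambda>x. l (frechet_derivative f (at x) v))" for v
      using Suc by auto
  qed
qed

lemma C_k_on_add:
  assumes "open U" "C_k_on k U f" "C_k_on k U g"
  shows "C_k_on k U (\<lambda>x. f x + g x)"
  using assms(2,3)
proof (induction k arbitrary: f g)
  case 0
  then show ?case by (auto intro: continuous_intros)
next
  case (Suc k)
  show ?case
  proof (rule C_k_on_SucI[OF assms(1)])
    show "((\<lambda>x. f x + g x) has_derivative
        (\<lambda>v. frechet_derivative f (at x) v + frechet_derivative g (at x) v)) (at x)" if "x \<in> U" for x
      using Suc.prems that by (auto intro!: has_derivative_add C_k_on_has_derivative)
    show "C_k_on k U (\<lambda>x. frechet_derivative f (at x) v + frechet_derivative g (at x) v)" for v
      using Suc by auto
  qed
qed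

lemma C_k_on_sum:
  assumes "open U" "\<And>i. i \<in> I \<Longrightarrow> C_k_on k U (f i)"
  shows "C_k_on k U (\<lambda>x. \<Sum>i\<in>I. f i x)"
  using assms(2)
  by (induction I rule: infinite_finite_induct) (auto simp: C_k_on_const intro: C_k_on_add[OF assms(1)])

lemma C_k_on_bilinear:
  assumes "open U" "bounded_bilinear b" "C_k_on k U f" "C_k_on k U g"
  shows "C_k_on k U (\<lambda>x. b (f x) (g x))"
  using assms(3,4)
proof (induction k arbitrary: f g)
  case 0
  then show ?case using bounded_bilinear.continuous_on[OF assms(2)] by auto
next
  case (Suc k)
  show ?case
  proof (rule C_k_on_SucI[OF assms(1)])
    show "((\<lambda>x. b (f x) (g x)) has_derivative
        (\<lambda>v. b (f x) (frechet_derivative g (at x) v) + b (frechet_derivative f (at x) v) (g x))) (at x)"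
      if "x \<in> U" for x
      using Suc.prems that
      by (auto intro!: bounded_bilinear.FDERIV[OF assms(2)] C_k_on_has_derivative)
    show "C_k_on k U (\<lambda>x. b (f x) (frechet_derivative g (at x) v) + b (frechet_derivative f (at x) v) (g x))" for v
      using Suc.prems
      by (intro C_k_on_add[OF assms(1)] Suc.IH) (blast dest: C_k_on_Suc_D | simp)+
  qed
qed

text \<open>In the chain rule the direction in which \<open>g\<close> is differentiated varies with
  the point, whereas the recursion controls derivatives in fixed directions. Expanding that
  direction in the basis separates the two dependences, and products are handled by
  \<open>C_k_on_bilinear\<close>.\<close>

lemma C_k_on_compose:
  fixes f :: "'a::euclidean_space \<Rightarrow> 'b::euclidean_space" and g :: "'b \<Rightarrow> 'c::real_normed_vector"
  assumes "open U" "open V" "f ` U \<subseteq> V" "C_k_on k V g" "C_k_on k U f"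
  shows "C_k_on k U (\<lambda>x. g (f x))"
  using assms(4,5)
proof (induction k arbitrary: g)
  case 0
  then show ?case using assms(3) by (auto intro: continuous_on_compose2)
next
  case (Suc k)
  let ?Df = "\<lambda>x. frechet_derivative f (at x)" and ?Dg = "\<lambda>x. frechet_derivative g (at x)"
  have Dg: "(g has_derivative ?Dg y) (at y)" if "y \<in> V" for y
    using C_k_on_has_derivative[OF Suc.prems(1) that] .
  show ?case
  proof (rule C_k_on_SucI[OF assms(1)])
    show "((\<lambda>x. g (f x)) has_derivative (\<lambda>v. \<Sum>b\<in>Basis. (?Df x v \<bullet> b) *\<^sub>R ?Dg (f x) b)) (at x)"
      if "x \<in> U" for x
    proof -
      have D: "(g has_derivative ?Dg (f x)) (at (f x))" using Dg assms(3) that by auto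
      have "linear (?Dg (f x))" using has_derivative_linear[OF D] .
      then have "?Dg (f x) (?Df x v) = (\<Sum>b\<in>Basis. (?Df x v \<bullet> b) *\<^sub>R ?Dg (f x) b)" for v
        by (subst (1) euclidean_representation[of "?Df x v", symmetric])
          (simp add: linear_sum linear_scale)
      then show ?thesis
        using has_derivative_compose[OF C_k_on_has_derivative[OF Suc.prems(2) that] D] by simp
    qed
    show "C_k_on k U (\<lambda>x. \<Sum>b\<in>Basis. (?Df x v \<bullet> b) *\<^sub>R ?Dg (f x) b)" for v
    proof (intro C_k_on_sum[OF assms(1)] C_k_on_bilinear[OF assms(1) bounded_bilinear_scaleR])
      fix b :: 'b
      show "C_k_on k U (\<lambda>x. ?Df x v \<bullet> b)"
        using Suc.prems by (intro C_k_on_linear_comp[OF assms(1) bounded_linear_inner_left]) simp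
      show "C_k_on k U (\<lambda>x. ?Dg (f x) b)"
        using Suc.prems by (intro Suc.IH) (blast dest: C_k_on_Suc_D | simp)+
    qed
  qed
qed

text \<open>Openness is built in because the derivatives in \<open>C_k_on\<close> are taken in the
  full space; on an open set they depend only on the values of the map there.\<close>

definition C_inf_on :: "'a::euclidean_space set \<Rightarrow> ('a \<Rightarrow> 'b::real_normed_vector) \<Rightarrow> bool" where
  "C_inf_on U f \<longleftrightarrow> open U \<and> (\<forall>k. C_k_on k U f)"

section \<open>Closure properties of smooth maps\<close>

named_theorems C_inf_intros

lemma C_inf_onD: "C_inf_on U f \<Longrightarrow> C_k_on k U f" "C_inf_on U f \<Longrightarrow> open U"
  by (auto simp: C_inf_on_def)

lemma C_inf_on_cong: "C_inf_on U f \<Longrightarrow> (\<And>x. x \<in> U \<Longrightarrow> f x = g x) \<Longrightarrow> C_inf_on U g"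
  unfolding C_inf_on_def using C_k_on_cong by blast

lemma C_inf_on_subset: "C_inf_on U f \<Longrightarrow> open V \<Longrightarrow> V \<subseteq> U \<Longrightarrow> C_inf_on V f"
  unfolding C_inf_on_def using C_k_on_subset by blast

lemma C_inf_on_imp_continuous_on: "C_inf_on U f \<Longrightarrow> continuous_on U f"
  using C_k_on_imp_continuous_on C_inf_onD(1) by blast

lemma C_inf_on_imp_smooth_on: "C_inf_on U f \<Longrightarrow> S \<subseteq> U \<Longrightarrow> smooth_on S f"
  unfolding C_inf_on_def smooth_on_def by blast

text \<open>Serves to glue the local extensions that \<open>smooth_on\<close> provides.\<close>

lemma C_inf_on_local:
  assumes "open U" "\<And>x. x \<in> U \<Longrightarrow> \<exists>V. x \<in> V \<and> C_inf_on V f"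
  shows "C_inf_on U f"
proof -
  have loc: "C_k_on k U f" if "open U" "\<And>x. x \<in> U \<Longrightarrow> \<exists>V. open V \<and> x \<in> V \<and> C_k_on k V f"
    for k and f :: "'a \<Rightarrow> 'b"
    using that(2)
  proof (induction k arbitrary: f)
    case 0
    have "continuous_on U f"
      by (intro continuous_at_imp_continuous_on ballI)
        (use 0 in \<open>metis C_k_on.simps(1) continuous_on_eq_continuous_at\<close>)
    then show ?case by simp
  next
    case (Suc k)
    have "C_k_on k U (\<lambda>x. frechet_derivative f (at x) v)" for v
    proof (rule Suc.IH)
      show "\<exists>V. open V \<and> x \<in> V \<and> C_k_on k V (\<lambda>x. frechet_derivative f (at x) v)" if "x \<in> U" for x
        using Suc.prems[OF that] by auto
    qed
    moreover have "f differentiable (at x)" if "x \<in> U" for x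
      using Suc.prems[OF that] by auto
    ultimately show ?case by simp
  qed
  then show ?thesis
    using assms unfolding C_inf_on_def by meson
qed

lemma C_inf_on_has_derivative:
  "C_inf_on U f \<Longrightarrow> x \<in> U \<Longrightarrow> (f has_derivative frechet_derivative f (at x)) (at x)"
  using C_k_on_has_derivative[of 0 U f x] C_inf_onD by blast

lemma C_inf_on_frechet_derivative [C_inf_intros]:
  "C_inf_on U f \<Longrightarrow> C_inf_on U (\<lambda>x. frechet_derivative f (at x) v)"
  unfolding C_inf_on_def using C_k_on.simps(2) by blast

lemma C_inf_on_const [C_inf_intros]: "open U \<Longrightarrow> C_inf_on U (\<lambda>_. c)"
  by (simp add: C_inf_on_def C_k_on_const)

lemma C_inf_on_linear: "open U \<Longrightarrow> bounded_linear f \<Longrightarrow> C_inf_on U f"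
  by (simp add: C_inf_on_def C_k_on_linear)

lemma C_inf_on_ident [C_inf_intros]: "open U \<Longrightarrow> C_inf_on U (\<lambda>x. x)"
  by (simp add: C_inf_on_linear bounded_linear_ident)

lemma C_inf_on_linear_comp: "bounded_linear l \<Longrightarrow> C_inf_on U f \<Longrightarrow> C_inf_on U (\<lambda>x. l (f x))"
  unfolding C_inf_on_def using C_k_on_linear_comp by blast

lemmas C_inf_on_fst [C_inf_intros] = C_inf_on_linear_comp[OF bounded_linear_fst]
  and C_inf_on_snd [C_inf_intros] = C_inf_on_linear_comp[OF bounded_linear_snd]
  and C_inf_on_minus [C_inf_intros] = C_inf_on_linear_comp[OF bounded_linear_minus[OF bounded_linear_ident]]

lemma C_inf_on_add [C_inf_intros]:
  "C_inf_on U f \<Longrightarrow> C_inf_on U g \<Longrightarrow> C_inf_on U (\<lambda>x. f x + g x)"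
  by (simp add: C_inf_on_def C_k_on_add)

lemma C_inf_on_diff [C_inf_intros]:
  "C_inf_on U f \<Longrightarrow> C_inf_on U g \<Longrightarrow> C_inf_on U (\<lambda>x. f x - g x)"
  using C_inf_on_add[OF _ C_inf_on_minus, of U f g] by simp

lemma C_inf_on_bilinear:
  "bounded_bilinear b \<Longrightarrow> C_inf_on U f \<Longrightarrow> C_inf_on U g \<Longrightarrow> C_inf_on U (\<lambda>x. b (f x) (g x))"
  by (simp add: C_inf_on_def C_k_on_bilinear)

lemmas C_inf_on_mult [C_inf_intros] = C_inf_on_bilinear[OF bounded_bilinear_mult]
  and C_inf_on_scaleR [C_inf_intros] = C_inf_on_bilinear[OF bounded_bilinear_scaleR]
  and C_inf_on_inner [C_inf_intros] = C_inf_on_bilinear[OF bounded_bilinear_inner]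

lemma C_k_on_Pair:
  assumes "open U" "C_k_on k U f" "C_k_on k U g"
  shows "C_k_on k U (\<lambda>x. (f x, g x))"
proof -
  have "bounded_linear (\<lambda>a::'b. (a, 0::'c))" "bounded_linear (\<lambda>b::'c. (0::'b, b))"
    by (auto intro: bounded_linear_Pair bounded_linear_ident bounded_linear_zero)
  then have "C_k_on k U (\<lambda>x. (f x, 0) + (0, g x))"
    using assms by (intro C_k_on_add C_k_on_linear_comp[where l = "\<lambda>a. (a, 0)"]
        C_k_on_linear_comp[where l = "\<lambda>b. (0, b)"])
  then show ?thesis by simp
qed

lemma C_inf_on_Pair [C_inf_intros]:
  "C_inf_on U f \<Longrightarrow> C_inf_on U g \<Longrightarrow> C_inf_on U (\<lambda>x. (f x, g x))"
  by (simp add: C_inf_on_def C_k_on_Pair)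

lemma C_inf_on_compose:
  fixes f :: "'a::euclidean_space \<Rightarrow> 'b::euclidean_space" and g :: "'b \<Rightarrow> 'c::real_normed_vector"
  assumes "C_inf_on V g" "C_inf_on U f" "f ` U \<subseteq> V"
  shows "C_inf_on U (\<lambda>x. g (f x))"
  using assms C_k_on_compose unfolding C_inf_on_def by blast

section \<open>Reciprocal, square root, cosine and norm\<close>

lemma C_inf_on_inverse: "C_inf_on {x::real. x \<noteq> 0} inverse"
proof -
  have o: "open {x::real. x \<noteq> 0}" by (simp add: open_Collect_neq)
  have "C_k_on k {x::real. x \<noteq> 0} inverse" for k
  proof (induction k)
    case 0
    show ?case by (auto intro!: continuous_intros)
  next
    case (Suc k)
    show ?case
    proof (rule C_k_on_SucI[OF o])
      show "(inverse has_derivative (\<lambda>h. - (inverse x * h * inverse x))) (at x)"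
        if "x \<in> {x::real. x \<noteq> 0}" for x
        using that by (auto intro: has_derivative_inverse')
      have "C_k_on k {x::real. x \<noteq> 0} (\<lambda>x. (-1) * (inverse x * v * inverse x))" for v
        by (intro C_k_on_bilinear[OF o bounded_bilinear_mult] C_k_on_const Suc)
      then show "C_k_on k {x::real. x \<noteq> 0} (\<lambda>x. - (inverse x * v * inverse x))" for v
        by simp
    qed
  qed
  then show ?thesis using o by (simp add: C_inf_on_def)
qed

lemma C_inf_on_sqrt: "C_inf_on {0<..} sqrt"
proof -
  have o: "open {0::real<..}" by simp
  have "C_k_on k {0<..} sqrt" for k
  proof (induction k)
    case 0
    show ?case by (auto intro!: continuous_intros)
  next
    case (Suc k)
    show ?case
    proof (rule C_k_on_SucI[OF o])
      show "(sqrt has_derivative (\<lambda>h. inverse (sqrt x) * (h / 2))) (at x)" if "x \<in> {0<..}" for x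
        using DERIV_real_sqrt[of x] that unfolding has_field_derivative_def
        by (auto elim!: has_derivative_eq_rhs simp: field_simps)
      \<comment> \<open>The derivative of the square root is half its reciprocal, so the induction
        hypothesis for \<open>sqrt\<close> itself suffices.\<close>
      have "C_k_on k {0<..} (\<lambda>x. inverse (sqrt x))"
        using C_k_on_compose[OF o _ _ C_inf_onD(1)[OF C_inf_on_inverse] Suc]
          C_inf_onD(2)[OF C_inf_on_inverse] by (force simp del: C_k_on.simps)
      then show "C_k_on k {0<..} (\<lambda>x. inverse (sqrt x) * (v / 2))" for v
        by (intro C_k_on_bilinear[OF o bounded_bilinear_mult] C_k_on_const)
    qed
  qed
  then show ?thesis by (simp add: C_inf_on_def)
qed

lemma C_inf_on_cos: "C_inf_on UNIV (cos :: real \<Rightarrow> real)"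
proof -
  \<comment> \<open>Up to sign each function is the derivative of the other, so the induction has to
    carry both.\<close>
  have "C_k_on k UNIV (sin :: real \<Rightarrow> real) \<and> C_k_on k UNIV (cos :: real \<Rightarrow> real)" for k
  proof (induction k)
    case 0
    show ?case by (auto intro!: continuous_intros)
  next
    case (Suc k)
    have "C_k_on (Suc k) UNIV (sin :: real \<Rightarrow> real)"
    proof (rule C_k_on_SucI)
      show "(sin has_derivative (\<lambda>h. cos x * h)) (at x)" for x :: real
        using DERIV_sin[of x] by (simp add: has_field_derivative_def)
      show "C_k_on k UNIV (\<lambda>x::real. cos x * v)" for v
        using Suc by (intro C_k_on_bilinear[OF _ bounded_bilinear_mult] C_k_on_const) auto
    qed auto
    moreover have "C_k_on (Suc k) UNIV (cos :: real \<Rightarrow> real)"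
    proof (rule C_k_on_SucI)
      show "(cos has_derivative (\<lambda>h. sin x * (- h))) (at x)" for x :: real
        using DERIV_cos[of x] unfolding has_field_derivative_def
        by (elim has_derivative_eq_rhs) auto
      show "C_k_on k UNIV (\<lambda>x::real. sin x * (- v))" for v
        using Suc by (intro C_k_on_bilinear[OF _ bounded_bilinear_mult] C_k_on_const) auto
    qed auto
    ultimately show ?case by simp
  qed
  then show ?thesis by (simp add: C_inf_on_def)
qed

lemma C_inf_on_norm:
  fixes f :: "'a::euclidean_space \<Rightarrow> 'b::real_inner"
  assumes "C_inf_on U f" "\<And>x. x \<in> U \<Longrightarrow> f x \<noteq> 0"
  shows "C_inf_on U (\<lambda>x. norm (f x))"
  unfolding norm_eq_sqrt_inner
  using assms by (intro C_inf_on_compose[OF C_inf_on_sqrt] C_inf_intros) auto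

lemma C_inf_on_inverse_comp:
  fixes f :: "'a::euclidean_space \<Rightarrow> real"
  assumes "C_inf_on U f" "\<And>x. x \<in> U \<Longrightarrow> f x \<noteq> 0"
  shows "C_inf_on U (\<lambda>x. inverse (f x))"
  using assms by (intro C_inf_on_compose[OF C_inf_on_inverse]) auto

text \<open>Two mean value theorems: one for the difference in direction \<open>w\<close> as a
  function of the parameter along \<open>v\<close>, then one for the derivative along
  \<open>v\<close> as a function of the parameter along \<open>w\<close>. The bound on
  \<open>h\<close> keeps the whole parallelogram in the ball.\<close>

lemma second_difference_mvt:
  fixes f :: "'a::euclidean_space \<Rightarrow> real"
  assumes f: "C_inf_on U f" and sub: "ball x r \<subseteq> U" and h: "h > 0" "h * (norm v + norm w) < r"
  obtains a b where "0 < a" "a < h" "0 < b" "b < h"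
    "f (x + h *\<^sub>R v + h *\<^sub>R w) - f (x + h *\<^sub>R v) - f (x + h *\<^sub>R w) + f x =
      h\<^sup>2 * frechet_derivative (\<lambda>y. frechet_derivative f (at y) v) (at (x + a *\<^sub>R v + b *\<^sub>R w)) w"
proof -
  define Dv where "Dv = (\<lambda>y. frechet_derivative f (at y) v)"
  have Dv: "C_inf_on U Dv" unfolding Dv_def using f by (intro C_inf_intros)
  have inU: "x + a *\<^sub>R v + b *\<^sub>R w \<in> U" if "0 \<le> a" "a \<le> h" "0 \<le> b" "b \<le> h" for a b
  proof -
    have "norm (a *\<^sub>R v + b *\<^sub>R w) \<le> a * norm v + b * norm w"
      using that by (metis abs_of_nonneg norm_scaleR norm_triangle_ineq)
    also have "\<dots> \<le> h * norm v + h * norm w"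
      using that by (intro add_mono mult_right_mono) auto
    also have "\<dots> < r" using h(2) by (simp add: algebra_simps)
    finally have "dist x (x + (a *\<^sub>R v + b *\<^sub>R w)) < r"
      using norm_minus_cancel[of "a *\<^sub>R v + b *\<^sub>R w"] by (simp add: dist_norm)
    then show ?thesis using sub by (auto simp: add.assoc)
  qed
  have der: "((\<lambda>a. g (c + a *\<^sub>R u)) has_real_derivative frechet_derivative g (at (c + a *\<^sub>R u)) u) (at a)"
    if "C_inf_on U g" "c + a *\<^sub>R u \<in> U" for g :: "'a \<Rightarrow> real" and c u a
  proof -
    have D: "(g has_derivative frechet_derivative g (at (c + a *\<^sub>R u))) (at (c + a *\<^sub>R u))"
      using C_inf_on_has_derivative that by blast
    have "((\<lambda>a. c + a *\<^sub>R u) has_derivative (\<lambda>t. t *\<^sub>R u)) (at a)"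
      by (auto intro!: derivative_eq_intros)
    from has_derivative_compose[OF this D]
    have "((\<lambda>a. g (c + a *\<^sub>R u)) has_derivative
        (\<lambda>t. frechet_derivative g (at (c + a *\<^sub>R u)) (t *\<^sub>R u))) (at a)" .
    then show ?thesis unfolding has_field_derivative_def
      by (elim has_derivative_eq_rhs)
        (simp add: fun_eq_iff linear_scale[OF has_derivative_linear[OF D]])
  qed
  define \<phi> where "\<phi> = (\<lambda>a. f (x + h *\<^sub>R w + a *\<^sub>R v) - f (x + a *\<^sub>R v))"
  have "(\<phi> has_real_derivative Dv (x + h *\<^sub>R w + a *\<^sub>R v) - Dv (x + a *\<^sub>R v)) (at a)"
    if "0 \<le> a" "a \<le> h" for a
    unfolding \<phi>_def Dv_def using that inU[of a h] inU[of a 0] h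
    by (intro DERIV_diff der f) (auto simp: add_ac)
  then obtain a where a: "0 < a" "a < h"
    and \<phi>: "\<phi> h - \<phi> 0 = (h - 0) * (Dv (x + h *\<^sub>R w + a *\<^sub>R v) - Dv (x + a *\<^sub>R v))"
    using MVT2[of 0 h \<phi> "\<lambda>a. Dv (x + h *\<^sub>R w + a *\<^sub>R v) - Dv (x + a *\<^sub>R v)"] h by auto
  have "((\<lambda>b. Dv (x + a *\<^sub>R v + b *\<^sub>R w)) has_real_derivative
      frechet_derivative Dv (at (x + a *\<^sub>R v + b *\<^sub>R w)) w) (at b)" if "0 \<le> b" "b \<le> h" for b
    using that inU[of a b] a by (intro der Dv) auto
  then obtain b where b: "0 < b" "b < h"
    and "Dv (x + a *\<^sub>R v + h *\<^sub>R w) - Dv (x + a *\<^sub>R v + 0 *\<^sub>R w) =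
      (h - 0) * frechet_derivative Dv (at (x + a *\<^sub>R v + b *\<^sub>R w)) w"
    using MVT2[of 0 h "\<lambda>b. Dv (x + a *\<^sub>R v + b *\<^sub>R w)"
        "\<lambda>b. frechet_derivative Dv (at (x + a *\<^sub>R v + b *\<^sub>R w)) w"] h by auto
  with \<phi> have "\<phi> h - \<phi> 0 = h\<^sup>2 * frechet_derivative Dv (at (x + a *\<^sub>R v + b *\<^sub>R w)) w"
    by (simp add: add_ac power2_eq_square)
  then show thesis
    using that[OF a b] unfolding \<phi>_def Dv_def by (simp add: add_ac)
qed

text \<open>Schwarz's theorem. The second difference over a small parallelogram is symmetric in
  \<open>v\<close> and \<open>w\<close>, and by \<open>second_difference_mvt\<close> it equals the
  square of \<open>h\<close> times either mixed derivative at some nearby point; continuity of both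
  at \<open>x\<close> brings them arbitrarily close.\<close>

lemma frechet_derivative_commute:
  fixes f :: "'a::euclidean_space \<Rightarrow> real"
  assumes f: "C_inf_on U f" and x: "x \<in> U"
  shows "frechet_derivative (\<lambda>y. frechet_derivative f (at y) v) (at x) w =
    frechet_derivative (\<lambda>y. frechet_derivative f (at y) w) (at x) v"
proof -
  define D where "D = (\<lambda>v w y. frechet_derivative (\<lambda>y. frechet_derivative f (at y) v) (at y) w)"
  have cont: "isCont (D v w) x" for v w
  proof -
    have "C_inf_on U (D v w)" unfolding D_def using f by (intro C_inf_intros)
    then show ?thesis
      using C_inf_on_imp_continuous_on C_inf_onD(2)[OF f] x continuous_on_eq_continuous_at by blast
  qed
  have "dist (D v w x) (D w v x) < e" if "e > 0" for e
  proof -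
    have near_D: "\<forall>\<^sub>F y in nhds x. dist (D v w y) (D v w x) < e/2" for v w
      using tendstoD[OF cont[of v w, unfolded isCont_def], of "e/2"] \<open>e > 0\<close>
      unfolding eventually_at_filter by (auto elim: eventually_mono)
    have "\<forall>\<^sub>F y in nhds x. dist (D v w y) (D v w x) < e/2 \<and> dist (D w v y) (D w v x) < e/2 \<and> y \<in> U"
      using x C_inf_onD(2)[OF f]
      by (intro eventually_conj eventually_nhds_in_open near_D)
    then obtain r where r: "r > 0" "\<And>y. dist y x < r \<Longrightarrow>
        dist (D v w y) (D v w x) < e/2 \<and> dist (D w v y) (D w v x) < e/2 \<and> y \<in> U"
      unfolding eventually_nhds_metric by blast
    \<comment> \<open>The summand 1 keeps the denominator positive when both vectors vanish, and the
      factor 2 makes the last inequality strict.\<close>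
    define h where "h = r / (2 * (norm v + norm w + 1))"
    have h: "h > 0" using r by (simp add: h_def add_nonneg_pos)
    have pos: "norm v + norm w + 1 > 0" by (simp add: add_nonneg_pos)
    have "h * (norm v + norm w) \<le> h * (norm v + norm w + 1)" using h by simp
    also have "\<dots> = r/2" using pos unfolding h_def by (simp add: divide_simps)
    finally have hr: "h * (norm v + norm w) < r" using r by simp
    have sub: "ball x r \<subseteq> U" using r by (auto simp: dist_commute)
    have near: "dist (x + a *\<^sub>R v + b *\<^sub>R w) x < r"
      if "0 < a" "a < h" "0 < b" "b < h" "h * (norm v + norm w) < r" for a b and v w :: 'a
    proof -
      have "norm (a *\<^sub>R v + b *\<^sub>R w) \<le> a * norm v + b * norm w"
        using that by (metis abs_of_pos norm_scaleR norm_triangle_ineq)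
      also have "\<dots> \<le> h * norm v + h * norm w"
        using that by (intro add_mono mult_right_mono) auto
      finally show ?thesis using that by (simp add: dist_norm algebra_simps)
    qed
    define \<Delta> where "\<Delta> = f (x + h *\<^sub>R v + h *\<^sub>R w) - f (x + h *\<^sub>R v) - f (x + h *\<^sub>R w) + f x"
    obtain a b where ab: "0 < a" "a < h" "0 < b" "b < h" "\<Delta> = h\<^sup>2 * D v w (x + a *\<^sub>R v + b *\<^sub>R w)"
      using second_difference_mvt[OF f sub h hr] unfolding \<Delta>_def D_def by metis
    have hr': "h * (norm w + norm v) < r" using hr by (simp add: add.commute)
    obtain c d where cd: "0 < c" "c < h" "0 < d" "d < h" "\<Delta> = h\<^sup>2 * D w v (x + c *\<^sub>R w + d *\<^sub>R v)"
      using second_difference_mvt[OF f sub h hr'] unfolding \<Delta>_def D_def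
      by (simp add: add_ac diff_diff_eq) blast
    have "D v w (x + a *\<^sub>R v + b *\<^sub>R w) = D w v (x + c *\<^sub>R w + d *\<^sub>R v)"
      using ab(5) cd(5) h by simp
    moreover have "dist (D v w (x + a *\<^sub>R v + b *\<^sub>R w)) (D v w x) < e/2"
      using r(2) near[OF ab(1-4) hr] by blast
    moreover have "dist (D w v (x + c *\<^sub>R w + d *\<^sub>R v)) (D w v x) < e/2"
      using r(2) near[OF cd(1-4) hr'] by blast
    ultimately show ?thesis by (metis dist_triangle_half_r)
  qed
  then have "D v w x = D w v x" by (metis dist_pos_lt less_irrefl)
  then show ?thesis by (simp add: D_def)
qed

section \<open>The covering of the annulus\<close>

lemma circ_eq_iff: "circ x = circ y \<longleftrightarrow> (\<exists>k::int. y = x + of_int k)"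
  using circle.abs_eq_iff by simp

lemma circ_add_int [simp]: "circ (x + of_int k) = circ x"
  unfolding circ_eq_iff by (rule exI[of _ "-k"]) simp

lemma circ_rep_circle [simp]: "circ (rep_circle q) = q"
  by (rule Quotient_abs_rep[OF Quotient_circle])

lemma continuous_on_circ: "continuous_on A circ"
  by (rule continuous_on_subset[of UNIV])
    (simp_all add: continuous_on_open_vimage open_circle_def)

lemma open_circ_image:
  assumes "open U"
  shows "open (circ ` U)"
proof -
  have "circ -` circ ` U = (\<Union>k::int. (+) (of_int k) ` U)"
  proof (intro equalityI subsetI)
    fix x assume "x \<in> circ -` circ ` U"
    then obtain u where "u \<in> U" "circ u = circ x" by auto
    then obtain k :: int where "x = of_int k + u" by (metis circ_eq_iff add.commute)
    then show "x \<in> (\<Union>k::int. (+) (of_int k) ` U)" using \<open>u \<in> U\<close> by blast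
  next
    fix x assume "x \<in> (\<Union>k::int. (+) (of_int k) ` U)"
    then obtain k :: int and u where "u \<in> U" "x = u + of_int k" by (auto simp: add.commute)
    then show "x \<in> circ -` circ ` U" by simp
  qed
  then show ?thesis using assms by (auto simp: open_circle_def intro!: open_translation)
qed

text \<open>An arbitrary section of the covering, on whose continuity nothing relies. Whatever is
  computed through it becomes meaningful by invariance under integer shifts.\<close>

definition lift :: "phase \<Rightarrow> real \<times> real" where
  "lift x = (rep_circle (fst x), snd x)"

lemma annulus_cover_lift [simp]: "annulus_cover (lift x) = x"
  by (simp add: annulus_cover_def lift_def)

lemma annulus_cover_eq_iff:
  "annulus_cover y = annulus_cover z \<longleftrightarrow> (\<exists>k::int. z = y + (of_int k, 0))"
  by (cases y; cases z) (auto simp: annulus_cover_def circ_eq_iff)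

lemma annulus_cover_shift [simp]: "annulus_cover (y + (of_int k, 0)) = annulus_cover y"
  by (cases y) (simp add: annulus_cover_def)

lemma annulus_cover_in_annulus [simp]: "annulus_cover y \<in> annulus \<longleftrightarrow> y \<in> strip"
  by (cases y) (simp add: annulus_cover_def annulus_def strip_def)

lemma lift_in_strip [simp]: "lift x \<in> strip \<longleftrightarrow> x \<in> annulus"
  by (metis annulus_cover_in_annulus annulus_cover_lift)

lemma annulus_subset_closed: "annulus \<subseteq> closed_annulus"
  by (auto simp: annulus_def closed_annulus_def)

lemma open_strip: "open strip"
  by (simp add: strip_def open_Times)

lemma open_time_strip: "open (UNIV \<times> strip)"
  by (simp add: open_Times open_strip)

lemma open_map_time_cover:
  assumes "open W"
  shows "open ((\<lambda>(s::real, y). (s, annulus_cover y)) ` W)"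
proof (rule open_prod_intro)
  fix z assume "z \<in> (\<lambda>(s, y). (s, annulus_cover y)) ` W"
  then obtain s t p where z: "z = (s, circ t, p)" "(s, t, p) \<in> W"
    unfolding annulus_cover_def by fast
  obtain A V where "open A" "open V" "s \<in> A" "(t, p) \<in> V" "A \<times> V \<subseteq> W"
    by (rule open_prod_elim[OF assms z(2)]) blast
  moreover obtain B C where "open B" "open C" "t \<in> B" "p \<in> C" "B \<times> C \<subseteq> V"
    by (rule open_prod_elim[OF \<open>open V\<close> \<open>(t, p) \<in> V\<close>]) blast
  ultimately have "open A" "open ((circ ` B) \<times> C)" "z \<in> A \<times> ((circ ` B) \<times> C)"
    and sub: "A \<times> (B \<times> C) \<subseteq> W"
    using open_circ_image[of B] by (auto simp: z open_Times)
  moreover have "A \<times> ((circ ` B) \<times> C) \<subseteq> (\<lambda>(s, y). (s, annulus_cover y)) ` W"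
  proof (intro subsetI)
    fix x assume "x \<in> A \<times> ((circ ` B) \<times> C)"
    then obtain a b c where "x = (a, circ b, c)" "(a, b, c) \<in> A \<times> (B \<times> C)" by auto
    then have "x = (\<lambda>(s, y). (s, annulus_cover y)) (a, b, c)" "(a, b, c) \<in> W"
      using sub by (auto simp: annulus_cover_def)
    then show "x \<in> (\<lambda>(s, y). (s, annulus_cover y)) ` W" by (rule image_eqI)
  qed
  ultimately show "\<exists>A B. open A \<and> open B \<and> z \<in> A \<times> B \<and> A \<times> B \<subseteq> (\<lambda>(s, y). (s, annulus_cover y)) ` W"
    by blast
qed

text \<open>The covering is an open map, and the closed strip is the full preimage of the closed
  annulus, so open sets that witness continuity upstairs project to witnesses downstairs. Continuity
  up to the boundary can thus be checked with real coordinates.\<close>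

lemma continuous_on_closed_annulus_descend:
  fixes F :: "real \<times> phase \<Rightarrow> 'b::topological_space"
  assumes "continuous_on (S \<times> (UNIV \<times> {-1..1})) (\<lambda>(s, y). F (s, annulus_cover y))"
  shows "continuous_on (S \<times> closed_annulus) F"
  unfolding continuous_on_open_invariant
proof (intro allI impI)
  fix V :: "'b set" assume "open V"
  then obtain W where W: "open W" "W \<inter> (S \<times> (UNIV \<times> {-1..1})) =
      (\<lambda>(s, y). F (s, annulus_cover y)) -` V \<inter> (S \<times> (UNIV \<times> {-1..1}))"
    using assms unfolding continuous_on_open_invariant by meson
  have W_iff: "(s, y) \<in> W \<longleftrightarrow> F (s, annulus_cover y) \<in> V" if "s \<in> S" "y \<in> UNIV \<times> {-1..1}" for s y
    using eqset_imp_iff[OF W(2), of "(s, y)"] that by simp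
  let ?\<pi> = "\<lambda>(s::real, y). (s, annulus_cover y)"
  have cl: "annulus_cover y \<in> closed_annulus \<longleftrightarrow> y \<in> UNIV \<times> {-1..1}" for y
    by (cases y) (simp add: annulus_cover_def closed_annulus_def)
  have "?\<pi> ` W \<inter> (S \<times> closed_annulus) = F -` V \<inter> (S \<times> closed_annulus)"
  proof (intro equalityI subsetI)
    fix z assume "z \<in> ?\<pi> ` W \<inter> (S \<times> closed_annulus)"
    then obtain s y where "z = (s, annulus_cover y)" "(s, y) \<in> W" "s \<in> S" "y \<in> UNIV \<times> {-1..1}"
      using cl by auto
    then show "z \<in> F -` V \<inter> (S \<times> closed_annulus)"
      using W_iff[of s y] cl[of y] by simp
  next
    fix z assume z: "z \<in> F -` V \<inter> (S \<times> closed_annulus)"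
    obtain s x where sx: "z = (s, x)" by (cases z)
    then have "(s, lift x) \<in> W"
      using W_iff[of s "lift x"] z cl[of "lift x"] by simp
    then show "z \<in> ?\<pi> ` W \<inter> (S \<times> closed_annulus)"
      using z sx by (auto intro!: rev_image_eqI)
  qed
  then show "\<exists>A. open A \<and> A \<inter> (S \<times> closed_annulus) = F -` V \<inter> (S \<times> closed_annulus)"
    using open_map_time_cover[OF W(1)] by blast
qed

section \<open>Space and time derivatives of maps on space-time\<close>

lemma has_derivative_slice:
  assumes "C_inf_on (UNIV \<times> U) G" "y \<in> U"
  shows "((\<lambda>z. G (s, z)) has_derivative (\<lambda>v. frechet_derivative G (at (s, y)) (0, v))) (at y)"
proof -
  have "((\<lambda>z. (s, z)) has_derivative (\<lambda>v. (0, v))) (at y)"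
    by (auto intro!: derivative_eq_intros)
  from has_derivative_compose[OF this C_inf_on_has_derivative[OF assms(1)]] show ?thesis
    using assms(2) by simp
qed

lemma has_vector_derivative_time:
  assumes "C_inf_on (UNIV \<times> U) G" "y \<in> U"
  shows "((\<lambda>r::real. G (r, y)) has_vector_derivative frechet_derivative G (at (s, y)) (1, 0)) (at s within S)"
proof -
  have D: "(G has_derivative frechet_derivative G (at (s, y))) (at (s, y))"
    using C_inf_on_has_derivative[OF assms(1)] assms(2) by auto
  have "((\<lambda>r. (r, y)) has_derivative (\<lambda>r. (r, 0))) (at s within S)"
    by (auto intro!: derivative_eq_intros)
  from has_derivative_compose[OF this D]
  have "((\<lambda>r. G (r, y)) has_derivative (\<lambda>r. frechet_derivative G (at (s, y)) (r, 0))) (at s within S)" .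
  moreover have "(\<lambda>r. frechet_derivative G (at (s, y)) (r, 0)) = (\<lambda>r. r *\<^sub>R frechet_derivative G (at (s, y)) (1, 0))"
  proof
    show "frechet_derivative G (at (s, y)) (r, 0) = r *\<^sub>R frechet_derivative G (at (s, y)) (1, 0)" for r
      using linear_scale[OF has_derivative_linear[OF D], of r "(1, 0)"] by simp
  qed
  ultimately show ?thesis by (simp only: has_vector_derivative_def)
qed

lemma C_inf_on_slice:
  fixes G :: "real \<times> 'a::euclidean_space \<Rightarrow> 'b::real_normed_vector"
  assumes "C_inf_on (UNIV \<times> U) G" "open U"
  shows "C_inf_on U (\<lambda>y. G (s, y))"
  using assms by (intro C_inf_on_compose[OF assms(1)] C_inf_intros) auto

section \<open>Hamiltonian isotopies\<close>

text \<open>The shape shared by the continuity conditions in \<open>symplectic_path\<close> and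
  \<open>generates\<close>, with \<open>b\<close> as the boundary values.\<close>

definition extension :: "(real \<Rightarrow> phase \<Rightarrow> 'b) \<Rightarrow> (phase \<Rightarrow> 'b) \<Rightarrow> real \<times> phase \<Rightarrow> 'b" where
  "extension f b = (\<lambda>(s, x). if x \<in> annulus then f s x else b x)"

text \<open>\<open>\<theta> s\<close> is the inverse of \<open>\<psi> s\<close> on the annulus, and \<open>\<Psi>\<close>, \<open>\<Phi>\<close> are lifts of \<open>\<psi>\<close>, \<open>\<theta>\<close>.
  \<open>\<eta>\<close> is the Hamiltonian of the isotopy \<open>\<psi>\<close> pulled back along \<open>\<psi>\<close>, so that
  \<open>two_form\<close> says $\Psi^*\omega = \omega - ds \wedge d(\eta_s \circ \pi)$ on space-time, where $\pi$
  is the covering of the annulus. This comprises that every \<open>\<psi> s\<close> is symplectic as well as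
  Hamilton's equation, and it is stable under composition.\<close>

locale ham_isotopy =
  fixes \<psi> \<theta> :: "real \<Rightarrow> phase \<Rightarrow> phase"
    and \<Psi> \<Phi> :: "real \<times> real \<times> real \<Rightarrow> real \<times> real"
    and \<eta> :: "real \<Rightarrow> phase \<Rightarrow> real"
  assumes smooth: "C_inf_on (UNIV \<times> strip) \<Psi>" "C_inf_on (UNIV \<times> strip) \<Phi>"
      "C_inf_on (UNIV \<times> strip) (\<lambda>(s, y). \<eta> s (annulus_cover y))"
    and strip: "y \<in> strip \<Longrightarrow> \<Psi> (s, y) \<in> strip" "y \<in> strip \<Longrightarrow> \<Phi> (s, y) \<in> strip"
    and inverses: "y \<in> strip \<Longrightarrow> \<Phi> (s, \<Psi> (s, y)) = y" "y \<in> strip \<Longrightarrow> \<Psi> (s, \<Phi> (s, y)) = y"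
    and shift: "y \<in> strip \<Longrightarrow> \<Psi> (s, y + (of_int k, 0)) = \<Psi> (s, y) + (of_int k, 0)"
    and cover: "y \<in> strip \<Longrightarrow> annulus_cover (\<Psi> (s, y)) = \<psi> s (annulus_cover y)"
      "y \<in> strip \<Longrightarrow> annulus_cover (\<Phi> (s, y)) = \<theta> s (annulus_cover y)"
    and two_form: "y \<in> strip \<Longrightarrow>
      omega (frechet_derivative \<Psi> (at (s, y)) (a, v)) (frechet_derivative \<Psi> (at (s, y)) (b, w)) =
      omega v w - a * frechet_derivative (\<lambda>(s, y). \<eta> s (annulus_cover y)) (at (s, y)) (b, w)
        + b * frechet_derivative (\<lambda>(s, y). \<eta> s (annulus_cover y)) (at (s, y)) (a, v)"
    and continuous: "continuous_on ({0..1} \<times> closed_annulus) (extension \<psi> id)"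
      "continuous_on ({0..1} \<times> closed_annulus) (extension \<theta> id)"
      "continuous_on ({0..1} \<times> closed_annulus) (extension \<eta> (\<lambda>_. 0))"
begin

lemma in_annulus:
  assumes "x \<in> annulus"
  shows "\<psi> s x \<in> annulus" "\<theta> s x \<in> annulus"
  using strip[of "lift x" s] cover[of "lift x" s] assms annulus_cover_in_annulus
  by (metis annulus_cover_lift lift_in_strip)+

lemma inverse_maps:
  assumes "x \<in> annulus"
  shows "\<theta> s (\<psi> s x) = x" "\<psi> s (\<theta> s x) = x"
  using strip[of "lift x" s] inverses[of "lift x" s] cover assms
  by (metis annulus_cover_lift lift_in_strip)+

lemma extension_closed_annulus:
  assumes "x \<in> closed_annulus"
  shows "extension \<psi> id (s, x) \<in> closed_annulus" "extension \<theta> id (s, x) \<in> closed_annulus"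
  using assms subsetD[OF annulus_subset_closed in_annulus(1)]
    subsetD[OF annulus_subset_closed in_annulus(2)]
  by (cases "x \<in> annulus"; simp add: extension_def)+

text \<open>Makes the velocity of the lifted path independent of the representative, so that it
  descends to a vector field on the annulus.\<close>

lemma frechet_derivative_shift:
  assumes "y \<in> strip"
  shows "frechet_derivative \<Psi> (at (s, y + (of_int k, 0))) (1, 0) = frechet_derivative \<Psi> (at (s, y)) (1, 0)"
proof -
  have y: "y + (of_int k, 0) \<in> strip" using assms by (cases y) (simp add: strip_def)
  have "((\<lambda>r. \<Psi> (r, y + (of_int k, 0))) has_vector_derivative
      frechet_derivative \<Psi> (at (s, y)) (1, 0) + 0) (at s)"
    unfolding shift[OF assms]
    by (intro has_vector_derivative_add has_vector_derivative_time[OF smooth(1) assms] has_vector_derivative_const)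
  then show ?thesis
    using has_vector_derivative_time[OF smooth(1) y, of s UNIV] vector_derivative_unique_at by fastforce
qed

lemma Phi_shift:
  assumes "y \<in> strip"
  shows "\<Phi> (s, y + (of_int k, 0)) = \<Phi> (s, y) + (of_int k, 0)"
proof -
  have "\<Psi> (s, \<Phi> (s, y) + (of_int k, 0)) = y + (of_int k, 0)"
    using shift[OF strip(2)[OF assms]] inverses[OF assms] by simp
  moreover have "\<Phi> (s, y) + (of_int k, 0) \<in> strip"
    using strip(2)[OF assms, of s] by (cases "\<Phi> (s, y)") (simp add: strip_def)
  ultimately show ?thesis using inverses(1) by metis
qed

text \<open>This is \<open>two_form\<close> on vectors without time component.\<close>

lemma symplectic:
  assumes "y \<in> strip"
  shows "omega (frechet_derivative (\<lambda>y. \<Psi> (s, y)) (at y) u) (frechet_derivative (\<lambda>y. \<Psi> (s, y)) (at y) v)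
    = omega u v"
  using two_form[OF assms, of s 0 u 0 v]
  by (simp flip: frechet_derivative_at[OF has_derivative_slice[OF smooth(1) assms]])

lemma symplectomorphism_psi: "symplectomorphism (\<psi> s)"
proof -
  have bij: "bij_betw (\<psi> s) annulus annulus"
    by (rule bij_betw_byWitness[where f' = "\<theta> s"]) (auto simp: in_annulus inverse_maps)
  have inv: "inv_into annulus (\<psi> s) x = \<theta> s x" if "x \<in> annulus" for x
    using bij that by (metis bij_betw_inv_into_left in_annulus(2) inverse_maps(2))
  have "smooth_on strip (\<lambda>y. \<Psi> (s, y))" "smooth_on strip (\<lambda>y. \<Phi> (s, y))"
    using C_inf_on_slice[OF smooth(1) open_strip] C_inf_on_slice[OF smooth(2) open_strip]
    by (auto intro: C_inf_on_imp_smooth_on)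
  then have "smooth_lift (\<psi> s) (\<lambda>y. \<Psi> (s, y))"
    "smooth_lift (inv_into annulus (\<psi> s)) (\<lambda>y. \<Phi> (s, y))"
    using cover inv by (auto simp: smooth_lift_def)
  then show ?thesis unfolding symplectomorphism_def using bij symplectic by blast
qed

lemma frechet_derivative_Psi_Phi:
  assumes "y \<in> strip"
  shows "frechet_derivative \<Psi> (at (s, \<Phi> (s, y))) (0, frechet_derivative \<Phi> (at (s, y)) (0, v)) = v"
proof -
  have "((\<lambda>z. \<Psi> (s, \<Phi> (s, z))) has_derivative
      (\<lambda>v. frechet_derivative \<Psi> (at (s, \<Phi> (s, y))) (0, frechet_derivative \<Phi> (at (s, y)) (0, v)))) (at y)"
    using has_derivative_compose[OF has_derivative_slice[OF smooth(2) assms]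
        has_derivative_slice[OF smooth(1) strip(2)[OF assms]]] .
  moreover have "((\<lambda>z. \<Psi> (s, \<Phi> (s, z))) has_derivative (\<lambda>v. v)) (at y)"
    by (rule has_derivative_transform_within_open[OF has_derivative_ident open_strip assms])
      (simp add: inverses)
  ultimately show ?thesis by (metis has_derivative_unique)
qed

text \<open>Composing \<open>\<eta>\<close> with the inverse maps undoes the pullback. Hamilton's
  equation is then \<open>two_form\<close> evaluated on the time direction and a spatial
  vector.\<close>

lemma generates: "generates (\<lambda>s x. \<eta> s (\<theta> s x)) \<psi>"
proof -
  let ?h = "\<lambda>(s, y). \<eta> s (annulus_cover y)"
  define X where "X = (\<lambda>s x. frechet_derivative \<Psi> (at (s, lift (\<theta> s x))) (1, 0))"
  have H_cover: "\<eta> s (\<theta> s (annulus_cover y)) = ?h (s, \<Phi> (s, y))" if "y \<in> strip" for s y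
    using cover(2)[OF that] by simp
  have "C_inf_on (UNIV \<times> strip) (\<lambda>z. ?h (fst z, \<Phi> z))"
    using strip(2) by (intro C_inf_on_compose[OF smooth(3)] C_inf_intros smooth open_time_strip) auto
  then have "C_inf_on (UNIV \<times> strip) (\<lambda>(s, y). \<eta> s (\<theta> s (annulus_cover y)))"
    by (rule C_inf_on_cong) (auto simp: H_cover)
  then have 1: "smooth_on ({0..1} \<times> strip) (\<lambda>(s, y). \<eta> s (\<theta> s (annulus_cover y)))"
    by (rule C_inf_on_imp_smooth_on) auto
  have "continuous_on ({0..1} \<times> closed_annulus) (\<lambda>z. extension \<eta> (\<lambda>_. 0) (fst z, extension \<theta> id z))"
    using extension_closed_annulus
    by (intro continuous_on_compose2[OF continuous(3)] continuous_intros continuous(2)) auto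
  moreover have "(\<lambda>z. extension \<eta> (\<lambda>_. 0) (fst z, extension \<theta> id z)) =
      (\<lambda>(s, x). if x \<in> annulus then \<eta> s (\<theta> s x) else 0)"
    by (auto simp: extension_def in_annulus)
  ultimately have 2: "continuous_on ({0..1} \<times> closed_annulus)
      (\<lambda>(s, x). if x \<in> annulus then \<eta> s (\<theta> s x) else 0)" by (simp only:)
  have 3: "symplectic_path \<psi> (\<lambda>s y. \<Psi> (s, y))"
    unfolding symplectic_path_def
  proof (intro conjI ballI)
    show "smooth_lift (\<psi> s) (\<lambda>y. \<Psi> (s, y))" for s
      using C_inf_on_slice[OF smooth(1) open_strip] cover(1)
      by (auto simp: smooth_lift_def intro: C_inf_on_imp_smooth_on)
    show "smooth_on ({0..1} \<times> strip) (\<lambda>(s, y). \<Psi> (s, y))"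
      using smooth(1) by (auto intro: C_inf_on_imp_smooth_on)
    show "continuous_on ({0..1} \<times> closed_annulus) (\<lambda>(s, x). if x \<in> annulus then \<psi> s x else x)"
      using continuous(1) unfolding extension_def id_apply .
  qed (rule symplectomorphism_psi)
  have X: "X s (\<psi> s (annulus_cover y)) = frechet_derivative \<Psi> (at (s, y)) (1, 0)" if "y \<in> strip" for s y
  proof -
    have "\<theta> s (\<psi> s (annulus_cover y)) = annulus_cover y" using that inverse_maps(1) by simp
    then obtain k where "lift (\<theta> s (\<psi> s (annulus_cover y))) = y + (of_int k, 0)"
      using annulus_cover_eq_iff annulus_cover_lift by metis
    then show ?thesis using frechet_derivative_shift[OF that] by (simp add: X_def)
  qed
  have 4: "((\<lambda>r. \<Psi> (r, y)) has_vector_derivative X s (\<psi> s (annulus_cover y))) (at s within {0..1})"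
    if "y \<in> strip" for s y
    unfolding X[OF that] by (rule has_vector_derivative_time[OF smooth(1) that])
  have 5: "omega (X s (annulus_cover y)) v =
      - frechet_derivative (\<lambda>z. \<eta> s (\<theta> s (annulus_cover z))) (at y) v" if "y \<in> strip" for s y v
  proof -
    let ?y = "\<Phi> (s, y)" and ?u = "frechet_derivative \<Phi> (at (s, y)) (0, v)"
    have y: "?y \<in> strip" using strip(2)[OF that] .
    have "((\<lambda>z. ?h (s, \<Phi> (s, z))) has_derivative
        (\<lambda>v. frechet_derivative ?h (at (s, ?y)) (0, frechet_derivative \<Phi> (at (s, y)) (0, v)))) (at y)"
      using has_derivative_compose[OF has_derivative_slice[OF smooth(2) that]
          has_derivative_slice[OF smooth(3) y]] .
    then have "((\<lambda>z. \<eta> s (\<theta> s (annulus_cover z))) has_derivative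
        (\<lambda>v. frechet_derivative ?h (at (s, ?y)) (0, frechet_derivative \<Phi> (at (s, y)) (0, v)))) (at y)"
      by (rule has_derivative_transform_within_open[OF _ open_strip that]) (simp add: cover)
    from frechet_derivative_at[OF this]
    have "frechet_derivative (\<lambda>z. \<eta> s (\<theta> s (annulus_cover z))) (at y) v =
        frechet_derivative ?h (at (s, ?y)) (0, ?u)" by (metis (no_types))
    moreover have "X s (annulus_cover y) = frechet_derivative \<Psi> (at (s, ?y)) (1, 0)"
      using X[OF y, of s] cover(1)[OF y, of s] inverses(2)[OF that, of s] by simp
    moreover have "frechet_derivative \<Psi> (at (s, ?y)) (0, ?u) = v"
      by (rule frechet_derivative_Psi_Phi[OF that])
    \<comment> \<open>The spatial vector \<open>?u\<close> is chosen so that the derivative of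
      \<open>\<Psi>\<close> sends it to \<open>v\<close>; with it only the term of
      \<open>two_form\<close> that contains the Hamiltonian survives.\<close>
    ultimately show ?thesis using two_form[OF y, of s 1 0 0 ?u] by (simp add: omega_def)
  qed
  show ?thesis unfolding generates_def using 1 2 3 4 5 by blast
qed

end

section \<open>Operations on Hamiltonian isotopies\<close>

lemma ham_isotopy_id: "ham_isotopy (\<lambda>_. id) (\<lambda>_. id) snd snd (\<lambda>_ _. 0)"
proof
  have D: "frechet_derivative snd (at z) = snd" for z :: "real \<times> real \<times> real"
    using frechet_derivative_at[OF bounded_linear_imp_has_derivative[OF bounded_linear_snd]] by metis
  show "omega (frechet_derivative snd (at (s, y)) (a, v)) (frechet_derivative snd (at (s, y)) (b, w)) =
      omega v w - a * frechet_derivative (\<lambda>(s, y). 0) (at (s, y)) (b, w)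
        + b * frechet_derivative (\<lambda>(s, y). 0) (at (s, y)) (a, v)"
    for s a b :: real and y v w :: "real \<times> real"
    by (simp add: D case_prod_unfold)
  have ext: "extension (\<lambda>_. id) id = snd" by (auto simp: extension_def)
  show "continuous_on ({0..1} \<times> closed_annulus) (extension (\<lambda>_. id) id)"
    unfolding ext by (auto intro: continuous_intros)
  show "continuous_on ({0..1} \<times> closed_annulus) (extension (\<lambda>_ _. 0::real) (\<lambda>_. 0))"
    by (simp add: extension_def case_prod_unfold)
qed (auto simp: case_prod_unfold open_time_strip intro!: C_inf_intros)

text \<open>The map \<open>\<lambda>z. (fst z, \<Psi>\<^sub>1 z)\<close> of space-time preserves
  time. Pulling the identity for \<open>\<Psi>\<^sub>2\<close> back along it and inserting the one
  for \<open>\<Psi>\<^sub>1\<close> adds the two Hamiltonian terms, the second Hamiltonian being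
  evaluated after the first map.\<close>

lemma ham_isotopy_compose:
  assumes "ham_isotopy \<psi>\<^sub>1 \<theta>\<^sub>1 \<Psi>\<^sub>1 \<Phi>\<^sub>1 \<eta>\<^sub>1" "ham_isotopy \<psi>\<^sub>2 \<theta>\<^sub>2 \<Psi>\<^sub>2 \<Phi>\<^sub>2 \<eta>\<^sub>2"
  shows "ham_isotopy (\<lambda>s. \<psi>\<^sub>2 s \<circ> \<psi>\<^sub>1 s) (\<lambda>s. \<theta>\<^sub>1 s \<circ> \<theta>\<^sub>2 s)
    (\<lambda>z. \<Psi>\<^sub>2 (fst z, \<Psi>\<^sub>1 z)) (\<lambda>z. \<Phi>\<^sub>1 (fst z, \<Phi>\<^sub>2 z)) (\<lambda>s x. \<eta>\<^sub>2 s (\<psi>\<^sub>1 s x) + \<eta>\<^sub>1 s x)"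
proof -
  interpret I1: ham_isotopy \<psi>\<^sub>1 \<theta>\<^sub>1 \<Psi>\<^sub>1 \<Phi>\<^sub>1 \<eta>\<^sub>1 by fact
  interpret I2: ham_isotopy \<psi>\<^sub>2 \<theta>\<^sub>2 \<Psi>\<^sub>2 \<Phi>\<^sub>2 \<eta>\<^sub>2 by fact
  let ?h1 = "\<lambda>(s, y). \<eta>\<^sub>1 s (annulus_cover y)" and ?h2 = "\<lambda>(s, y). \<eta>\<^sub>2 s (annulus_cover y)"
  let ?h = "\<lambda>(s, y). \<eta>\<^sub>2 s (\<psi>\<^sub>1 s (annulus_cover y)) + \<eta>\<^sub>1 s (annulus_cover y)"
  have h: "?h2 (fst z, \<Psi>\<^sub>1 z) + ?h1 z = ?h z" if "z \<in> UNIV \<times> strip" for z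
    using that I1.cover(1) by auto
  show ?thesis
  proof
    show "C_inf_on (UNIV \<times> strip) (\<lambda>z. \<Psi>\<^sub>2 (fst z, \<Psi>\<^sub>1 z))"
      using I1.strip by (intro C_inf_on_compose[OF I2.smooth(1)] C_inf_intros I1.smooth open_time_strip) auto
    show "C_inf_on (UNIV \<times> strip) (\<lambda>z. \<Phi>\<^sub>1 (fst z, \<Phi>\<^sub>2 z))"
      using I2.strip by (intro C_inf_on_compose[OF I1.smooth(2)] C_inf_intros I2.smooth open_time_strip) auto
    have "C_inf_on (UNIV \<times> strip) (\<lambda>z. ?h2 (fst z, \<Psi>\<^sub>1 z) + ?h1 z)"
      using I1.strip by (intro C_inf_on_add C_inf_on_compose[OF I2.smooth(3)] C_inf_intros I1.smooth open_time_strip) auto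
    then show "C_inf_on (UNIV \<times> strip) ?h"
      by (rule C_inf_on_cong) (rule h)
    fix s a b :: real and y v w :: "real \<times> real" and k :: int
    assume y: "y \<in> strip"
    then have y1: "\<Psi>\<^sub>1 (s, y) \<in> strip" and y2: "\<Phi>\<^sub>2 (s, y) \<in> strip" using I1.strip I2.strip by auto
    show "\<Psi>\<^sub>2 (fst (s, y), \<Psi>\<^sub>1 (s, y)) \<in> strip" "\<Phi>\<^sub>1 (fst (s, y), \<Phi>\<^sub>2 (s, y)) \<in> strip"
      using I1.strip I2.strip y by auto
    show "\<Phi>\<^sub>1 (fst (s, \<Psi>\<^sub>2 (fst (s, y), \<Psi>\<^sub>1 (s, y))), \<Phi>\<^sub>2 (s, \<Psi>\<^sub>2 (fst (s, y), \<Psi>\<^sub>1 (s, y)))) = y"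
      "\<Psi>\<^sub>2 (fst (s, \<Phi>\<^sub>1 (fst (s, y), \<Phi>\<^sub>2 (s, y))), \<Psi>\<^sub>1 (s, \<Phi>\<^sub>1 (fst (s, y), \<Phi>\<^sub>2 (s, y)))) = y"
      using y y1 y2 by (auto simp: I1.inverses I2.inverses)
    show "\<Psi>\<^sub>2 (fst (s, y + (of_int k, 0)), \<Psi>\<^sub>1 (s, y + (of_int k, 0))) =
        \<Psi>\<^sub>2 (fst (s, y), \<Psi>\<^sub>1 (s, y)) + (of_int k, 0)"
      using y y1 by (simp add: I1.shift I2.shift)
    show "annulus_cover (\<Psi>\<^sub>2 (fst (s, y), \<Psi>\<^sub>1 (s, y))) = (\<psi>\<^sub>2 s \<circ> \<psi>\<^sub>1 s) (annulus_cover y)"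
      "annulus_cover (\<Phi>\<^sub>1 (fst (s, y), \<Phi>\<^sub>2 (s, y))) = (\<theta>\<^sub>1 s \<circ> \<theta>\<^sub>2 s) (annulus_cover y)"
      using y y1 y2 by (simp_all add: I1.cover I2.cover)
    let ?D1 = "frechet_derivative \<Psi>\<^sub>1 (at (s, y))"
    have inner: "((\<lambda>z. (fst z, \<Psi>\<^sub>1 z)) has_derivative (\<lambda>x. (fst x, ?D1 x))) (at (s, y))"
      using y by (intro derivative_intros C_inf_on_has_derivative[OF I1.smooth(1)]) auto
    have "((\<lambda>z. \<Psi>\<^sub>2 (fst z, \<Psi>\<^sub>1 z)) has_derivative
        (\<lambda>x. frechet_derivative \<Psi>\<^sub>2 (at (s, \<Psi>\<^sub>1 (s, y))) (fst x, ?D1 x))) (at (s, y))"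
      using has_derivative_compose[OF inner] C_inf_on_has_derivative[OF I2.smooth(1)] y1 by fastforce
    note DPsi = frechet_derivative_at[OF this, symmetric]
    have "((\<lambda>z. ?h2 (fst z, \<Psi>\<^sub>1 z) + ?h1 z) has_derivative
        (\<lambda>x. frechet_derivative ?h2 (at (s, \<Psi>\<^sub>1 (s, y))) (fst x, ?D1 x)
           + frechet_derivative ?h1 (at (s, y)) x)) (at (s, y))"
      by (intro has_derivative_add has_derivative_compose[OF inner]
          C_inf_on_has_derivative[OF I1.smooth(3)])
        (use C_inf_on_has_derivative[OF I2.smooth(3)] y y1 in auto)
    then have "(?h has_derivative
        (\<lambda>x. frechet_derivative ?h2 (at (s, \<Psi>\<^sub>1 (s, y))) (fst x, ?D1 x)
           + frechet_derivative ?h1 (at (s, y)) x)) (at (s, y))"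
      by (rule has_derivative_transform_within_open[OF _ open_time_strip]) (use y h in auto)
    note Dh = frechet_derivative_at[OF this, symmetric]
    show "omega (frechet_derivative (\<lambda>z. \<Psi>\<^sub>2 (fst z, \<Psi>\<^sub>1 z)) (at (s, y)) (a, v))
        (frechet_derivative (\<lambda>z. \<Psi>\<^sub>2 (fst z, \<Psi>\<^sub>1 z)) (at (s, y)) (b, w)) =
      omega v w - a * frechet_derivative ?h (at (s, y)) (b, w) + b * frechet_derivative ?h (at (s, y)) (a, v)"
      unfolding DPsi Dh using I1.two_form[OF y, of s a v b w]
        I2.two_form[OF y1, of s a "?D1 (a, v)" b "?D1 (b, w)"]
      by (simp add: algebra_simps)
  next
    have "continuous_on ({0..1} \<times> closed_annulus) (\<lambda>z. extension \<psi>\<^sub>2 id (fst z, extension \<psi>\<^sub>1 id z))"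
      using I1.extension_closed_annulus
      by (intro continuous_on_compose2[OF I2.continuous(1)] continuous_intros I1.continuous) auto
    moreover have "(\<lambda>z. extension \<psi>\<^sub>2 id (fst z, extension \<psi>\<^sub>1 id z)) = extension (\<lambda>s. \<psi>\<^sub>2 s \<circ> \<psi>\<^sub>1 s) id"
      by (auto simp: extension_def I1.in_annulus)
    ultimately show "continuous_on ({0..1} \<times> closed_annulus) (extension (\<lambda>s. \<psi>\<^sub>2 s \<circ> \<psi>\<^sub>1 s) id)"
      by (simp only:)
    have "continuous_on ({0..1} \<times> closed_annulus) (\<lambda>z. extension \<theta>\<^sub>1 id (fst z, extension \<theta>\<^sub>2 id z))"
      using I2.extension_closed_annulus
      by (intro continuous_on_compose2[OF I1.continuous(2)] continuous_intros I2.continuous) auto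
    moreover have "(\<lambda>z. extension \<theta>\<^sub>1 id (fst z, extension \<theta>\<^sub>2 id z)) = extension (\<lambda>s. \<theta>\<^sub>1 s \<circ> \<theta>\<^sub>2 s) id"
      by (auto simp: extension_def I2.in_annulus)
    ultimately show "continuous_on ({0..1} \<times> closed_annulus) (extension (\<lambda>s. \<theta>\<^sub>1 s \<circ> \<theta>\<^sub>2 s) id)"
      by (simp only:)
    have "continuous_on ({0..1} \<times> closed_annulus)
        (\<lambda>z. extension \<eta>\<^sub>2 (\<lambda>_. 0) (fst z, extension \<psi>\<^sub>1 id z) + extension \<eta>\<^sub>1 (\<lambda>_. 0) z)"
      using I1.extension_closed_annulus
      by (intro continuous_on_add continuous_on_compose2[OF I2.continuous(3)] continuous_intros
          I1.continuous) auto
    moreover have "(\<lambda>z. extension \<eta>\<^sub>2 (\<lambda>_. 0) (fst z, extension \<psi>\<^sub>1 id z) + extension \<eta>\<^sub>1 (\<lambda>_. 0) z) =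
        extension (\<lambda>s x. \<eta>\<^sub>2 s (\<psi>\<^sub>1 s x) + \<eta>\<^sub>1 s x) (\<lambda>_. 0)"
      by (auto simp: extension_def I1.in_annulus)
    ultimately show "continuous_on ({0..1} \<times> closed_annulus)
        (extension (\<lambda>s x. \<eta>\<^sub>2 s (\<psi>\<^sub>1 s x) + \<eta>\<^sub>1 s x) (\<lambda>_. 0))"
      by (simp only:)
  qed
qed

text \<open>The pulled back Hamiltonian of the iterate is the sum of \<open>\<eta>\<close> over the
  first \<open>n\<close> points of an orbit, so a uniform bound on \<open>\<eta>\<close> is
  multiplied by \<open>n\<close>.\<close>

lemma ham_isotopy_funpow:
  assumes "ham_isotopy \<psi> \<theta> \<Psi> \<Phi> \<eta>"
    and B: "\<And>s x. s \<in> {0..1} \<Longrightarrow> x \<in> annulus \<Longrightarrow> \<bar>\<eta> s x\<bar> \<le> B s"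
  shows "\<exists>\<Psi>' \<Phi>' \<eta>'. ham_isotopy (\<lambda>s. \<psi> s ^^ n) (\<lambda>s. \<theta> s ^^ n) \<Psi>' \<Phi>' \<eta>' \<and>
    (\<forall>s\<in>{0..1}. \<forall>x\<in>annulus. \<bar>\<eta>' s x\<bar> \<le> real n * B s)"
proof (induction n)
  case 0
  show ?case
    by (rule exI[of _ snd], rule exI[of _ snd], rule exI[of _ "\<lambda>_ _. 0"])
      (use ham_isotopy_id in \<open>simp add: id_def\<close>)
next
  case (Suc n)
  then obtain \<Psi>' \<Phi>' \<eta>' where I: "ham_isotopy (\<lambda>s. \<psi> s ^^ n) (\<lambda>s. \<theta> s ^^ n) \<Psi>' \<Phi>' \<eta>'"
    and B': "\<forall>s\<in>{0..1}. \<forall>x\<in>annulus. \<bar>\<eta>' s x\<bar> \<le> real n * B s" by blast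
  have "\<bar>\<eta> s ((\<psi> s ^^ n) x) + \<eta>' s x\<bar> \<le> real (Suc n) * B s" if "s \<in> {0..1}" "x \<in> annulus" for s x
    using B[OF that(1) ham_isotopy.in_annulus(1)[OF I that(2)], of s] B' that
    by (fastforce simp: algebra_simps)
  moreover have "(\<theta> s ^^ n) \<circ> \<theta> s = \<theta> s ^^ Suc n" for s
    by (simp only: funpow_Suc_right)
  moreover have "\<psi> s \<circ> (\<psi> s ^^ n) = \<psi> s ^^ Suc n" for s
    by simp
  ultimately show ?case
    using ham_isotopy_compose[OF I assms(1)] by (simp only:) blast
qed

text \<open>A path at rest in the inverse of the initial map. Composed with the original path it
  moves the starting point to the identity and adds nothing to the Hamiltonian.\<close>

lemma ham_isotopy_inverse_constant:
  assumes "ham_isotopy \<psi> \<theta> \<Psi> \<Phi> \<eta>"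
  shows "ham_isotopy (\<lambda>_. \<theta> 0) (\<lambda>_. \<psi> 0) (\<lambda>z. \<Phi> (0, snd z)) (\<lambda>z. \<Psi> (0, snd z)) (\<lambda>_ _. 0)"
proof -
  interpret I: ham_isotopy \<psi> \<theta> \<Psi> \<Phi> \<eta> by fact
  show ?thesis
  proof
    show "C_inf_on (UNIV \<times> strip) (\<lambda>z::real \<times> real \<times> real. \<Phi> (0, snd z))"
      "C_inf_on (UNIV \<times> strip) (\<lambda>z::real \<times> real \<times> real. \<Psi> (0, snd z))"
      by (auto intro!: C_inf_on_compose[OF I.smooth(2)] C_inf_on_compose[OF I.smooth(1)] C_inf_intros open_time_strip)
    show "C_inf_on (UNIV \<times> strip) (\<lambda>(s::real, y::real \<times> real). 0::real)"
      by (simp add: case_prod_unfold C_inf_on_const open_time_strip)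
    fix s a b :: real and y v w :: "real \<times> real" and k :: int
    assume y: "y \<in> strip"
    then show "\<Phi> (0, snd (s, y)) \<in> strip" "\<Psi> (0, snd (s, y)) \<in> strip"
      "\<Psi> (0, snd (s, \<Phi> (0, snd (s, y)))) = y" "\<Phi> (0, snd (s, \<Psi> (0, snd (s, y)))) = y"
      "\<Phi> (0, snd (s, y + (of_int k, 0))) = \<Phi> (0, snd (s, y)) + (of_int k, 0)"
      "annulus_cover (\<Phi> (0, snd (s, y))) = \<theta> 0 (annulus_cover y)"
      "annulus_cover (\<Psi> (0, snd (s, y))) = \<psi> 0 (annulus_cover y)"
      by (auto simp: I.strip I.inverses I.Phi_shift I.cover)
    let ?D = "\<lambda>v. frechet_derivative \<Phi> (at (0, y)) (0, v)"
    have "((\<lambda>z. \<Phi> (0, snd z)) has_derivative (\<lambda>x. ?D (snd x))) (at (s, y))"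
      using has_derivative_compose[OF has_derivative_snd[OF has_derivative_ident]]
        has_derivative_slice[OF I.smooth(2) y] by fastforce
    note D = frechet_derivative_at[OF this, symmetric]
    \<comment> \<open>The original map is symplectic at the preimage of \<open>y\<close>; applied to
      \<open>?D v\<close> and \<open>?D w\<close>, its derivative returns \<open>v\<close> and
      \<open>w\<close>.\<close>
    have "omega (?D v) (?D w) = omega v w"
      using I.two_form[OF I.strip(2)[OF y, of 0], of 0 0 "?D v" 0 "?D w"] I.frechet_derivative_Psi_Phi[OF y]
      by simp
    then show "omega (frechet_derivative (\<lambda>z. \<Phi> (0, snd z)) (at (s, y)) (a, v))
        (frechet_derivative (\<lambda>z. \<Phi> (0, snd z)) (at (s, y)) (b, w)) =
      omega v w - a * frechet_derivative (\<lambda>(s, y). 0) (at (s, y)) (b, w)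
        + b * frechet_derivative (\<lambda>(s, y). 0) (at (s, y)) (a, v)"
      unfolding D by (simp add: case_prod_unfold)
  next
    have cont: "continuous_on ({0..1::real} \<times> closed_annulus) (\<lambda>z. extension \<psi> id (0::real, snd z))"
      "continuous_on ({0..1::real} \<times> closed_annulus) (\<lambda>z. extension \<theta> id (0::real, snd z))"
      by (auto intro!: continuous_on_compose2[OF I.continuous(1)]
          continuous_on_compose2[OF I.continuous(2)] continuous_intros)
    have ext: "(\<lambda>z::real \<times> phase. extension \<psi> id (0::real, snd z)) = extension (\<lambda>_. \<psi> 0) id"
      "(\<lambda>z::real \<times> phase. extension \<theta> id (0::real, snd z)) = extension (\<lambda>_. \<theta> 0) id"
      by (auto simp: extension_def)
    show "continuous_on ({0..1} \<times> closed_annulus) (extension (\<lambda>_. \<psi> 0) id)"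
      "continuous_on ({0..1} \<times> closed_annulus) (extension (\<lambda>_. \<theta> 0) id)"
      using cont unfolding ext by - assumption+
    show "continuous_on ({0..1} \<times> closed_annulus) (extension (\<lambda>_ _. 0::real) (\<lambda>_. 0))"
      by (simp add: extension_def case_prod_unfold)
  qed
qed

section \<open>Strict convexity of tables\<close>

text \<open>On an open set a local extension agrees with the map on a whole neighbourhood, hence
  shares its derivatives.\<close>

lemma smooth_on_open_imp_C_inf_on:
  assumes "open S" "smooth_on S f"
  shows "C_inf_on S f"
proof (rule C_inf_on_local[OF assms(1)])
  fix x assume "x \<in> S"
  then obtain U g where "open U" "x \<in> U" "\<forall>k. C_k_on k U g" "\<forall>y\<in>S \<inter> U. f y = g y"
    using assms(2) unfolding smooth_on_def by blast
  then have "C_inf_on U g" by (simp add: C_inf_on_def)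
  then have "C_inf_on (S \<inter> U) g"
    by (rule C_inf_on_subset) (use \<open>open U\<close> assms(1) in auto)
  then have "C_inf_on (S \<inter> U) f"
    by (rule C_inf_on_cong) (use \<open>\<forall>y\<in>S \<inter> U. f y = g y\<close> in auto)
  then show "\<exists>V. x \<in> V \<and> C_inf_on V f" using \<open>x \<in> S\<close> \<open>x \<in> U\<close> by blast
qed

lemma vector_derivative_conv_frechet:
  assumes "f differentiable (at t)"
  shows "vector_derivative f (at t) = frechet_derivative f (at t) 1"
proof -
  have "(f has_derivative (\<lambda>x. x *\<^sub>R vector_derivative f (at t))) (at t)"
    using assms vector_derivative_works has_vector_derivative_def by blast
  from frechet_derivative_at[OF this, symmetric] show ?thesis by simp
qed

lemma C_inf_on_vector_derivative:
  assumes "C_inf_on U f"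
  shows "C_inf_on U (\<lambda>t. vector_derivative f (at t))"
    "t \<in> U \<Longrightarrow> (f has_vector_derivative vector_derivative f (at t)) (at t)"
proof -
  have D: "f differentiable (at t)" if "t \<in> U" for t
    using C_inf_on_has_derivative[OF assms that] by (auto simp: differentiable_def)
  then show "t \<in> U \<Longrightarrow> (f has_vector_derivative vector_derivative f (at t)) (at t)"
    by (simp add: vector_derivative_works)
  show "C_inf_on U (\<lambda>t. vector_derivative f (at t))"
    by (rule C_inf_on_cong[OF C_inf_on_frechet_derivative[OF assms, of 1]])
      (simp add: vector_derivative_conv_frechet D)
qed

section \<open>Inner product and determinant in the plane\<close>

lemma bounded_linear_det2: "bounded_linear (det2 u)"
  unfolding det2_def by (auto intro!: bounded_linear_intros)

lemma det2_minus_right [simp]: "det2 u (- v) = - det2 u v"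
  by (simp add: det2_def)

lemma det2_minus_left [simp]: "det2 (- u) v = - det2 u v"
  by (simp add: det2_def)

lemma det2_scaleR_right [simp]: "det2 u (c *\<^sub>R v) = c * det2 u v"
  by (simp add: det2_def algebra_simps)

lemma det2_commute: "det2 u v = - det2 v u"
  by (simp add: det2_def)

lemma inner_real2: "(u::real^2) \<bullet> v = u $ 1 * v $ 1 + u $ 2 * v $ 2"
  by (simp add: inner_vec_def sum_2)

text \<open>For a unit vector \<open>u\<close> this expands \<open>v \<bullet> w\<close> in the
  orthonormal frame formed by \<open>u\<close> and its rotation by a right angle.\<close>

lemma det2_inner_identity:
  "(u \<bullet> u) * (v \<bullet> w) = (u \<bullet> v) * (u \<bullet> w) + det2 u v * det2 u w"
  by (simp add: inner_real2 det2_def algebra_simps)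

lemma det2_eq_0_unit:
  assumes "norm u = 1" "norm v = 1" "det2 u v = 0"
  shows "v = u \<or> v = - u"
proof -
  have 1: "u \<bullet> u = 1" "v \<bullet> v = 1" using assms by (simp_all add: norm_eq_1)
  have "(u \<bullet> v)\<^sup>2 = 1" using det2_inner_identity[of u v v] 1 assms(3) by (simp add: power2_eq_square)
  then have "u \<bullet> v = 1 \<or> u \<bullet> v = -1" by (simp add: power2_eq_1_iff)
  moreover have "(v - u) \<bullet> (v - u) = 2 - 2 * (u \<bullet> v)" "(v + u) \<bullet> (v + u) = 2 + 2 * (u \<bullet> v)"
    using 1 by (simp_all add: inner_diff inner_add inner_commute)
  ultimately have "(v - u) \<bullet> (v - u) = 0 \<or> (v + u) \<bullet> (v + u) = 0" by auto
  then show ?thesis by (auto simp: add_eq_0_iff)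
qed

lemma det2_has_real_derivative:
  "(f has_vector_derivative f') F \<Longrightarrow> ((\<lambda>t. det2 u (f t)) has_real_derivative det2 u f') F"
  using bounded_linear.has_vector_derivative[OF bounded_linear_det2]
  by (simp add: has_real_derivative_iff_has_vector_derivative)

section \<open>Boundary curves as periodic functions\<close>

lemma periodic_vector_derivative:
  fixes f :: "real \<Rightarrow> 'a::real_normed_vector"
  assumes "\<And>t. f (t + c) = f t"
  shows "vector_derivative f (at (t + c)) = vector_derivative f (at t)"
proof -
  have shift: "(f has_vector_derivative D) (at t)"
    if "(f has_vector_derivative D) (at (t + c))" "\<And>t. f (t + c) = f t" for D c t
  proof -
    have "((\<lambda>t. t + c) has_vector_derivative 1) (at t)" by (auto intro!: derivative_eq_intros)
    from vector_diff_chain_at[OF this that(1)] show ?thesis using that(2) by (simp add: o_def)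
  qed
  have "f (t - c) = f t" for t using assms[of "t - c"] by simp
  then have "(f has_vector_derivative D) (at (t + c)) \<longleftrightarrow> (f has_vector_derivative D) (at t)" for D
    using shift[of D t c] shift[of D "t + c" "- c"] assms by auto
  then show ?thesis by (simp add: vector_derivative_def)
qed

locale table =
  fixes \<gamma> :: "circle \<Rightarrow> real^2"
  assumes table: "\<gamma> \<in> billiard_tables"
begin

definition g where "g t = \<gamma> (circ t)"
definition g' where "g' t = vector_derivative g (at t)"
definition g'' where "g'' t = vector_derivative g' (at t)"

lemma C_inf_g: "C_inf_on UNIV g" and C_inf_g': "C_inf_on UNIV g'"
proof -
  show "C_inf_on UNIV g"
    using table smooth_on_open_imp_C_inf_on[OF open_UNIV, of g] by (simp add: billiard_tables_def g_def[abs_def])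
  then show "C_inf_on UNIV g'"
    unfolding g'_def[abs_def] by (rule C_inf_on_vector_derivative)
qed

lemma g_deriv: "(g has_vector_derivative g' t) (at t)" and g'_deriv: "(g' has_vector_derivative g'' t) (at t)"
  using C_inf_on_vector_derivative(2)[OF C_inf_g] C_inf_on_vector_derivative(2)[OF C_inf_g']
  by (auto simp: g'_def[abs_def] g''_def)

lemma g_shift: "g (t + of_int k) = g t" and g'_shift: "g' (t + of_int k) = g' t"
proof -
  show g: "g (t + of_int k) = g t" for t by (simp add: g_def)
  show "g' (t + of_int k) = g' t" unfolding g'_def by (rule periodic_vector_derivative) (rule g)
qed

lemma g_eq_iff: "g t = g u \<longleftrightarrow> circ t = circ u"
  using table by (auto simp: g_def billiard_tables_def inj_eq)

lemma rep_circle_circ: obtains k :: int where "rep_circle (circ t) = t + of_int k"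
  using circ_eq_iff[of t "rep_circle (circ t)"] by auto

lemma circle_deriv_circ: "circle_deriv \<gamma> (circ t) = g' t"
proof -
  obtain k :: int where k: "rep_circle (circ t) = t + of_int k" by (rule rep_circle_circ)
  have "circle_deriv \<gamma> (circ t) = g' (t + of_int k)"
    unfolding circle_deriv_def k g'_def by (simp add: g_def[abs_def])
  then show ?thesis by (simp add: g'_shift)
qed

lemma circle_deriv2_circ: "circle_deriv (circle_deriv \<gamma>) (circ t) = g'' t"
proof -
  obtain k :: int where k: "rep_circle (circ t) = t + of_int k" by (rule rep_circle_circ)
  have "circle_deriv (circle_deriv \<gamma>) (circ t) = vector_derivative g' (at (t + of_int k))"
    unfolding circle_deriv_def[of "circle_deriv \<gamma>"] k circle_deriv_circ ..
  also have "\<dots> = g'' t" unfolding g''_def by (rule periodic_vector_derivative) (rule g'_shift)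
  finally show ?thesis .
qed

lemma norm_g' [simp]: "norm (g' t) = 1"
  unfolding circle_deriv_circ[symmetric] using table unfolding billiard_tables_def by blast

lemma curvature_pos: "det2 (g' t) (g'' t) > 0"
  unfolding circle_deriv_circ[symmetric] circle_deriv2_circ[symmetric]
  using table unfolding billiard_tables_def by blast

text \<open>If \<open>g T\<close> were on the tangent line at \<open>g t\<close>, then so would be a whole boundary segment;
  but the height over the tangent line has only nondegenerate zeros.\<close>

lemma strictly_left:
  assumes "circ t \<noteq> circ T"
  shows "det2 (g' t) (g T - g t) > 0"
proof (rule ccontr)
  assume neg: "\<not> det2 (g' t) (g T - g t) > 0"
  define h where "h x = det2 (g' t) (x - g t)" for x
  have range_g: "range \<gamma> = range g"
    by (auto simp: g_def) (metis circ_rep_circle rangeI)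
  have "\<exists>K. compact K \<and> convex K \<and> interior K \<noteq> {} \<and> frontier K = range \<gamma> \<and>
      (\<forall>q. \<forall>x\<in>interior K. det2 (circle_deriv \<gamma> q) (x - \<gamma> q) > 0)"
    using table unfolding billiard_tables_def by blast
  then obtain K where K: "compact K" "convex K" "interior K \<noteq> {}" "frontier K = range g"
    and left: "\<forall>q. \<forall>x\<in>interior K. det2 (circle_deriv \<gamma> q) (x - \<gamma> q) > 0"
    unfolding range_g by blast
  have pos: "h x > 0" if "x \<in> interior K" for x
    using left that unfolding h_def circle_deriv_circ[symmetric] g_def by blast
  have cont: "continuous_on A h" for A
    unfolding h_def
    by (intro bounded_linear.continuous_on[OF bounded_linear_det2] continuous_intros)
  have "closed K" using K(1) by (rule compact_imp_closed)
  \<comment> \<open>A closed convex set with nonempty interior is the closure of that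
    interior.\<close>
  have nonneg: "h x \<ge> 0" if "x \<in> K" for x
  proof -
    have "closure (interior K) \<subseteq> {x. 0 \<le> h x}"
      using pos cont by (intro closure_minimal closed_Collect_le) (auto intro: less_imp_le)
    then show ?thesis
      using that convex_closure_interior[OF K(2,3)] \<open>closed K\<close> by auto
  qed
  have gK: "g u \<in> K" for u
    using K(4) \<open>closed K\<close> by (metis closure_closed frontier_def Diff_iff rangeI)
  have hT: "h (g T) = 0" using neg nonneg[OF gK, of T] by (simp add: h_def)
  define Z where "Z = {u \<in> {0..1}. h (g u) = 0}"
  have "closed_segment (g t) (g T) \<subseteq> g ` Z"
  proof
    fix x assume x: "x \<in> closed_segment (g t) (g T)"
    then obtain c where "x = (1 - c) *\<^sub>R g t + c *\<^sub>R g T" by (auto simp: in_segment)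
    then have "x - g t = c *\<^sub>R (g T - g t)" by (simp add: algebra_simps)
    then have "h x = 0" using hT by (simp add: h_def)
    moreover have "x \<in> K" using x gK K(2) by (meson convex_contains_segment subsetD)
    ultimately have "x \<in> frontier K"
      using pos[of x] \<open>closed K\<close> by (auto simp: frontier_def)
    then obtain u where u: "x = g u" using K(4) by auto
    have "g (frac u) = g u" using g_shift[of "frac u" "\<lfloor>u\<rfloor>"] by (simp add: frac_def)
    moreover have "frac u \<in> {0..1}" using frac_lt_1[of u] by simp
    ultimately show "x \<in> g ` Z" using u \<open>h x = 0\<close> by (intro image_eqI[of _ _ "frac u"]) (auto simp: Z_def)
  qed
  moreover have "infinite (closed_segment (g t) (g T))"
    using assms g_eq_iff by simp
  ultimately have "infinite Z" using finite_surj by blast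
  moreover have "Z \<subseteq> {0..1}" by (auto simp: Z_def)
  ultimately obtain u where u: "u islimpt Z"
    using compact_eq_Bolzano_Weierstrass[of "{0..1::real}"] by blast
  have h_g: "((\<lambda>u. h (g u)) has_real_derivative det2 (g' t) (g' v)) (at v)" for v
    unfolding h_def using g_deriv by (intro det2_has_real_derivative) (auto intro!: derivative_eq_intros)
  \<comment> \<open>The height is nonnegative along the boundary, so each of its zeros is a
    minimum.\<close>
  have zero_deriv: "det2 (g' t) (g' v) = 0" if "h (g v) = 0" for v
    using DERIV_local_min[OF h_g[of v], of 1] nonneg[OF gK] that by auto
  have "closed {v. h (g v) = 0}"
    by (intro closed_Collect_eq continuous_at_imp_continuous_on ballI)
      (use h_g DERIV_isCont in auto)
  moreover have "u islimpt {v. h (g v) = 0}" using u by (rule islimpt_subset) (auto simp: Z_def)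
  ultimately have hu: "h (g u) = 0" using closed_limpt by blast
  \<comment> \<open>The zeros \<open>X n\<close> of the height are zeros of its derivative as well.
    As they accumulate at \<open>u\<close>, the second derivative vanishes at \<open>u\<close>,
    where the tangent is parallel to \<open>g' t\<close>; positive curvature forbids this.\<close>
  obtain X where X: "\<And>n::nat. X n \<in> Z - {u}" "X \<longlonglongrightarrow> u"
    using u unfolding islimpt_sequential by blast
  have "((\<lambda>v. det2 (g' t) (g' v)) has_real_derivative det2 (g' t) (g'' u)) (at u)"
    by (intro det2_has_real_derivative g'_deriv)
  then have "((\<lambda>v. (det2 (g' t) (g' v) - det2 (g' t) (g' u)) / (v - u)) \<longlongrightarrow> det2 (g' t) (g'' u)) (at u)"
    by (simp add: has_field_derivative_iff)
  moreover have "filterlim X (at u) sequentially"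
    using X by (auto simp: filterlim_at)
  ultimately have "(\<lambda>n. (det2 (g' t) (g' (X n)) - det2 (g' t) (g' u)) / (X n - u)) \<longlonglongrightarrow> det2 (g' t) (g'' u)"
    by (rule filterlim_compose)
  moreover have "det2 (g' t) (g' (X n)) = 0" for n using X(1)[of n] zero_deriv by (auto simp: Z_def)
  ultimately have "det2 (g' t) (g'' u) = 0"
    using zero_deriv[OF hu] by (simp add: LIMSEQ_const_iff)
  moreover have "g' u = g' t \<or> g' u = - g' t"
    using det2_eq_0_unit[OF norm_g' norm_g' zero_deriv[OF hu]] .
  ultimately show False using curvature_pos[of u] by auto
qed

end

section \<open>Chords in a family of tables\<close>

locale billiard_family =
  fixes G :: "real \<Rightarrow> circle \<Rightarrow> real^2"
  assumes smooth_family: "C_inf_on UNIV (\<lambda>(s, t). G s (circ t))"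
    and tables: "G s \<in> billiard_tables"
begin

definition c :: "real \<times> real \<Rightarrow> real^2" where "c z = G (fst z) (circ (snd z))"
definition ct where "ct z = frechet_derivative c (at z) (0, 1)"
definition cs where "cs z = frechet_derivative c (at z) (1, 0)"

lemma C_inf_c: "C_inf_on UNIV c"
  using smooth_family by (simp add: c_def[abs_def] case_prod_unfold)

lemma C_inf_ct: "C_inf_on UNIV ct" and C_inf_cs: "C_inf_on UNIV cs"
  unfolding ct_def[abs_def] cs_def[abs_def] by (intro C_inf_intros C_inf_c)+

lemma c_has_derivative: "(c has_derivative (\<lambda>w. fst w *\<^sub>R cs z + snd w *\<^sub>R ct z)) (at z)"
proof -
  have D: "(c has_derivative frechet_derivative c (at z)) (at z)"
    using C_inf_on_has_derivative[OF C_inf_c] by simp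
  note lin = has_derivative_linear[OF D]
  have "frechet_derivative c (at z) = (\<lambda>w. fst w *\<^sub>R cs z + snd w *\<^sub>R ct z)"
  proof
    fix w :: "real \<times> real"
    have "frechet_derivative c (at z) (fst w *\<^sub>R (1, 0) + snd w *\<^sub>R (0, 1)) = fst w *\<^sub>R cs z + snd w *\<^sub>R ct z"
      unfolding linear_add[OF lin] linear_scale[OF lin] by (simp add: cs_def ct_def)
    then show "frechet_derivative c (at z) w = fst w *\<^sub>R cs z + snd w *\<^sub>R ct z" by simp
  qed
  with D show ?thesis by simp
qed

lemma table_g: "table.g (G s) t = c (s, t)"
  using tables by (simp add: table.g_def c_def table_def)

lemma c_deriv_t: "((\<lambda>t. c (s, t)) has_vector_derivative ct (s, t)) (at t within A)"
proof -
  have "((\<lambda>t. (s, t)) has_derivative (\<lambda>x. (0, x))) (at t within A)"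
    by (auto intro!: derivative_eq_intros)
  from has_derivative_compose[OF this c_has_derivative] show ?thesis
    by (simp add: has_vector_derivative_def)
qed

lemma c_deriv_s: "((\<lambda>s. c (s, t)) has_vector_derivative cs (s, t)) (at s within A)"
proof -
  have "((\<lambda>s. (s, t)) has_derivative (\<lambda>x. (x, 0))) (at s within A)"
    by (auto intro!: derivative_eq_intros)
  from has_derivative_compose[OF this c_has_derivative] show ?thesis
    by (simp add: has_vector_derivative_def)
qed

lemma table_g': "table.g' (G s) t = ct (s, t)"
proof -
  interpret table "G s" by unfold_locales (rule tables)
  have "g = (\<lambda>t. c (s, t))" by (simp add: table_g fun_eq_iff)
  then show ?thesis using c_deriv_t[of s t UNIV] by (simp add: g'_def vector_derivative_at)
qed

lemma norm_ct [simp]: "norm (ct (s, t)) = 1"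
  using table.norm_g'[of "G s" t] tables table_g' by (simp add: table_def)

lemma circle_deriv_G: "circle_deriv (G s) (circ t) = ct (s, t)"
  using table.circle_deriv_circ[of "G s" t] tables table_g' by (simp add: table_def)

lemma c_shift [simp]: "c (s, t + of_int k) = c (s, t)"
  by (simp add: c_def)

lemma ct_shift [simp]: "ct (s, t + of_int k) = ct (s, t)"
  by (metis circle_deriv_G circ_add_int)

lemma cs_shift [simp]: "cs (s, t + of_int k) = cs (s, t)"
  using c_deriv_s[of "t + of_int k" s UNIV] c_deriv_s[of t s UNIV] vector_derivative_unique_at
  by fastforce

lemma c_shift_1 [simp]: "c (s, t + 1) = c (s, t)" "ct (s, t + 1) = ct (s, t)" "cs (s, t + 1) = cs (s, t)"
  using c_shift[of s t 1] ct_shift[of s t 1] cs_shift[of s t 1] by simp_all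

lemma circ_neq: "t < T \<Longrightarrow> T < t + 1 \<Longrightarrow> circ t \<noteq> circ T"
proof
  assume "t < T" "T < t + 1" "circ t = circ T"
  then obtain k :: int where "T = t + of_int k" "0 < k" "k < 1"
    by (metis add_less_cancel_left circ_eq_iff less_add_same_cancel1 of_int_0_less_iff of_int_less_1_iff)
  then show False by simp
qed

lemma strictly_left_t: "circ t \<noteq> circ T \<Longrightarrow> det2 (ct (s, t)) (c (s, T) - c (s, t)) > 0"
  using table.strictly_left[of "G s" t T] tables table_g table_g' by (simp add: table_def)

text \<open>Once the starting parameter \<open>t\<close> is fixed, every other point of the circle
  has exactly one parameter \<open>T\<close> in this range. The ends \<open>T = t\<close> and
  \<open>T = t + 1\<close> are the two ways in which a chord degenerates.\<close>

definition chords :: "(real \<times> real \<times> real) set" where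
  "chords = {(s, t, T). t < T \<and> T < t + 1}"

definition V :: "real \<times> real \<times> real \<Rightarrow> real^2" where
  "V z = c (fst z, snd (snd z)) - c (fst z, fst (snd z))"

definition L where "L z = norm (V z)"
definition u where "u z = V z /\<^sub>R norm (V z)"
definition dL where "dL w z = frechet_derivative L (at z) w"

text \<open>By \<open>dL_eq\<close> below these are the partial derivatives of \<open>L\<close>, up to the sign of \<open>F\<close>.\<close>

definition F where "F z = u z \<bullet> ct (fst z, fst (snd z))"
definition P where "P z = u z \<bullet> ct (fst z, snd (snd z))"
definition K where "K z = u z \<bullet> (cs (fst z, snd (snd z)) - cs (fst z, fst (snd z)))"

section \<open>Chord length and its differential\<close>

lemma open_chords: "open chords"
proof -
  have eq: "chords = {z. fst (snd z) < snd (snd z)} \<inter> {z. snd (snd z) < fst (snd z) + 1}"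
    by (auto simp: chords_def)
  show ?thesis unfolding eq by (auto intro!: open_Int open_Collect_less continuous_intros)
qed

lemma V_nonzero: "z \<in> chords \<Longrightarrow> V z \<noteq> 0"
  using strictly_left_t[of "fst (snd z)" "snd (snd z)" "fst z"] circ_neq
  by (auto simp: chords_def V_def det2_def)

lemma norm_u: "z \<in> chords \<Longrightarrow> norm (u z) = 1"
  using V_nonzero by (simp add: u_def)

lemma C_inf_comp_UNIV:
  fixes f :: "'a::euclidean_space \<Rightarrow> 'b::euclidean_space"
  shows "C_inf_on UNIV g \<Longrightarrow> C_inf_on U f \<Longrightarrow> C_inf_on U (\<lambda>x. g (f x))"
  by (rule C_inf_on_compose) auto

lemma C_inf_V: "C_inf_on chords V"
  unfolding V_def[abs_def]
  by (intro C_inf_intros C_inf_comp_UNIV[OF C_inf_c] open_chords)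

lemma C_inf_L: "C_inf_on chords L"
  unfolding L_def[abs_def] by (intro C_inf_on_norm C_inf_V V_nonzero)

lemma C_inf_u: "C_inf_on chords u"
  unfolding u_def[abs_def]
  by (intro C_inf_intros C_inf_on_inverse_comp C_inf_on_norm C_inf_V) (auto simp: V_nonzero)

lemma C_inf_F: "C_inf_on chords F" and C_inf_P: "C_inf_on chords P" and C_inf_K: "C_inf_on chords K"
  unfolding F_def[abs_def] P_def[abs_def] K_def[abs_def]
  by (intro C_inf_intros C_inf_u C_inf_comp_UNIV[OF C_inf_ct] C_inf_comp_UNIV[OF C_inf_cs] open_chords)+

lemma V_has_derivative:
  "(V has_derivative (\<lambda>w. fst w *\<^sub>R cs (fst z, snd (snd z)) + snd (snd w) *\<^sub>R ct (fst z, snd (snd z))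
     - (fst w *\<^sub>R cs (fst z, fst (snd z)) + fst (snd w) *\<^sub>R ct (fst z, fst (snd z))))) (at z)"
proof -
  have 1: "((\<lambda>z. (fst z, snd (snd z))) has_derivative (\<lambda>w. (fst w, snd (snd w)))) (at z)"
    "((\<lambda>z. (fst z, fst (snd z))) has_derivative (\<lambda>w. (fst w, fst (snd w)))) (at z)"
    by (auto intro!: derivative_eq_intros)
  show ?thesis
    unfolding V_def[abs_def]
    using has_derivative_diff[OF has_derivative_compose[OF 1(1) c_has_derivative]
        has_derivative_compose[OF 1(2) c_has_derivative]] by simp
qed

text \<open>The first variation formula: the derivative of the norm at \<open>V z\<close> is the
  pairing with the unit vector \<open>u z\<close>, and the starting point enters \<open>V\<close>
  with a minus sign.\<close>

lemma dL_eq: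
  assumes "z \<in> chords"
  shows "dL w z = fst w * K z - fst (snd w) * F z + snd (snd w) * P z"
proof -
  have "(norm has_derivative (\<lambda>y. sgn (V z) \<bullet> y)) (at (V z))"
    using has_derivative_norm[OF V_nonzero[OF assms]] by (simp add: inner_commute)
  from has_derivative_compose[OF V_has_derivative this]
  have "(L has_derivative (\<lambda>w. sgn (V z) \<bullet> (fst w *\<^sub>R cs (fst z, snd (snd z)) + snd (snd w) *\<^sub>R ct (fst z, snd (snd z))
     - (fst w *\<^sub>R cs (fst z, fst (snd z)) + fst (snd w) *\<^sub>R ct (fst z, fst (snd z)))))) (at z)"
    by (simp add: L_def[abs_def])
  from frechet_derivative_at[OF this, symmetric] show ?thesis
    unfolding dL_def K_def F_def P_def u_def sgn_div_norm
    by (simp add: inner_diff_right inner_add_right algebra_simps)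
qed

text \<open>Closedness of the one-form \<open>K ds - F dt + P dT\<close>, the differential of \<open>L\<close>.\<close>

lemma dL_closed:
  assumes "z \<in> chords"
  defines "D f \<equiv> frechet_derivative f (at z)"
  shows "fst w * D K w' - fst (snd w) * D F w' + snd (snd w) * D P w' =
    fst w' * D K w - fst (snd w') * D F w + snd (snd w') * D P w"
proof -
  have "frechet_derivative (dL w) (at z) w' = fst w * D K w' - fst (snd w) * D F w' + snd (snd w) * D P w'"
    for w w'
  proof -
    have "((\<lambda>z. fst w * K z - fst (snd w) * F z + snd (snd w) * P z) has_derivative
        (\<lambda>w'. fst w * D K w' - fst (snd w) * D F w' + snd (snd w) * D P w')) (at z)"
      unfolding D_def using C_inf_on_has_derivative assms(1) C_inf_K C_inf_F C_inf_P
      by (auto intro!: derivative_eq_intros)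
    then have "(dL w has_derivative
        (\<lambda>w'. fst w * D K w' - fst (snd w) * D F w' + snd (snd w) * D P w')) (at z)"
      by (rule has_derivative_transform_within_open[OF _ open_chords assms(1)]) (simp add: dL_eq)
    from frechet_derivative_at[OF this, symmetric] show ?thesis by simp
  qed
  \<comment> \<open>The two sides are the second derivatives of \<open>L\<close> along
    \<open>w\<close> and \<open>w'\<close>, taken in either order.\<close>
  then show ?thesis
    using frechet_derivative_commute[OF C_inf_L assms(1), of w w'] by (simp add: dL_def[abs_def])
qed

section \<open>Angles between chords and the boundary\<close>

lemma cos_less_1:
  assumes "norm (a::real^2) = 1" "norm b = 1" "det2 b a \<noteq> 0"
  shows "\<bar>a \<bullet> b\<bar> < 1"
proof -
  have "(a \<bullet> b)\<^sup>2 + (det2 b a)\<^sup>2 = 1"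
    using det2_inner_identity[of b a a] assms(1,2)
    by (simp add: norm_eq_1 power2_eq_square inner_commute)
  then have "(a \<bullet> b)\<^sup>2 < 1" using assms(3) by (smt (verit) zero_less_power2)
  then show ?thesis by (simp add: abs_square_less_1)
qed

text \<open>At either end the other end lies strictly to the left of the tangent. Seen from the
  terminal point the chord is traversed backwards, whence the opposite sign.\<close>

lemma det_u:
  assumes "z \<in> chords"
  shows "det2 (ct (fst z, fst (snd z))) (u z) > 0" "det2 (ct (fst z, snd (snd z))) (u z) < 0"
proof -
  obtain s t T where z: "z = (s, t, T)" "t < T" "T < t + 1" using assms by (auto simp: chords_def)
  have "norm (V z) > 0" using V_nonzero[OF assms] by simp
  moreover have "det2 (ct (s, t)) (V z) > 0"
    using strictly_left_t[of t T s] circ_neq z by (simp add: V_def)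
  moreover have "det2 (ct (s, T)) (- V z) > 0"
    using strictly_left_t[of T t s] circ_neq[OF z(2,3)] z(1) by (simp add: V_def)
  ultimately show "det2 (ct (fst z, fst (snd z))) (u z) > 0" "det2 (ct (fst z, snd (snd z))) (u z) < 0"
    by (simp_all add: u_def z(1) divide_less_0_iff mult_less_0_iff)
qed

lemma F_bound: "\<bar>F z\<bar> < 1" and P_bound: "\<bar>P z\<bar> < 1" if "z \<in> chords"
  unfolding F_def P_def using det_u[OF that] norm_u[OF that] by (intro cos_less_1; simp)+

definition FT where "FT z = frechet_derivative F (at z) (0, 0, 1)"

lemma C_inf_FT: "C_inf_on chords FT"
  unfolding FT_def[abs_def] by (intro C_inf_intros C_inf_F)

lemma F_deriv_T:
  assumes "(s, t, T) \<in> chords"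
  shows "((\<lambda>T. F (s, t, T)) has_real_derivative FT (s, t, T)) (at T)"
proof -
  have D: "(F has_derivative frechet_derivative F (at (s, t, T))) (at (s, t, T))"
    using C_inf_on_has_derivative[OF C_inf_F assms] .
  have "((\<lambda>T. (s, t, T)) has_derivative (\<lambda>x. (0, 0, x))) (at T)"
    by (auto intro!: derivative_eq_intros)
  from has_derivative_compose[OF this D] have "((\<lambda>T. F (s, t, T)) has_derivative
      (\<lambda>x. frechet_derivative F (at (s, t, T)) (0, 0, x))) (at T)" .
  moreover have "frechet_derivative F (at (s, t, T)) (0, 0, x) = FT (s, t, T) * x" for x
    using linear_scale[OF has_derivative_linear[OF D], of x "(0, 0, 1)"] by (simp add: FT_def)
  ultimately show ?thesis by (simp add: has_field_derivative_def)
qed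

text \<open>The twist condition. Normalizing the chord removes the component of its derivative along
  \<open>u z\<close>, so with the tangents \<open>e\<close> at the start and \<open>E\<close> at the
  end, \<open>FT z\<close> equals \<open>det2 (u z) E * det2 (u z) e / norm (V z)\<close>. By
  \<open>det_u\<close> the two determinants have opposite signs.\<close>

lemma FT_neg:
  assumes z: "z \<in> chords"
  shows "FT z < 0"
proof -
  obtain s t T where zz: "z = (s, t, T)" by (cases z)
  let ?e = "ct (s, t)" and ?E = "ct (s, T)" and ?u = "u z" and ?N = "norm (V z)"
  have N: "?N > 0" using V_nonzero[OF z] by simp
  have V: "((\<lambda>T. V (s, t, T)) has_vector_derivative ?E) (at T)"
    unfolding V_def using c_deriv_t[of s T UNIV] by (auto intro!: derivative_eq_intros)
  have "((\<lambda>T. norm (V (s, t, T))) has_derivative (\<lambda>x. sgn (V z) \<bullet> (x *\<^sub>R ?E))) (at T)"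
    using has_derivative_compose[OF V[unfolded has_vector_derivative_def] has_derivative_norm] V_nonzero[OF z]
    by (simp add: zz inner_commute)
  then have normV: "((\<lambda>T. norm (V (s, t, T))) has_real_derivative ?u \<bullet> ?E) (at T)"
    unfolding has_field_derivative_def u_def sgn_div_norm
    by (elim has_derivative_eq_rhs) (auto simp: fun_eq_iff)
  have innerV: "((\<lambda>T. V (s, t, T) \<bullet> ?e) has_real_derivative ?E \<bullet> ?e) (at T)"
    using bounded_linear.has_vector_derivative[OF bounded_linear_inner_left V, of ?e]
    by (simp add: has_real_derivative_iff_has_vector_derivative)
  have "((\<lambda>T. V (s, t, T) \<bullet> ?e / norm (V (s, t, T))) has_real_derivative
      ((?E \<bullet> ?e) * ?N - (V z \<bullet> ?e) * (?u \<bullet> ?E)) / (?N * ?N)) (at T)"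
    using DERIV_divide[OF innerV normV] N by (simp add: zz)
  moreover have "((?E \<bullet> ?e) * ?N - (V z \<bullet> ?e) * (?u \<bullet> ?E)) / (?N * ?N) =
      ((?E \<bullet> ?e) - (?u \<bullet> ?e) * (?u \<bullet> ?E)) / ?N"
  proof -
    have "V z \<bullet> ?e = ?N * (?u \<bullet> ?e)" using N by (simp add: u_def)
    then have "(?E \<bullet> ?e) * ?N - (V z \<bullet> ?e) * (?u \<bullet> ?E) =
        ((?E \<bullet> ?e) - (?u \<bullet> ?e) * (?u \<bullet> ?E)) * ?N"
      by (simp add: algebra_simps)
    then show ?thesis using N by simp
  qed
  moreover have "(\<lambda>T. V (s, t, T) \<bullet> ?e / norm (V (s, t, T))) = (\<lambda>T. F (s, t, T))"
    by (simp add: F_def u_def divide_inverse mult.commute)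
  ultimately have "((\<lambda>T. F (s, t, T)) has_real_derivative
      ((?E \<bullet> ?e) - (?u \<bullet> ?e) * (?u \<bullet> ?E)) / ?N) (at T)"
    by (simp only:)
  then have "FT z = ((?E \<bullet> ?e) - (?u \<bullet> ?e) * (?u \<bullet> ?E)) / ?N"
    using DERIV_unique F_deriv_T z unfolding zz by blast
  moreover have "(?E \<bullet> ?e) - (?u \<bullet> ?e) * (?u \<bullet> ?E) = det2 ?u ?E * det2 ?u ?e"
    using det2_inner_identity[of ?u ?E ?e] norm_u[OF z] by (simp add: norm_eq_1 algebra_simps inner_commute)
  moreover have "det2 ?u ?E * det2 ?u ?e < 0"
    using det_u[OF z] det2_commute[of ?u] by (simp add: zz mult_pos_neg mult_less_0_iff)
  ultimately show ?thesis using N by (simp add: divide_neg_pos)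
qed

end

section \<open>The endpoint of a chord as a function of its angle\<close>

lemma has_vector_derivative_imp_difference_quotient:
  assumes "(f has_vector_derivative D) (at x within A)"
  shows "((\<lambda>y. (f y - f x) /\<^sub>R (y - x)) \<longlongrightarrow> D) (at x within A)"
proof (rule LIM_zero_cancel, rule tendsto_norm_zero_cancel)
  have "norm (f y - f x - (y - x) *\<^sub>R D) / norm (y - x) = norm ((f y - f x) /\<^sub>R (y - x) - D)"
    if "y \<noteq> x" for y
  proof -
    have "f y - f x - (y - x) *\<^sub>R D = (y - x) *\<^sub>R ((f y - f x) /\<^sub>R (y - x) - D)"
      using that by (simp add: scaleR_diff_right)
    then show ?thesis using that by (simp only: norm_scaleR) simp
  qed
  then have "\<forall>\<^sub>F y in at x within A.
      norm (f y - f x - (y - x) *\<^sub>R D) / norm (y - x) = norm ((f y - f x) /\<^sub>R (y - x) - D)"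
    by (simp add: eventually_at_filter)
  moreover have "((\<lambda>y. norm (f y - f x - (y - x) *\<^sub>R D) / norm (y - x)) \<longlongrightarrow> 0) (at x within A)"
    using assms unfolding has_vector_derivative_def has_derivative_iff_norm by simp
  ultimately show "((\<lambda>y. norm ((f y - f x) /\<^sub>R (y - x) - D)) \<longlongrightarrow> 0) (at x within A)"
    by (rule Lim_transform_eventually[rotated])
qed

context billiard_family
begin

section \<open>Existence and uniqueness of the endpoint\<close>

lemma F_strict_antimono:
  assumes "t < T" "T < T'" "T' < t + 1"
  shows "F (s, t, T') < F (s, t, T)"
proof (rule DERIV_neg_imp_decreasing[OF assms(2)])
  fix x assume "T \<le> x" "x \<le> T'"
  then have "(s, t, x) \<in> chords" using assms by (simp add: chords_def)
  then show "\<exists>y. ((\<lambda>T. F (s, t, T)) has_real_derivative y) (at x) \<and> y < 0"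
    using F_deriv_T FT_neg by blast
qed

text \<open>The direction of a short chord is a normalized difference quotient of the boundary curve
  and tends to the tangent. Near \<open>t + 1\<close> the parameter difference is negative, which
  reverses the direction and gives the limit -1.\<close>

lemma F_at_right: "((\<lambda>T. F (s, t, T)) \<longlongrightarrow> 1) (at_right t)"
  and F_at_left: "((\<lambda>T. F (s, t, T)) \<longlongrightarrow> -1) (at_left (t + 1))"
proof -
  define q where "q a T = (c (s, T) - c (s, a)) /\<^sub>R (T - a)" for a T
  have q: "(q a \<longlongrightarrow> ct (s, a)) (at a within A)" for a A
    unfolding q_def by (intro has_vector_derivative_imp_difference_quotient c_deriv_t)
  have lim: "((\<lambda>T. q a T \<bullet> ct (s, a) / norm (q a T)) \<longlongrightarrow> 1) (at a within A)" for a A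
  proof -
    have "((\<lambda>T. q a T \<bullet> ct (s, a) / norm (q a T)) \<longlongrightarrow> ct (s, a) \<bullet> ct (s, a) / norm (ct (s, a))) (at a within A)"
      by (intro tendsto_intros q) simp
    then show ?thesis by (simp add: dot_square_norm)
  qed
  have "F (s, t, T) = q t T \<bullet> ct (s, t) / norm (q t T)" if "t < T" for T
  proof -
    have "q t T = V (s, t, T) /\<^sub>R (T - t)" by (simp add: q_def V_def)
    then show ?thesis using that by (simp add: F_def u_def divide_simps)
  qed
  then have "\<forall>\<^sub>F T in at_right t. q t T \<bullet> ct (s, t) / norm (q t T) = F (s, t, T)"
    by (simp add: eventually_at_filter)
  then show "((\<lambda>T. F (s, t, T)) \<longlongrightarrow> 1) (at_right t)"
    by (rule Lim_transform_eventually[OF lim])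
  have "F (s, t, T) = - (q (t + 1) T \<bullet> ct (s, t + 1) / norm (q (t + 1) T))" if "T < t + 1" for T
  proof -
    have "q (t + 1) T = V (s, t, T) /\<^sub>R (T - (t + 1))" by (simp add: q_def V_def)
    then show ?thesis using that by (simp add: F_def u_def divide_simps) (simp add: algebra_simps)
  qed
  then have "\<forall>\<^sub>F T in at_left (t + 1). - (q (t + 1) T \<bullet> ct (s, t + 1) / norm (q (t + 1) T)) = F (s, t, T)"
    by (simp add: eventually_at_filter)
  then show "((\<lambda>T. F (s, t, T)) \<longlongrightarrow> -1) (at_left (t + 1))"
    by (rule Lim_transform_eventually[OF tendsto_minus[OF lim]])
qed

text \<open>The cosine of the angle decreases strictly from 1 to -1 as the endpoint runs once around
  the table, so it takes each value in between exactly once.\<close>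

lemma ex1_hit:
  assumes "-1 < p" "p < 1"
  shows "\<exists>!T. t < T \<and> T < t + 1 \<and> F (s, t, T) = p"
proof (rule ex_ex1I)
  obtain a where a: "t < a" "a < t + 1" "F (s, t, a) > p"
  proof -
    have "\<forall>\<^sub>F T in at_right t. F (s, t, T) > p" using order_tendstoD(1)[OF F_at_right] assms by auto
    moreover have "\<forall>\<^sub>F T in at_right t. t < T \<and> T < t + 1"
      by (intro eventually_conj eventually_at_right_less) (simp add: eventually_at_right_less eventually_at_right[of t "t + 1"] exI[of _ "t + 1"])
    ultimately have "\<forall>\<^sub>F T in at_right t. t < T \<and> T < t + 1 \<and> F (s, t, T) > p"
      by eventually_elim auto
    then show thesis using that eventually_happens'[OF trivial_limit_at_right_real] by blast
  qed
  obtain b where b: "t < b" "b < t + 1" "F (s, t, b) < p"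
  proof -
    have "\<forall>\<^sub>F T in at_left (t + 1). F (s, t, T) < p" using order_tendstoD(2)[OF F_at_left] assms by auto
    moreover have "\<forall>\<^sub>F T in at_left (t + 1). t < T \<and> T < t + 1"
      by (simp add: eventually_at_left[of t "t + 1"] exI[of _ t])
    ultimately have "\<forall>\<^sub>F T in at_left (t + 1). t < T \<and> T < t + 1 \<and> F (s, t, T) < p"
      by eventually_elim auto
    then show thesis using that eventually_happens'[OF trivial_limit_at_left_real] by blast
  qed
  have "a \<le> b"
    using F_strict_antimono[of t b a s] a b by force
  moreover have "isCont (\<lambda>T. F (s, t, T)) x" if "a \<le> x" "x \<le> b" for x
    using that a b by (intro DERIV_isCont[OF F_deriv_T]) (simp add: chords_def)
  ultimately obtain T where "a \<le> T" "T \<le> b" "F (s, t, T) = p"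
    using IVT2[of "\<lambda>T. F (s, t, T)" b p a] a b by force
  then show "\<exists>T. t < T \<and> T < t + 1 \<and> F (s, t, T) = p" using a b by (intro exI[of _ T]) auto
next
  show "T = T'" if "t < T \<and> T < t + 1 \<and> F (s, t, T) = p" "t < T' \<and> T' < t + 1 \<and> F (s, t, T') = p" for T T'
    using F_strict_antimono[of t T T' s] F_strict_antimono[of t T' T s] that by (cases T T' rule: linorder_cases) auto
qed

text \<open>The values for \<open>p \<ge> 1\<close> and \<open>p \<le> -1\<close> make \<open>hit\<close> continuous on the whole space.\<close>

definition hit :: "real \<times> real \<times> real \<Rightarrow> real" where
  "hit z = (if snd (snd z) \<ge> 1 then fst (snd z) else if snd (snd z) \<le> -1 then fst (snd z) + 1
     else THE T. fst (snd z) < T \<and> T < fst (snd z) + 1 \<and> F (fst z, fst (snd z), T) = snd (snd z))"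

definition chord :: "real \<times> real \<times> real \<Rightarrow> real \<times> real \<times> real" where
  "chord z = (fst z, fst (snd z), hit z)"

abbreviation "spacetime \<equiv> UNIV \<times> strip :: (real \<times> real \<times> real) set"

lemma chord_in_chords: "chord z \<in> chords" and F_chord: "F (chord z) = snd (snd z)" if "z \<in> spacetime"
proof -
  have "-1 < snd (snd z)" "snd (snd z) < 1" using that by (auto simp: strip_def)
  from theI'[OF ex1_hit[OF this, of "fst (snd z)" "fst z"]] this
  show "chord z \<in> chords" "F (chord z) = snd (snd z)" by (simp_all add: chord_def chords_def hit_def)
qed

lemma hit_bounds_strict: "z \<in> spacetime \<Longrightarrow> fst (snd z) < hit z \<and> hit z < fst (snd z) + 1"
  using chord_in_chords[of z] by (simp add: chord_def chords_def)

lemma hit_outside: "z \<notin> spacetime \<Longrightarrow> hit z = fst (snd z) \<and> snd (snd z) \<ge> 1 \<or> hit z = fst (snd z) + 1 \<and> snd (snd z) \<le> -1"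
  by (cases z) (auto simp: hit_def strip_def)

lemma hit_bounds: "fst (snd z) \<le> hit z" "hit z \<le> fst (snd z) + 1"
  using hit_bounds_strict[of z] hit_outside[of z] by fastforce+

lemma hit_eqI:
  assumes "t < T" "T < t + 1" "F (s, t, T) = p"
  shows "hit (s, t, p) = T"
proof -
  have "\<bar>p\<bar> < 1" using F_bound[of "(s, t, T)"] assms by (simp add: chords_def)
  then have "hit (s, t, p) = (THE T. t < T \<and> T < t + 1 \<and> F (s, t, T) = p)"
    by (auto simp: hit_def)
  also have "\<dots> = T" using ex1_hit[of p t s] assms \<open>\<bar>p\<bar> < 1\<close> by (intro the1_equality) auto
  finally show ?thesis .
qed

text \<open>Turns comparisons of the implicitly defined \<open>hit\<close> into comparisons of
  values of \<open>F\<close>. They persist off \<open>spacetime\<close>, because \<open>F\<close>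
  lies strictly between -1 and 1 on genuine chords.\<close>

lemma less_hit_iff:
  assumes T: "fst (snd z) < T" "T < fst (snd z) + 1"
  shows "T < hit z \<longleftrightarrow> snd (snd z) < F (fst z, fst (snd z), T)"
    "hit z < T \<longleftrightarrow> F (fst z, fst (snd z), T) < snd (snd z)"
proof -
  have "(T < hit z \<longleftrightarrow> snd (snd z) < F (fst z, fst (snd z), T)) \<and>
    (hit z < T \<longleftrightarrow> F (fst z, fst (snd z), T) < snd (snd z))"
  proof (cases "z \<in> spacetime")
    case True
    have F: "F (fst z, fst (snd z), hit z) = snd (snd z)" using F_chord[OF True] by (simp add: chord_def)
    have b: "fst (snd z) < hit z" "hit z < fst (snd z) + 1" using hit_bounds_strict[OF True] by auto
    show ?thesis
      using F_strict_antimono[of "fst (snd z)" T "hit z" "fst z"]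
        F_strict_antimono[of "fst (snd z)" "hit z" T "fst z"] F b assms
      by (cases T "hit z" rule: linorder_cases; auto)
  next
    case False
    have "\<bar>F (fst z, fst (snd z), T)\<bar> < 1" using T by (intro F_bound) (simp add: chords_def)
    then show ?thesis using hit_outside[OF False] T by auto
  qed
  then show "T < hit z \<longleftrightarrow> snd (snd z) < F (fst z, fst (snd z), T)"
    "hit z < T \<longleftrightarrow> F (fst z, fst (snd z), T) < snd (snd z)" by auto
qed

section \<open>Continuity and smoothness of the endpoint\<close>

lemma F_isCont: "z \<in> chords \<Longrightarrow> isCont F z"
  using C_inf_on_imp_continuous_on[OF C_inf_F] open_chords by (simp add: continuous_on_eq_continuous_at)

text \<open>For \<open>T\<close> strictly between \<open>a\<close> and \<open>hit z0\<close>, the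
  relation of \<open>T\<close> to \<open>hit z\<close> is by \<open>less_hit_iff\<close> a strict
  inequality between continuous functions of \<open>z\<close>, so it persists near
  \<open>z0\<close>. This monotonicity argument also reaches the boundary of the strip, where the
  derivative of \<open>F\<close> gives no information.\<close>

lemma hit_isCont: "isCont hit z0"
proof -
  have lim: "((\<lambda>z. F (fst z, fst (snd z), T)) \<longlongrightarrow> F (fst z0, fst (snd z0), T)) (at z0)"
    "\<forall>\<^sub>F z in at z0. fst (snd z) < T \<and> T < fst (snd z) + 1"
    if "fst (snd z0) < T" "T < fst (snd z0) + 1" for T
  proof -
    have "(fst z0, fst (snd z0), T) \<in> chords" using that by (simp add: chords_def)
    then show "((\<lambda>z. F (fst z, fst (snd z), T)) \<longlongrightarrow> F (fst z0, fst (snd z0), T)) (at z0)"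
      by (intro isCont_tendsto_compose[OF F_isCont] tendsto_intros)
    have l: "((\<lambda>z. fst (snd z)) \<longlongrightarrow> fst (snd z0)) (at z0)" by (intro tendsto_intros)
    show "\<forall>\<^sub>F z in at z0. fst (snd z) < T \<and> T < fst (snd z) + 1"
      using order_tendstoD(2)[OF l that(1)] order_tendstoD(1)[OF l, of "T - 1"] that
      by (auto elim: eventually_elim2)
  qed
  have t: "((\<lambda>z. fst (snd z)) \<longlongrightarrow> fst (snd z0)) (at z0)" by (intro tendsto_intros)
  have p: "((\<lambda>z. snd (snd z)) \<longlongrightarrow> snd (snd z0)) (at z0)" by (intro tendsto_intros)
  have "(hit \<longlongrightarrow> hit z0) (at z0)"
  proof (rule order_tendstoI)
    fix a assume a: "a < hit z0"
    show "\<forall>\<^sub>F z in at z0. a < hit z"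
    \<comment> \<open>Below the starting parameter no chord is available for comparison, but the
      bound \<open>hit_bounds\<close> suffices there.\<close>
    proof (cases "a < fst (snd z0)")
      case True
      show ?thesis
        using order_tendstoD(1)[OF t True] by (rule eventually_mono) (erule less_le_trans[OF _ hit_bounds(1)])
    next
      case False
      then obtain T where T: "a < T" "T < hit z0" using dense[OF a] by auto
      then have r: "fst (snd z0) < T" "T < fst (snd z0) + 1" using hit_bounds[of z0] False by auto
      have "\<forall>\<^sub>F z in at z0. snd (snd z) - F (fst z, fst (snd z), T) < 0"
        using order_tendstoD(2)[OF tendsto_diff[OF p lim(1)[OF r]], of 0] less_hit_iff(1)[OF r] T by simp
      then show ?thesis
        using lim(2)[OF r]
      proof eventually_elim
        case (elim z)
        then show ?case using less_hit_iff(1)[of z T] T by auto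
      qed
    qed
  next
    fix a assume a: "hit z0 < a"
    show "\<forall>\<^sub>F z in at z0. hit z < a"
    proof (cases "fst (snd z0) + 1 < a")
      case True
      have "((\<lambda>z. fst (snd z) + 1) \<longlongrightarrow> fst (snd z0) + 1) (at z0)" by (intro tendsto_intros)
      from order_tendstoD(2)[OF this True] show ?thesis
        by (rule eventually_mono) (rule le_less_trans[OF hit_bounds(2)])
    next
      case False
      then obtain T where T: "hit z0 < T" "T < a" using dense[OF a] by auto
      then have r: "fst (snd z0) < T" "T < fst (snd z0) + 1" using hit_bounds[of z0] False by auto
      have "\<forall>\<^sub>F z in at z0. F (fst z, fst (snd z), T) - snd (snd z) < 0"
        using order_tendstoD(2)[OF tendsto_diff[OF lim(1)[OF r] p], of 0] less_hit_iff(2)[OF r] T by simp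
      then show ?thesis
        using lim(2)[OF r]
      proof eventually_elim
        case (elim z)
        then show ?case using less_hit_iff(2)[of z T] T by auto
      qed
    qed
  qed
  then show ?thesis by (simp add: isCont_def)
qed

text \<open>Implicit differentiation of \<open>F (chord z) = snd (snd z)\<close>, solved for the
  differential of \<open>hit\<close>.\<close>

definition dhit where
  "dhit z w = (snd (snd w) - frechet_derivative F (at (chord z)) (fst w, fst (snd w), 0)) * inverse (FT (chord z))"

definition dchord where
  "dchord z w = (fst w, fst (snd w), dhit z w)"

text \<open>\<open>chord\<close> inverts the map that replaces the endpoint by the value of
  \<open>F\<close>. The inverse is already known to be continuous, and the derivative of the map is
  invertible since \<open>FT\<close> does not vanish, so the inverse is differentiable.\<close>

lemma chord_has_derivative:
  assumes z: "z \<in> spacetime"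
  shows "(chord has_derivative dchord z) (at z)"
proof -
  let ?DF = "frechet_derivative F (at (chord z))"
  have DF: "(F has_derivative ?DF) (at (chord z))"
    using C_inf_on_has_derivative[OF C_inf_F chord_in_chords[OF z]] .
  note lin = has_derivative_linear[OF DF]
  have bl: "bounded_linear ?DF" using DF has_derivative_bounded_linear by blast
  show ?thesis
  proof (rule has_derivative_inverse_basic)
    show "((\<lambda>x. (fst x, fst (snd x), F x)) has_derivative (\<lambda>w. (fst w, fst (snd w), ?DF w))) (at (chord z))"
      by (intro derivative_intros DF)
    have "bounded_linear (\<lambda>w. ?DF (fst w, fst (snd w), 0))"
      by (intro bounded_linear_compose[OF bl] bounded_linear_Pair bounded_linear_fst
          bounded_linear_fst_comp bounded_linear_snd bounded_linear_zero)
    then show "bounded_linear (dchord z)"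
      unfolding dchord_def[abs_def] dhit_def[abs_def]
      by (intro bounded_linear_Pair bounded_linear_fst bounded_linear_mult_const bounded_linear_sub
        bounded_linear_compose[OF bounded_linear_fst bounded_linear_snd]
        bounded_linear_compose[OF bounded_linear_snd bounded_linear_snd])
    show "dchord z \<circ> (\<lambda>w. (fst w, fst (snd w), ?DF w)) = id"
    proof
      fix w :: "real \<times> real \<times> real"
      have "?DF (fst w, fst (snd w), 0) + snd (snd w) *\<^sub>R ?DF (0, 0, 1) = ?DF ((fst w, fst (snd w), 0) + snd (snd w) *\<^sub>R (0, 0, 1))"
        by (simp only: linear_add[OF lin] linear_scale[OF lin])
      also have "(fst w, fst (snd w), 0) + snd (snd w) *\<^sub>R (0, 0, 1) = w" by (cases w) auto
      finally have "?DF w = ?DF (fst w, fst (snd w), 0) + snd (snd w) * FT (chord z)"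
        by (simp add: FT_def)
      then show "(dchord z \<circ> (\<lambda>w. (fst w, fst (snd w), ?DF w))) w = id w"
        using FT_neg[OF chord_in_chords[OF z]] by (simp add: dchord_def dhit_def prod_eq_iff)
    qed
    show "continuous (at z) chord"
      unfolding chord_def[abs_def] by (intro continuous_intros hit_isCont)
    show "open spacetime" by (rule open_time_strip)
    show "z \<in> spacetime" by fact
    show "(fst (chord x), fst (snd (chord x)), F (chord x)) = x" if "x \<in> spacetime" for x
      using F_chord[OF that] by (simp add: chord_def prod_eq_iff)
  qed
qed

text \<open>Bootstrapping: the derivative \<open>dchord\<close> is built from smooth functions
  evaluated at \<open>chord\<close>, so each order of differentiability of \<open>chord\<close>
  yields the next.\<close>

lemma C_inf_chord: "C_inf_on spacetime chord"
proof -
  have sub: "chord ` spacetime \<subseteq> chords" using chord_in_chords by blast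
  have "C_k_on k spacetime chord" for k
  proof (induction k)
    case 0
    show ?case
      using chord_has_derivative
      by (auto intro!: continuous_at_imp_continuous_on has_derivative_continuous)
  next
    case (Suc k)
    have DFk: "C_k_on k spacetime (\<lambda>z. frechet_derivative F (at (chord z)) v)" for v
      by (rule C_k_on_compose[OF open_time_strip open_chords sub _ Suc])
        (rule C_inf_onD(1)[OF C_inf_on_frechet_derivative[OF C_inf_F]])
    have "C_inf_on chords (\<lambda>z. inverse (FT z))"
      using FT_neg by (intro C_inf_on_inverse_comp C_inf_FT) force
    then have "C_k_on k spacetime (\<lambda>z. inverse (FT (chord z)))"
      using C_k_on_compose[OF open_time_strip open_chords sub _ Suc] C_inf_onD(1) by blast
    moreover have "C_k_on k spacetime (\<lambda>z. snd (snd v) - frechet_derivative F (at (chord z)) (fst v, fst (snd v), 0))" for v :: "real \<times> real \<times> real"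
      using C_k_on_add[OF open_time_strip C_k_on_const C_k_on_linear_comp[OF open_time_strip bounded_linear_minus[OF bounded_linear_ident] DFk], of "snd (snd v)"]
      by simp
    ultimately have "C_k_on k spacetime (\<lambda>z. dhit z v)" for v
      unfolding dhit_def by (intro C_k_on_bilinear[OF open_time_strip bounded_bilinear_mult])
    then have "C_k_on k spacetime (\<lambda>z. dchord z v)" for v
      unfolding dchord_def by (intro C_k_on_Pair open_time_strip C_k_on_const)
    then show ?case
      by (intro C_k_on_SucI[OF open_time_strip chord_has_derivative])
  qed
  then show ?thesis by (simp add: C_inf_on_def open_time_strip)
qed

end

section \<open>The billiard ball maps of a family of tables\<close>

text \<open>Reversal of the direction of motion. The type is left open so that it acts on the strip
  as well as on the annulus.\<close>

definition rev_momentum :: "'a \<times> real \<Rightarrow> 'a \<times> real" where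
  "rev_momentum x = (fst x, - snd x)"

lemma rev_momentum_in_strip [simp]: "rev_momentum y \<in> strip \<longleftrightarrow> y \<in> strip"
  by (cases y) (auto simp: rev_momentum_def strip_def)

lemma rev_momentum_in_annulus [simp]: "rev_momentum x \<in> annulus \<longleftrightarrow> x \<in> annulus"
  by (cases x) (auto simp: rev_momentum_def annulus_def)

lemma rev_momentum_in_closed_annulus [simp]: "rev_momentum x \<in> closed_annulus \<longleftrightarrow> x \<in> closed_annulus"
  by (cases x) (auto simp: rev_momentum_def closed_annulus_def)

lemma rev_momentum_rev_momentum [simp]: "rev_momentum (rev_momentum x) = x"
  by (simp add: rev_momentum_def)

lemma annulus_cover_rev_momentum: "annulus_cover (rev_momentum y) = rev_momentum (annulus_cover y)"
  by (cases y) (simp add: rev_momentum_def annulus_cover_def)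

context billiard_family
begin

text \<open>The lift of the billiard ball map that advances the parameter by an amount strictly
  between 0 and 1.\<close>

definition bounce :: "real \<times> real \<times> real \<Rightarrow> real \<times> real" where
  "bounce z = (hit z, P (chord z))"

lemma bounce_in_strip: "z \<in> spacetime \<Longrightarrow> bounce z \<in> strip"
  using P_bound[OF chord_in_chords[of z]] by (auto simp: bounce_def strip_def)

lemma shift_chords:
  "V (s, t + of_int k, T + of_int k) = V (s, t, T)" "F (s, t + of_int k, T + of_int k) = F (s, t, T)"
  "P (s, t + of_int k, T + of_int k) = P (s, t, T)" "K (s, t + of_int k, T + of_int k) = K (s, t, T)"
proof -
  show V: "V (s, t + of_int k, T + of_int k) = V (s, t, T)" by (simp add: V_def)
  show "F (s, t + of_int k, T + of_int k) = F (s, t, T)"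
    "P (s, t + of_int k, T + of_int k) = P (s, t, T)" "K (s, t + of_int k, T + of_int k) = K (s, t, T)"
    unfolding F_def P_def K_def u_def V by simp_all
qed

lemma hit_shift:
  assumes "(s, t, p) \<in> spacetime"
  shows "hit (s, t + of_int k, p) = hit (s, t, p) + of_int k"
  using hit_bounds_strict[OF assms] F_chord[OF assms]
  by (intro hit_eqI) (auto simp: chord_def shift_chords)

text \<open>In the convention of \<open>chords\<close> the way back from \<open>T\<close> ends at
  \<open>t + 1\<close>, which is the same boundary point as \<open>t\<close>. Reversing the chord
  exchanges the two cosines and changes their signs.\<close>

lemma reversed_chord:
  "u (s, T, t + 1) = - u (s, t, T)" "F (s, T, t + 1) = - P (s, t, T)" "P (s, T, t + 1) = - F (s, t, T)"
proof -
  have "V (s, T, t + 1) = - V (s, t, T)" by (simp add: V_def)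
  then show u: "u (s, T, t + 1) = - u (s, t, T)" by (simp add: u_def)
  show "F (s, T, t + 1) = - P (s, t, T)" "P (s, T, t + 1) = - F (s, t, T)"
    unfolding F_def P_def u by simp_all
qed

lemma bounce_reversed:
  assumes "y \<in> strip"
  shows "bounce (s, rev_momentum (bounce (s, y))) = rev_momentum y + (1, 0)"
proof -
  obtain t p where y: "y = (t, p)" by (cases y)
  let ?T = "hit (s, t, p)"
  have z: "(s, t, p) \<in> spacetime" using assms y by simp
  have "hit (s, ?T, - P (s, t, ?T)) = t + 1"
    using hit_bounds_strict[OF z] by (intro hit_eqI) (auto simp: reversed_chord)
  then show ?thesis
    using F_chord[OF z] by (simp add: y bounce_def rev_momentum_def chord_def reversed_chord)
qed

text \<open>Going there and back along one chord advances the lift by a full turn in total, see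
  \<open>bounce_reversed\<close>; subtracting \<open>(1, 0)\<close> corrects for it.\<close>

definition unbounce :: "real \<times> real \<times> real \<Rightarrow> real \<times> real" where
  "unbounce z = rev_momentum (bounce (fst z, rev_momentum (snd z))) - (1, 0)"

lemma bounce_shift:
  assumes "y \<in> strip"
  shows "bounce (s, y + (of_int k, 0)) = bounce (s, y) + (of_int k, 0)"
  using assms by (cases y) (simp add: bounce_def chord_def hit_shift shift_chords)

lemma unbounce_bounce: "y \<in> strip \<Longrightarrow> unbounce (s, bounce (s, y)) = y"
  by (simp add: unbounce_def bounce_reversed) (simp add: rev_momentum_def prod_eq_iff)

lemma bounce_unbounce:
  assumes "y \<in> strip"
  shows "bounce (s, unbounce (s, y)) = y"
proof -
  have r: "rev_momentum y \<in> strip" using assms by simp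
  then have *: "rev_momentum (bounce (s, rev_momentum y)) \<in> strip" using bounce_in_strip by simp
  have "bounce (s, rev_momentum (bounce (s, rev_momentum y)) + (of_int (- 1), 0)) = y + (1, 0) + (of_int (- 1), 0)"
    unfolding bounce_shift[OF *] bounce_reversed[OF r] by simp
  then show ?thesis by (simp add: unbounce_def minus_prod_def plus_prod_def)
qed

lemma unbounce_in_strip: "z \<in> spacetime \<Longrightarrow> unbounce z \<in> strip"
  using bounce_in_strip[of "(fst z, rev_momentum (snd z))"]
  by (cases "bounce (fst z, rev_momentum (snd z))")
    (auto simp: unbounce_def rev_momentum_def strip_def)

lemma billiard_map_cover:
  assumes "y \<in> strip"
  shows "billiard_map (G s) (annulus_cover y) = annulus_cover (bounce (s, y))"
proof -
  obtain t p where y: "y = (t, p)" by (cases y)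
  have z: "(s, t, p) \<in> spacetime" using assms y by simp
  have dir: "chord_dir (G s) (circ t) (circ T) = u (s, t, T)" for T
    by (simp add: chord_dir_def u_def V_def c_def)
  let ?T = "hit (s, t, p)"
  have "(THE (Q, P'). Q \<noteq> circ t \<and> p = chord_dir (G s) (circ t) Q \<bullet> circle_deriv (G s) (circ t) \<and>
      P' = chord_dir (G s) (circ t) Q \<bullet> circle_deriv (G s) Q) = (circ ?T, P (s, t, ?T))"
  proof (rule the_equality, goal_cases)
    case 1
    show ?case
      using hit_bounds_strict[OF z] F_chord[OF z] circ_neq[of t ?T]
      by (auto simp: dir circle_deriv_G chord_def F_def P_def)
  next
    case (2 QP)
    obtain Q P' where QP: "QP = (Q, P')" by (cases QP)
    \<comment> \<open>The representative of \<open>Q\<close> in the half-open interval from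
      \<open>t\<close> to \<open>t + 1\<close>; its left end is excluded because \<open>Q\<close>
      differs from the starting point.\<close>
    define T where "T = t + frac (rep_circle Q - t)"
    have T: "circ T = Q"
    proof -
      have "rep_circle Q = T + of_int \<lfloor>rep_circle Q - t\<rfloor>" by (simp add: T_def frac_def)
      then show ?thesis by (metis circ_add_int circ_rep_circle)
    qed
    have "T \<noteq> t" using T 2 QP by auto
    then have "t < T" "T < t + 1"
      using frac_ge_0[of "rep_circle Q - t"] frac_lt_1[of "rep_circle Q - t"]
      by (auto simp: T_def less_le)
    moreover have "F (s, t, T) = p" "P' = P (s, t, T)"
      using 2 by (auto simp: QP T[symmetric] dir circle_deriv_G F_def P_def)
    ultimately have "?T = T" by (intro hit_eqI)
    then show ?case using T QP \<open>P' = P (s, t, T)\<close> by simp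
  qed
  then show ?thesis
    by (simp add: billiard_map_def annulus_cover_def y bounce_def chord_def)
qed

section \<open>Smoothness of the lift and the two-form identity\<close>

lemma C_inf_bounce: "C_inf_on spacetime bounce"
proof -
  have "C_inf_on spacetime (\<lambda>z. P (chord z))"
    by (rule C_inf_on_compose[OF C_inf_P C_inf_chord]) (use chord_in_chords in blast)
  moreover have "C_inf_on spacetime (\<lambda>z. snd (snd (chord z)))"
    by (intro C_inf_intros C_inf_chord)
  ultimately show ?thesis
    unfolding bounce_def[abs_def] using C_inf_on_Pair by (simp add: chord_def)
qed

lemma C_inf_unbounce: "C_inf_on spacetime unbounce"
proof -
  have 1: "C_inf_on spacetime (\<lambda>z. (fst z, rev_momentum (snd z)))"
    unfolding rev_momentum_def by (intro C_inf_intros open_time_strip)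
  have "C_inf_on spacetime (\<lambda>z. bounce (fst z, rev_momentum (snd z)))"
    by (rule C_inf_on_compose[OF C_inf_bounce 1]) auto
  then show ?thesis
    unfolding unbounce_def[abs_def] rev_momentum_def[of "bounce _"]
    by (intro C_inf_intros open_time_strip)
qed

text \<open>Closedness of the differential of \<open>L\<close> reads dK ds - dF dt + dP dT = 0, with
  wedge products understood. Along \<open>chord\<close> the function \<open>F\<close> becomes the
  coordinate p and T becomes \<open>hit\<close>, so dP dT is the pullback of \<open>omega\<close>,
  and it differs from dp dt by the term in K.\<close>

lemma bounce_two_form:
  fixes s a b :: real and y v w :: "real \<times> real"
  assumes "y \<in> strip"
  defines "D \<equiv> frechet_derivative bounce (at (s, y))"
    and "DK \<equiv> frechet_derivative (\<lambda>z. - K (chord z)) (at (s, y))"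
  shows "omega (D (a, v)) (D (b, w)) = omega v w - a * DK (b, w) + b * DK (a, v)"
proof -
  have z: "(s, y) \<in> spacetime" using assms by simp
  note ch = chord_has_derivative[OF z] and mem = chord_in_chords[OF z]
  let ?D = "\<lambda>f. frechet_derivative f (at (chord (s, y)))"
  have comp: "((\<lambda>z. f (chord z)) has_derivative (\<lambda>x. ?D f (dchord (s, y) x))) (at (s, y))"
    if "C_inf_on chords f" for f :: "real \<times> real \<times> real \<Rightarrow> real"
    using has_derivative_compose[OF ch C_inf_on_has_derivative[OF that mem]] .
  have "((\<lambda>z. (snd (snd (chord z)), P (chord z))) has_derivative
      (\<lambda>x. (snd (snd (dchord (s, y) x)), ?D P (dchord (s, y) x)))) (at (s, y))"
    by (intro derivative_intros ch comp C_inf_P)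
  then have "(bounce has_derivative (\<lambda>x. (dhit (s, y) x, ?D P (dchord (s, y) x)))) (at (s, y))"
    by (simp add: bounce_def[abs_def] chord_def dchord_def)
  then have D: "D = (\<lambda>x. (dhit (s, y) x, ?D P (dchord (s, y) x)))"
    unfolding D_def by (rule frechet_derivative_at[symmetric])
  have "((\<lambda>z. - K (chord z)) has_derivative (\<lambda>x. - ?D K (dchord (s, y) x))) (at (s, y))"
    by (intro derivative_intros comp C_inf_K)
  then have DK: "DK = (\<lambda>x. - ?D K (dchord (s, y) x))"
    unfolding DK_def by (rule frechet_derivative_at[symmetric])
  have DF: "?D F (dchord (s, y) x) = snd (snd x)" for x
  proof -
    have "((\<lambda>z. F (chord z)) has_derivative (\<lambda>x. snd (snd x))) (at (s, y))"
      by (rule has_derivative_transform_within_open[OF _ open_time_strip z, of "\<lambda>z. snd (snd z)"])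
        (auto intro!: derivative_eq_intros simp: F_chord)
    from has_derivative_unique[OF comp[OF C_inf_F] this] show ?thesis by (rule fun_cong)
  qed
  from dL_closed[OF mem, of "dchord (s, y) (a, v)" "dchord (s, y) (b, w)"]
  have "a * ?D K (dchord (s, y) (b, w)) - fst v * snd w + dhit (s, y) (a, v) * ?D P (dchord (s, y) (b, w)) =
    b * ?D K (dchord (s, y) (a, v)) - fst w * snd v + dhit (s, y) (b, w) * ?D P (dchord (s, y) (a, v))"
    unfolding DF by (simp add: dchord_def)
  then show ?thesis unfolding D DK omega_def by (simp add: algebra_simps)
qed

text \<open>Off \<open>spacetime\<close> the bound vanishes, since \<open>hit\<close> then returns to the starting point
  on the circle.\<close>

lemma isCont_chord_comparison:
  fixes e :: "real \<times> real \<Rightarrow> 'b::real_normed_vector"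
  assumes e: "continuous_on UNIV e" "\<And>s t. e (s, t + 1) = e (s, t)"
    and b: "continuous_on UNIV b"
    and f: "\<And>z. z \<in> spacetime \<Longrightarrow> isCont f z"
      "\<And>z. \<bar>f z - b z\<bar> \<le> norm (e (fst z, hit z) - e (fst z, fst (snd z)))"
  shows "isCont f z"
proof (cases "z \<in> spacetime")
  case False
  let ?r = "\<lambda>z. norm (e (fst z, hit z) - e (fst z, fst (snd z)))"
  have ec: "isCont e x" for x
    using e(1) unfolding continuous_on_eq_continuous_at[OF open_UNIV] by blast
  have r0: "?r z = 0" using hit_outside[OF False] e(2) by auto
  have "((\<lambda>z. e (fst z, hit z) - e (fst z, fst (snd z))) \<longlongrightarrow> e (fst z, hit z) - e (fst z, fst (snd z))) (at z)"
    using hit_isCont[of z] unfolding isCont_def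
    by (intro tendsto_intros isCont_tendsto_compose[OF ec])
  from tendsto_norm[OF this] have "(?r \<longlongrightarrow> 0) (at z)" unfolding r0 .
  then have "((\<lambda>z. f z - b z) \<longlongrightarrow> 0) (at z)"
    by (rule Lim_null_comparison[rotated]) (simp add: f(2))
  moreover have "(b \<longlongrightarrow> b z) (at z)"
    using b unfolding continuous_on_eq_continuous_at[OF open_UNIV] isCont_def by blast
  ultimately have "((\<lambda>z. f z - b z + b z) \<longlongrightarrow> 0 + b z) (at z)" by (rule tendsto_add)
  moreover have "f z = b z" using f(2)[of z] r0 by simp
  ultimately show ?thesis by (simp add: isCont_def)
qed (rule f(1))

lemma isCont_comp_chord:
  assumes "C_inf_on chords f" "z \<in> spacetime"
  shows "isCont (\<lambda>z. f (chord z)) z"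
proof -
  have "isCont f (chord z)"
    using C_inf_on_imp_continuous_on[OF assms(1)] open_chords chord_in_chords[OF assms(2)]
    by (simp add: continuous_on_eq_continuous_at)
  with has_derivative_continuous[OF chord_has_derivative[OF assms(2)]] show ?thesis
    by (rule isCont_o2)
qed

lemma isCont_on_spacetime:
  assumes "\<And>z. z \<in> spacetime \<Longrightarrow> f z = g z" "z \<in> spacetime" "isCont g z"
  shows "isCont f z"
proof -
  have "\<forall>\<^sub>F x in nhds z. f x = g x"
    using eventually_nhds_in_open[OF open_time_strip assms(2)] by (rule eventually_mono) (rule assms(1))
  from isCont_cong[OF this] show ?thesis using assms(3) by simp
qed

section \<open>Continuity up to the boundary circles\<close>

definition P_ext where "P_ext z = (if z \<in> spacetime then P (chord z) else snd (snd z))"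
definition K_ext where "K_ext z = (if z \<in> spacetime then - K (chord z) else 0)"

text \<open>Both momenta pair the same unit vector with the tangents at the two ends of the chord,
  so they differ by at most the distance of these tangents. For \<open>K_ext\<close> the velocities
  of the homotopy take the place of the tangents.\<close>

lemma P_ext_isCont: "isCont P_ext z"
proof (rule isCont_chord_comparison[where e = ct and b = "\<lambda>z. snd (snd z)"])
  show "isCont P_ext z" if "z \<in> spacetime" for z
    by (rule isCont_on_spacetime[OF _ that isCont_comp_chord[OF C_inf_P that]]) (simp add: P_ext_def)
  show "\<bar>P_ext z - snd (snd z)\<bar> \<le> norm (ct (fst z, hit z) - ct (fst z, fst (snd z)))" for z
  proof (cases "z \<in> spacetime")
    case True
    have "P_ext z - snd (snd z) = P (chord z) - F (chord z)" using F_chord[OF True] True by (simp add: P_ext_def)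
    also have "\<dots> = u (chord z) \<bullet> (ct (fst z, hit z) - ct (fst z, fst (snd z)))"
      by (simp add: P_def F_def chord_def inner_diff_right)
    finally show ?thesis
      using Cauchy_Schwarz_ineq2[of "u (chord z)"] norm_u[OF chord_in_chords[OF True]] by simp
  qed (simp add: P_ext_def)
qed (auto intro!: continuous_intros C_inf_on_imp_continuous_on[OF C_inf_ct])

lemma K_ext_isCont: "isCont K_ext z"
proof (rule isCont_chord_comparison[where e = cs and b = "\<lambda>_. 0"])
  show "isCont K_ext z" if "z \<in> spacetime" for z
    by (rule isCont_on_spacetime[OF _ that isCont_minus[OF isCont_comp_chord[OF C_inf_K that]]]) (simp add: K_ext_def)
  show "\<bar>K_ext z - 0\<bar> \<le> norm (cs (fst z, hit z) - cs (fst z, fst (snd z)))" for z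
  proof (cases "z \<in> spacetime")
    case True
    then have "\<bar>K_ext z - 0\<bar> = \<bar>u (chord z) \<bullet> (cs (fst z, hit z) - cs (fst z, fst (snd z)))\<bar>"
      by (simp add: K_ext_def K_def chord_def)
    then show ?thesis
      using Cauchy_Schwarz_ineq2[of "u (chord z)"] norm_u[OF chord_in_chords[OF True]] by simp
  qed (simp add: K_ext_def)
qed (auto intro!: continuous_intros C_inf_on_imp_continuous_on[OF C_inf_cs])

lemma continuous_on_annulus_cover: "continuous_on A annulus_cover"
  unfolding annulus_cover_def case_prod_unfold
  by (intro continuous_intros continuous_on_compose2[OF continuous_on_circ[of UNIV]]) auto

definition \<eta> :: "real \<Rightarrow> phase \<Rightarrow> real" where
  "\<eta> s x = - K (chord (s, lift x))"

text \<open>Shifting both ends of a chord by the same integer changes nothing, so the representative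
  chosen by \<open>lift\<close> does not matter.\<close>

lemma eta_cover:
  assumes "y \<in> strip"
  shows "\<eta> s (annulus_cover y) = - K (chord (s, y))"
proof -
  obtain k :: int where "lift (annulus_cover y) = y + (of_int k, 0)"
    using annulus_cover_eq_iff annulus_cover_lift by metis
  then show ?thesis
    using assms by (cases y) (simp add: \<eta>_def chord_def hit_shift shift_chords)
qed

lemma continuous_extension_billiard_map:
  "continuous_on (S \<times> closed_annulus) (extension (\<lambda>s. billiard_map (G s)) id)"
proof (rule continuous_on_closed_annulus_descend)
  have "continuous_on UNIV hit" "continuous_on UNIV P_ext"
    using hit_isCont P_ext_isCont by (auto intro: continuous_at_imp_continuous_on)
  then have "continuous_on UNIV (\<lambda>z. annulus_cover (hit z, P_ext z))"
    by (intro continuous_on_compose2[OF continuous_on_annulus_cover[of UNIV]] continuous_intros) auto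
  then have "continuous_on (S \<times> (UNIV \<times> {-1..1})) (\<lambda>z. annulus_cover (hit z, P_ext z))"
    by (rule continuous_on_subset) simp
  moreover have "annulus_cover (hit z, P_ext z) =
      (\<lambda>(s, y). extension (\<lambda>s. billiard_map (G s)) id (s, annulus_cover y)) z"
    if "z \<in> S \<times> (UNIV \<times> {-1..1})" for z
  proof (cases "z \<in> spacetime")
    case True
    then show ?thesis
      by (cases z) (auto simp: extension_def billiard_map_cover bounce_def P_ext_def)
  next
    case False
    moreover obtain s t p where zz: "z = (s, t, p)" by (cases z)
    ultimately have "(t, p) \<notin> strip" "P_ext z = p" by (auto simp: P_ext_def)
    \<comment> \<open>At p = -1 the lift moves by a full turn and at p = 1 not at all; on the circle
      both are the identity.\<close>
    moreover have "circ (hit z) = circ t"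
      using hit_outside[OF False] circ_add_int[of t 1] by (auto simp: zz)
    ultimately have "annulus_cover (hit z, P_ext z) = annulus_cover (t, p)"
      by (simp add: annulus_cover_def)
    then show ?thesis using \<open>(t, p) \<notin> strip\<close> by (simp add: zz extension_def)
  qed
  ultimately show "continuous_on (S \<times> (UNIV \<times> {-1..1}))
      (\<lambda>(s, y). extension (\<lambda>s. billiard_map (G s)) id (s, annulus_cover y))"
    using continuous_on_cong by fastforce
qed

lemma continuous_extension_eta:
  "continuous_on (S \<times> closed_annulus) (extension \<eta> (\<lambda>_. 0))"
proof (rule continuous_on_closed_annulus_descend)
  have "continuous_on (S \<times> (UNIV \<times> {-1..1})) K_ext"
    using K_ext_isCont by (auto intro: continuous_at_imp_continuous_on)
  moreover have "K_ext = (\<lambda>(s, y). extension \<eta> (\<lambda>_. 0) (s, annulus_cover y))"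
    by (auto simp: K_ext_def extension_def eta_cover)
  ultimately show "continuous_on (S \<times> (UNIV \<times> {-1..1})) (\<lambda>(s, y). extension \<eta> (\<lambda>_. 0) (s, annulus_cover y))"
    by (simp only:)
qed

lemma ham_isotopy_billiard:
  "ham_isotopy (\<lambda>s. billiard_map (G s)) (\<lambda>s x. rev_momentum (billiard_map (G s) (rev_momentum x)))
    bounce unbounce \<eta>"
proof
  have eq: "(\<lambda>z. - K (chord z)) z = (\<lambda>(s, y). \<eta> s (annulus_cover y)) z" if "z \<in> spacetime" for z
    using that by (auto simp: eta_cover)
  have "C_inf_on spacetime (\<lambda>z. - K (chord z))"
    by (intro C_inf_intros C_inf_on_compose[OF C_inf_K C_inf_chord]) (use chord_in_chords in blast)
  then show "C_inf_on spacetime (\<lambda>(s, y). \<eta> s (annulus_cover y))"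
    by (rule C_inf_on_cong) (rule eq)
  show "continuous_on ({0..1} \<times> closed_annulus) (extension (\<lambda>s. billiard_map (G s)) id)"
    "continuous_on ({0..1} \<times> closed_annulus) (extension \<eta> (\<lambda>_. 0))"
    by (rule continuous_extension_billiard_map continuous_extension_eta)+
  have "continuous_on ({0..1} \<times> closed_annulus)
      (\<lambda>z. rev_momentum (extension (\<lambda>s. billiard_map (G s)) id (fst z, rev_momentum (snd z))))"
    unfolding rev_momentum_def
    by (intro continuous_intros continuous_on_compose2[OF continuous_extension_billiard_map[of "{0..1}"]])
      (auto simp: closed_annulus_def)
  moreover have "(\<lambda>z. rev_momentum (extension (\<lambda>s. billiard_map (G s)) id (fst z, rev_momentum (snd z)))) =
      extension (\<lambda>s x. rev_momentum (billiard_map (G s) (rev_momentum x))) id"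
    by (auto simp: extension_def)
  ultimately show "continuous_on ({0..1} \<times> closed_annulus)
      (extension (\<lambda>s x. rev_momentum (billiard_map (G s) (rev_momentum x))) id)"
    by (simp only:)
  fix s a b :: real and y v w :: "real \<times> real" and k :: int
  assume y: "y \<in> strip"
  have "frechet_derivative (\<lambda>z. - K (chord z)) (at (s, y)) =
      frechet_derivative (\<lambda>(s, y). \<eta> s (annulus_cover y)) (at (s, y))"
    using y by (intro frechet_derivative_cong_open[OF open_time_strip] eq) auto
  then show "omega (frechet_derivative bounce (at (s, y)) (a, v)) (frechet_derivative bounce (at (s, y)) (b, w)) =
      omega v w - a * frechet_derivative (\<lambda>(s, y). \<eta> s (annulus_cover y)) (at (s, y)) (b, w)
        + b * frechet_derivative (\<lambda>(s, y). \<eta> s (annulus_cover y)) (at (s, y)) (a, v)"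
    using bounce_two_form[OF y, of s a v b w] by (simp only:)
  show "annulus_cover (bounce (s, y)) = billiard_map (G s) (annulus_cover y)"
    using billiard_map_cover[OF y] by simp
  \<comment> \<open>The full turn subtracted in \<open>unbounce\<close> is invisible on the
    annulus.\<close>
  have "annulus_cover (unbounce (s, y)) = annulus_cover (rev_momentum (bounce (s, rev_momentum y)) + (of_int (- 1), 0))"
    by (simp add: unbounce_def minus_prod_def plus_prod_def)
  also have "\<dots> = rev_momentum (billiard_map (G s) (rev_momentum (annulus_cover y)))"
    unfolding annulus_cover_shift annulus_cover_rev_momentum
    using billiard_map_cover[of "rev_momentum y" s] y by (simp add: annulus_cover_rev_momentum)
  finally show "annulus_cover (unbounce (s, y)) = rev_momentum (billiard_map (G s) (rev_momentum (annulus_cover y)))" .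
qed (auto simp: C_inf_bounce C_inf_unbounce bounce_in_strip unbounce_in_strip unbounce_bounce
    bounce_unbounce bounce_shift)

lemma eta_bound:
  assumes "x \<in> annulus" "\<And>t. norm (cs (s, t)) \<le> B"
  shows "\<bar>\<eta> s x\<bar> \<le> 2 * B"
proof -
  let ?z = "(s, lift x)"
  have z: "?z \<in> spacetime" using assms by simp
  have "\<bar>\<eta> s x\<bar> = \<bar>u (chord ?z) \<bullet> (cs (s, hit ?z) - cs (s, fst (lift x)))\<bar>"
    by (simp add: \<eta>_def K_def chord_def)
  also have "\<dots> \<le> norm (cs (s, hit ?z) - cs (s, fst (lift x)))"
    using Cauchy_Schwarz_ineq2[of "u (chord ?z)"] norm_u[OF chord_in_chords[OF z]] by simp
  also have "\<dots> \<le> 2 * B"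
    using norm_triangle_ineq4[of "cs (s, hit ?z)" "cs (s, fst (lift x))"]
      assms(2)[of "hit ?z"] assms(2)[of "fst (lift x)"] by simp
  finally show ?thesis .
qed

end

section \<open>Homotopies of tables\<close>

text \<open>By uniform continuity on the compact product, moving \<open>x\<close> slightly changes
  all the functions under the supremum by less than \<open>e/2\<close> at once, and so the supremum
  by at most \<open>e/2\<close>.\<close>

lemma continuous_on_SUP_compact:
  fixes f :: "'a::metric_space \<times> 'b::metric_space \<Rightarrow> real"
  assumes "continuous_on (A \<times> C) f" "compact A" "compact C" "C \<noteq> {}"
  shows "continuous_on A (\<lambda>x. SUP y\<in>C. f (x, y))"
proof -
  have cont: "continuous_on C (\<lambda>y. f (x, y))" if "x \<in> A" for x
    using that by (intro continuous_on_compose2[OF assms(1)] continuous_intros) auto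
  have bdd: "bdd_above ((\<lambda>y. f (x, y)) ` C)" if "x \<in> A" for x
    using compact_continuous_image[OF cont[OF that] assms(3)]
    by (intro bounded_imp_bdd_above compact_imp_bounded)
  have unif: "uniformly_continuous_on (A \<times> C) f"
    using assms(1-3) by (intro compact_uniformly_continuous compact_Times)
  show ?thesis
    unfolding continuous_on_iff
  proof (intro ballI allI impI)
    fix x and e :: real assume "x \<in> A" "e > 0"
    obtain d where d: "d > 0" "\<And>z z'. z \<in> A \<times> C \<Longrightarrow> z' \<in> A \<times> C \<Longrightarrow> dist z' z < d \<Longrightarrow> dist (f z') (f z) < e/2"
      using unif \<open>e > 0\<close> unfolding uniformly_continuous_on_def by (meson half_gt_zero)
    have le: "(SUP y\<in>C. f (x, y)) \<le> (SUP y\<in>C. f (x', y)) + e/2" if "x \<in> A" "x' \<in> A" "dist x x' < d" for x x'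
    proof (rule cSUP_least[OF assms(4)])
      fix y assume "y \<in> C"
      then have "dist (f (x, y)) (f (x', y)) < e/2"
        using that by (intro d(2)) (auto simp: dist_Pair_Pair)
      moreover have "f (x', y) \<le> (SUP y\<in>C. f (x', y))"
        using \<open>y \<in> C\<close> by (rule cSUP_upper[OF _ bdd[OF that(2)]])
      ultimately show "f (x, y) \<le> (SUP y\<in>C. f (x', y)) + e/2"
        unfolding dist_real_def by linarith
    qed
    show "\<exists>d>0. \<forall>x'\<in>A. dist x' x < d \<longrightarrow> dist (SUP y\<in>C. f (x', y)) (SUP y\<in>C. f (x, y)) < e"
    proof (intro exI[of _ d] conjI ballI impI d(1))
      fix x' assume "x' \<in> A" "dist x' x < d"
      then show "dist (SUP y\<in>C. f (x', y)) (SUP y\<in>C. f (x, y)) < e"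
        using le[of x x'] le[of x' x] \<open>x \<in> A\<close> \<open>e > 0\<close> by (simp add: dist_real_def abs_less_iff dist_commute)
    qed
  qed
qed

lemma circ_surj_unit: obtains t where "t \<in> {0..1}" "q = circ t"
proof
  have "rep_circle q = frac (rep_circle q) + of_int \<lfloor>rep_circle q\<rfloor>" by (simp add: frac_def)
  then show "q = circ (frac (rep_circle q))" by (metis circ_add_int circ_rep_circle)
  show "frac (rep_circle q) \<in> {0..1}" using frac_lt_1[of "rep_circle q"] by simp
qed

text \<open>Precomposition with \<open>\<sigma>\<close> extends a homotopy smoothly to all times.\<close>

definition \<sigma> :: "real \<Rightarrow> real" where
  "\<sigma> s = (1 - cos (pi * s)) / 2"

definition \<sigma>' :: "real \<Rightarrow> real" where
  "\<sigma>' s = pi * sin (pi * s) / 2"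

lemma sigma_range: "\<sigma> s \<in> {0..1}"
  using cos_le_one[of "pi * s"] cos_ge_minus_one[of "pi * s"] by (simp add: \<sigma>_def)

lemma sigma_0 [simp]: "\<sigma> 0 = 0" and sigma_1 [simp]: "\<sigma> 1 = 1"
  by (simp_all add: \<sigma>_def)

lemma sigma_deriv: "(\<sigma> has_real_derivative \<sigma>' s) (at s within A)"
  unfolding \<sigma>_def[abs_def] \<sigma>'_def by (auto intro!: derivative_eq_intros)

lemma sigma'_nonneg: "s \<in> {0..1} \<Longrightarrow> \<sigma>' s \<ge> 0"
  unfolding \<sigma>'_def by (auto intro!: divide_nonneg_nonneg mult_nonneg_nonneg sin_ge_zero simp: mult_left_le)

lemma C_inf_sigma: "C_inf_on UNIV \<sigma>"
proof -
  have "C_inf_on UNIV (\<lambda>s. (1 - cos (pi * s)) * (1 / 2))"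
    by (intro C_inf_intros C_inf_on_compose[OF C_inf_on_cos]) auto
  then show ?thesis by (simp add: \<sigma>_def[abs_def])
qed

section \<open>Speed of a homotopy and its reparametrization\<close>

locale homotopy =
  fixes \<alpha> \<beta> :: "circle \<Rightarrow> real^2" and \<Gamma> :: "real \<Rightarrow> circle \<Rightarrow> real^2"
  assumes homotopy: "table_homotopy \<alpha> \<beta> \<Gamma>"
begin

definition velocity :: "real \<Rightarrow> circle \<Rightarrow> real^2" where
  "velocity s q = vector_derivative (\<lambda>r. \<Gamma> r q) (at s within {0..1})"

definition speed :: "real \<Rightarrow> real" where
  "speed s = (SUP q. norm (velocity s q))"

lemma extend:
  assumes "s \<in> {0..1}"
  obtains U g where "open U" "(s, t) \<in> U" "C_inf_on U g"
    "\<And>r x. r \<in> {0..1} \<Longrightarrow> (r, x) \<in> U \<Longrightarrow> \<Gamma> r (circ x) = g (r, x)"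
proof -
  have "smooth_on ({0..1} \<times> UNIV) (\<lambda>(s, t). \<Gamma> s (circ t))"
    using homotopy by (simp add: table_homotopy_def)
  moreover have "(s, t) \<in> {0..1} \<times> UNIV" using assms by simp
  ultimately obtain U g where U: "open U" "(s, t) \<in> U" "\<forall>k. C_k_on k U g"
    and eq: "\<forall>y\<in>({0..1} \<times> UNIV) \<inter> U. (\<lambda>(s, t). \<Gamma> s (circ t)) y = g y"
    unfolding smooth_on_def by meson
  have "\<Gamma> r (circ x) = g (r, x)" if "r \<in> {0..1}" "(r, x) \<in> U" for r x
    using bspec[OF eq, of "(r, x)"] that by simp
  then show thesis using U by (intro that[of U g]) (auto simp: C_inf_on_def)
qed

text \<open>The derivative within [0,1], one-sided at the end times, agrees with that of every local
  smooth extension. This gives existence and joint continuity of the velocity up to the end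
  times.\<close>

lemma velocity_local:
  assumes "open U" "C_inf_on U g" "\<And>r x. r \<in> {0..1} \<Longrightarrow> (r, x) \<in> U \<Longrightarrow> \<Gamma> r (circ x) = g (r, x)"
    and s: "s \<in> {0..1}" "(s, t) \<in> U"
  shows "((\<lambda>r. \<Gamma> r (circ t)) has_vector_derivative frechet_derivative g (at (s, t)) (1, 0)) (at s within {0..1})"
    and "velocity s (circ t) = frechet_derivative g (at (s, t)) (1, 0)"
proof -
  let ?D = "frechet_derivative g (at (s, t))"
  have D: "(g has_derivative ?D) (at (s, t))"
    using C_inf_on_has_derivative[OF assms(2) s(2)] .
  have "((\<lambda>r. (r, t)) has_derivative (\<lambda>r. (r, 0))) (at s within {0..1})"
    by (auto intro!: derivative_eq_intros)
  from has_derivative_compose[OF this D]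
  have "((\<lambda>r. g (r, t)) has_derivative (\<lambda>r. ?D (r, 0))) (at s within {0..1})" .
  moreover have "?D (r, 0) = r *\<^sub>R ?D (1, 0)" for r
    using linear_scale[OF has_derivative_linear[OF D], of r "(1, 0)"] by simp
  then have "(\<lambda>r. ?D (r, 0)) = (\<lambda>r. r *\<^sub>R ?D (1, 0))" by (rule ext)
  ultimately have g: "((\<lambda>r. g (r, t)) has_vector_derivative ?D (1, 0)) (at s within {0..1})"
    by (simp only: has_vector_derivative_def)
  have "open ((\<lambda>r. (r, t)) -` U)"
    by (intro open_vimage assms(1) continuous_intros)
  then obtain d where d: "d > 0" "\<And>r. dist r s < d \<Longrightarrow> (r, t) \<in> U"
    using s(2) unfolding open_dist by (metis vimage_eq)
  show \<Gamma>: "((\<lambda>r. \<Gamma> r (circ t)) has_vector_derivative ?D (1, 0)) (at s within {0..1})"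
    by (rule has_vector_derivative_transform_within[OF g d(1) s(1)]) (use d(2) assms(3) in auto)
  show "velocity s (circ t) = ?D (1, 0)"
    unfolding velocity_def
    using vector_derivative_within_cbox[of 0 1 s "\<lambda>r. \<Gamma> r (circ t)" "?D (1, 0)"] s(1) \<Gamma> by simp
qed

lemma velocity:
  assumes "s \<in> {0..1}"
  shows "((\<lambda>r. \<Gamma> r (circ t)) has_vector_derivative velocity s (circ t)) (at s within {0..1})"
proof -
  obtain U g where "open U" "(s, t) \<in> U" "C_inf_on U g"
    "\<And>r x. r \<in> {0..1} \<Longrightarrow> (r, x) \<in> U \<Longrightarrow> \<Gamma> r (circ x) = g (r, x)"
    using extend[OF assms] by blast
  then show ?thesis using velocity_local[of U g s t] assms by simp
qed

lemma continuous_velocity: "continuous_on ({0..1} \<times> UNIV) (\<lambda>(s, t). velocity s (circ t))"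
proof (rule continuous_on_eq_continuous_within[THEN iffD2], rule ballI)
  fix z :: "real \<times> real" assume z: "z \<in> {0..1} \<times> UNIV"
  obtain s t where st: "z = (s, t)" "s \<in> {0..1}" using z by auto
  obtain U g where U: "open U" "(s, t) \<in> U" "C_inf_on U g"
    "\<And>r x. r \<in> {0..1} \<Longrightarrow> (r, x) \<in> U \<Longrightarrow> \<Gamma> r (circ x) = g (r, x)"
    using extend[OF st(2)] by blast
  let ?f = "\<lambda>z. frechet_derivative g (at z) (1, 0)"
  have eq: "velocity r (circ x) = ?f (r, x)" if "r \<in> {0..1}" "(r, x) \<in> U" for r x
    using velocity_local(2)[OF U(1,3,4) that] by simp
  have "continuous_on U ?f" by (intro C_inf_on_imp_continuous_on C_inf_intros U(3))
  then have "isCont ?f z" using U(1,2) st by (simp add: continuous_on_eq_continuous_at)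
  then have "(?f \<longlongrightarrow> ?f z) (at z within {0..1} \<times> UNIV)"
    unfolding isCont_def by (rule tendsto_within_subset) simp
  moreover have "\<forall>\<^sub>F x in at z within {0..1} \<times> UNIV. ?f x = (\<lambda>(s, t). velocity s (circ t)) x"
    unfolding eventually_at_topological
    by (rule exI[of _ U]) (use U(1,2) st eq in auto)
  ultimately have "((\<lambda>(s, t). velocity s (circ t)) \<longlongrightarrow> ?f z) (at z within {0..1} \<times> UNIV)"
    by (rule Lim_transform_eventually)
  then show "continuous (at z within {0..1} \<times> UNIV) (\<lambda>(s, t). velocity s (circ t))"
    unfolding continuous_within using eq[OF st(2) U(2)] st(1) by simp
qed

lemma continuous_norm_velocity: "continuous_on ({0..1} \<times> {0..1}) (\<lambda>z. norm (velocity (fst z) (circ (snd z))))"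
  using continuous_on_subset[OF continuous_velocity, of "{0..1} \<times> {0..1}"]
  by (intro continuous_on_norm) (auto simp: case_prod_unfold)

text \<open>Replaces the circle, which carries only a topology here, by a compact interval to which
  \<open>continuous_on_SUP_compact\<close> applies.\<close>

lemma range_velocity: "range (\<lambda>q. norm (velocity s q)) = (\<lambda>t. norm (velocity s (circ t))) ` {0..1}"
proof (intro equalityI subsetI)
  fix x assume "x \<in> range (\<lambda>q. norm (velocity s q))"
  then obtain q where "x = norm (velocity s q)" by auto
  moreover obtain t where "t \<in> {0..1}" "q = circ t" by (rule circ_surj_unit)
  ultimately show "x \<in> (\<lambda>t. norm (velocity s (circ t))) ` {0..1}" by auto
qed auto

lemma continuous_speed: "continuous_on {0..1} speed"
  using continuous_on_SUP_compact[OF continuous_norm_velocity]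
  by (simp add: speed_def[abs_def] range_velocity)

lemma velocity_le_speed:
  assumes "s \<in> {0..1}"
  shows "norm (velocity s q) \<le> speed s"
proof -
  have "continuous_on {0..1} (\<lambda>t. norm (velocity s (circ t)))"
  proof -
    have "continuous_on {0..1} (\<lambda>t. (s, t))" by (intro continuous_intros)
    from continuous_on_compose2[OF continuous_norm_velocity this] show ?thesis using assms by (simp add: image_subset_iff)
  qed
  then have "bdd_above (range (\<lambda>q. norm (velocity s q)))"
    unfolding range_velocity
    by (intro bounded_imp_bdd_above compact_imp_bounded compact_continuous_image) auto
  then show ?thesis unfolding speed_def by (intro cSUP_upper) auto
qed

text \<open>Integration by substitution: the reparametrized homotopy has the same length, as
  \<open>\<sigma>\<close> runs from 0 to 1.\<close>

lemma homotopy_length: "((\<lambda>s. \<sigma>' s * speed (\<sigma> s)) has_integral homotopy_length \<Gamma>) {0..1}"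
proof -
  have "((\<lambda>s. \<sigma>' s *\<^sub>R speed (\<sigma> s)) has_integral integral {\<sigma> 0..\<sigma> 1} speed) {0..1}"
    by (rule has_integral_substitution[OF _ _ _ continuous_speed sigma_deriv]) (use sigma_range in auto)
  moreover have "integral {0..1} speed = homotopy_length \<Gamma>"
    by (simp add: homotopy_length_def speed_def[abs_def] velocity_def)
  ultimately show ?thesis by simp
qed

text \<open>A local extension \<open>g\<close> of the homotopy is evaluated only at times
  \<open>\<sigma> s\<close>, which lie in [0,1], where it agrees with \<open>\<Gamma>\<close>. Hence
  the composite is smooth also around times at which \<open>\<sigma>\<close> reaches 0 or 1.\<close>

sublocale billiard_family "\<lambda>s. \<Gamma> (\<sigma> s)"
proof
  show "\<Gamma> (\<sigma> s) \<in> billiard_tables" for s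
    using homotopy sigma_range[of s] by (simp add: table_homotopy_def)
  show "C_inf_on UNIV (\<lambda>(s, t). \<Gamma> (\<sigma> s) (circ t))"
  proof (rule C_inf_on_local[OF open_UNIV])
    fix z :: "real \<times> real"
    obtain s t where z: "z = (s, t)" by (cases z)
    obtain U g where U: "open U" "(\<sigma> s, t) \<in> U" "C_inf_on U g"
      "\<And>r x. r \<in> {0..1} \<Longrightarrow> (r, x) \<in> U \<Longrightarrow> \<Gamma> r (circ x) = g (r, x)"
      using extend[OF sigma_range] by blast
    define W where "W = (\<lambda>z. (\<sigma> (fst z), snd z)) -` U"
    have sig: "C_inf_on UNIV (\<lambda>z::real \<times> real. (\<sigma> (fst z), snd z))"
      by (intro C_inf_intros C_inf_on_compose[OF C_inf_sigma]) auto
    have "open W" unfolding W_def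
      using C_inf_on_imp_continuous_on[OF sig] U(1) by (intro open_vimage)
    have "C_inf_on W (\<lambda>z. g (\<sigma> (fst z), snd z))"
      by (rule C_inf_on_compose[OF U(3) C_inf_on_subset[OF sig \<open>open W\<close>]]) (auto simp: W_def)
    then have "C_inf_on W (\<lambda>(s, t). \<Gamma> (\<sigma> s) (circ t))"
      by (rule C_inf_on_cong) (use U(4) sigma_range in \<open>auto simp: W_def\<close>)
    moreover have "z \<in> W" using U(2) by (simp add: W_def z)
    ultimately show "\<exists>V. z \<in> V \<and> C_inf_on V (\<lambda>(s, t). \<Gamma> (\<sigma> s) (circ t))" by blast
  qed
qed

lemma norm_cs_le:
  assumes "s \<in> {0..1}"
  shows "norm (cs (s, t)) \<le> \<sigma>' s * speed (\<sigma> s)"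
proof -
  have 1: "(\<sigma> has_vector_derivative \<sigma>' s) (at s within UNIV)"
    using sigma_deriv has_real_derivative_iff_has_vector_derivative by blast
  \<comment> \<open>\<open>\<Gamma>\<close> is differentiated within [0,1] only; as all values of
    \<open>\<sigma>\<close> lie there, the chain rule relative to the image of
    \<open>\<sigma>\<close> applies at every time.\<close>
  have "((\<lambda>r. \<Gamma> r (circ t)) has_vector_derivative velocity (\<sigma> s) (circ t)) (at (\<sigma> s) within \<sigma> ` UNIV)"
    by (rule has_vector_derivative_within_subset[OF velocity]) (use sigma_range in auto)
  from vector_diff_chain_within[OF 1 this]
  have "((\<lambda>s. c (s, t)) has_vector_derivative \<sigma>' s *\<^sub>R velocity (\<sigma> s) (circ t)) (at s)"
    by (simp add: o_def c_def)
  then have "cs (s, t) = \<sigma>' s *\<^sub>R velocity (\<sigma> s) (circ t)"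
    using c_deriv_s[of t s UNIV] vector_derivative_unique_at by blast
  then show ?thesis
    using velocity_le_speed[OF sigma_range, of s "circ t"] sigma'_nonneg[OF assms]
    by (simp add: mult_left_mono)
qed

section \<open>Path from the identity to the comparison map\<close>

definition inverse_map :: "phase \<Rightarrow> phase" where
  "inverse_map x = rev_momentum (billiard_map \<alpha> (rev_momentum x))"

text \<open>Following the path of iterates by the fixed inverse of its initial map gives a path from
  the identity to \<open>\<phi>\<close>. The fixed factor has Hamiltonian zero, so the bound
  obtained for the iterates carries over to the new path.\<close>

lemma comparison_map:
  fixes n :: nat
  defines "\<phi> \<equiv> (inverse_map ^^ n) \<circ> (billiard_map \<beta> ^^ n)"
  shows "\<phi> \<in> Ham" "d_H id \<phi> \<le> ereal (4 * real n * homotopy_length \<Gamma>)"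
    "\<And>x. x \<in> annulus \<Longrightarrow> (billiard_map \<alpha> ^^ n) (\<phi> x) = (billiard_map \<beta> ^^ n) x"
proof -
  let ?B = "\<lambda>s. 2 * (\<sigma>' s * speed (\<sigma> s))"
  let ?\<psi> = "\<lambda>s. billiard_map (\<Gamma> (\<sigma> s)) ^^ n"
  let ?\<theta> = "\<lambda>s. (\<lambda>x. rev_momentum (billiard_map (\<Gamma> (\<sigma> s)) (rev_momentum x))) ^^ n"
  have ends: "\<Gamma> 0 = \<alpha>" "\<Gamma> 1 = \<beta>" using homotopy by (simp_all add: table_homotopy_def)
  have "\<bar>\<eta> s x\<bar> \<le> ?B s" if "s \<in> {0..1}" "x \<in> annulus" for s x
    using eta_bound[OF that(2) norm_cs_le[OF that(1)]] .
  from ham_isotopy_funpow[OF ham_isotopy_billiard this, of n]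
  obtain \<Psi> \<Phi> \<eta>' where I: "ham_isotopy ?\<psi> ?\<theta> \<Psi> \<Phi> \<eta>'"
    and bound: "\<And>s x. s \<in> {0..1} \<Longrightarrow> x \<in> annulus \<Longrightarrow> \<bar>\<eta>' s x\<bar> \<le> real n * ?B s"
    by blast
  interpret I: ham_isotopy ?\<psi> ?\<theta> \<Psi> \<Phi> \<eta>' by (rule I)
  have inv: "?\<theta> 0 = inverse_map ^^ n" by (simp add: ends inverse_map_def[abs_def])
  note J = ham_isotopy_compose[OF I ham_isotopy_inverse_constant[OF I]]
  \<comment> \<open>The Hamiltonian that \<open>ham_isotopy.generates\<close> yields for
    \<open>J\<close>: the pulled back one at the preimage of \<open>x\<close> under the path. The
    summand 0 comes from the fixed factor.\<close>
  define H where "H = (\<lambda>s x. 0 + \<eta>' s ((?\<theta> s \<circ> ?\<psi> 0) x))"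
  define path where "path = (\<lambda>s. ?\<theta> 0 \<circ> ?\<psi> s)"
  have gen: "generates H path" unfolding H_def path_def using ham_isotopy.generates[OF J] .
  have joins: "joins path id \<phi>"
    using I.inverse_maps(1)[of _ 0] by (simp add: joins_def path_def \<phi>_def ends inverse_map_def[abs_def])
  then show "\<phi> \<in> Ham" using gen by (auto simp: Ham_def hamiltonian_path_def)
  have H_bound: "\<bar>H s x\<bar> \<le> real n * ?B s" if "s \<in> {0..1}" "x \<in> annulus" for s x
    using bound[OF that(1) I.in_annulus(2)[OF I.in_annulus(1)[OF that(2), of 0], of s]] by (simp add: H_def)
  let ?osc = "\<lambda>s. (SUP x\<in>annulus. H s x) - (INF x\<in>annulus. H s x)"
  have osc: "?osc s \<le> 4 * real n * (\<sigma>' s * speed (\<sigma> s))" if "s \<in> {0..1}" for s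
  proof -
    have ne: "annulus \<noteq> {}" by (auto simp: annulus_def intro!: exI[of _ 0])
    have "(SUP x\<in>annulus. H s x) \<le> real n * ?B s"
      using H_bound[OF that] by (intro cSUP_least[OF ne]) (auto simp: abs_le_iff)
    moreover have "- (real n * ?B s) \<le> (INF x\<in>annulus. H s x)"
      using H_bound[OF that] by (intro cINF_greatest[OF ne]) (fastforce simp: abs_le_iff)
    ultimately show ?thesis by simp
  qed
  have int: "((\<lambda>s. 4 * real n * (\<sigma>' s * speed (\<sigma> s))) has_integral 4 * real n * homotopy_length \<Gamma>) {0..1}"
    using has_integral_mult_right[OF homotopy_length] .
  have "hofer_length H \<le> 4 * real n * homotopy_length \<Gamma>"
  proof (cases "?osc integrable_on {0..1}")
    case True
    then have "hofer_length H \<le> integral {0..1} (\<lambda>s. 4 * real n * (\<sigma>' s * speed (\<sigma> s)))"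
      unfolding hofer_length_def using int osc by (intro integral_le) auto
    then show ?thesis unfolding integral_unique[OF int] .
  next
    \<comment> \<open>Here the integral defining the Hofer length has the default value 0, so it
      remains to see that the right-hand side is nonnegative.\<close>
    case False
    have "0 \<le> 4 * real n * homotopy_length \<Gamma>"
    proof (rule has_integral_nonneg[OF int])
      fix s :: real assume s: "s \<in> {0..1}"
      have "0 \<le> norm (cs (s, 0))" by simp
      also have "\<dots> \<le> \<sigma>' s * speed (\<sigma> s)" by (rule norm_cs_le[OF s])
      finally show "0 \<le> 4 * real n * (\<sigma>' s * speed (\<sigma> s))" by simp
    qed
    then show ?thesis using False by (simp add: hofer_length_def not_integrable_integral)
  qed
  moreover have "d_H id \<phi> \<le> ereal (hofer_length H)"
    unfolding d_H_def using gen joins by (intro INF_lower2[of "(H, path)"]) auto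
  ultimately show "d_H id \<phi> \<le> ereal (4 * real n * homotopy_length \<Gamma>)"
    by (meson ereal_less_eq(3) order_trans)
  show "(billiard_map \<alpha> ^^ n) (\<phi> x) = (billiard_map \<beta> ^^ n) x" if "x \<in> annulus" for x
    using I.inverse_maps(2)[OF I.in_annulus(1)[OF that, of 1], of 0] by (simp add: \<phi>_def inv[symmetric] ends)
qed

end

theorem corollary3p4:
  fixes X :: "phase set" and n :: nat and \<alpha> \<beta> :: "circle \<Rightarrow> real^2"
  assumes "X \<subseteq> annulus"
    and "displacement_energy X > 0"
    and "n > 0"
    and "\<alpha> \<in> billiard_tables"
    and "\<beta> \<in> billiard_tables"
    and "d_B \<alpha> \<beta> < displacement_energy X / ereal (4 * real n)"
  shows "\<exists>x\<in>X. (billiard_map \<beta> ^^ n) x \<in> (billiard_map \<alpha> ^^ n) ` X"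
proof -
  obtain \<Gamma> where "table_homotopy \<alpha> \<beta> \<Gamma>"
    and less: "ereal (homotopy_length \<Gamma>) < displacement_energy X / ereal (4 * real n)"
    using assms(6) unfolding d_B_def INF_less_iff by auto
  then interpret homotopy \<alpha> \<beta> \<Gamma> by unfold_locales
  define \<phi> where "\<phi> = (inverse_map ^^ n) \<circ> (billiard_map \<beta> ^^ n)"
  note \<phi> = comparison_map[where n = n, folded \<phi>_def]
  \<comment> \<open>The case distinction on the extended real energy includes the infinite
    value.\<close>
  have "ereal (4 * real n * homotopy_length \<Gamma>) < displacement_energy X"
    using less assms(2,3) by (cases "displacement_energy X") (auto simp: field_simps)
  then have "\<not> displacement_energy X \<le> d_H id \<phi>" using \<phi>(2) by auto
  then have "\<phi> ` X \<inter> X \<noteq> {}"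
    using \<phi>(1) unfolding displacement_energy_def by (metis (mono_tags, lifting) INF_lower mem_Collect_eq)
  \<comment> \<open>The image of \<open>x\<close> under the \<open>n\<close>-th iterate for
    \<open>\<beta>\<close> is the image of \<open>\<phi> x\<close>, again a point of
    \<open>X\<close>, under the \<open>n\<close>-th iterate for \<open>\<alpha>\<close>.\<close>
  then obtain x where "x \<in> X" "\<phi> x \<in> X" by auto
  then show ?thesis using \<phi>(3)[of x] assms(1) by (metis image_eqI subsetD)
qed

end
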